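(* Let $l\ge 1$ and $1\le n_1<n_2<\cdots<n_l$ be integers with $n_l\ge 2$, and let $k_1,\dots,k_l$ be positive integers. Let $X$ be a bubble space consisting of a sphere $S^{n_l}$ together with $k_j$ disks of dimension $n_j$ for each $j<l$ and $k_l-1$ disks of dimension $n_l$, so that $k_j=\dim_{\mathbb{Q}}H_{n_j}(X;\mathbb{Q})$ for every $j\in\{1,\dots,l\}$. Let $f:X\to X$ be a continuous map. For each $j$ let $p_j(x)=\det(f_{\ast n_j}-x\,\mathrm{Id})$ be the characteristic polynomial of the linear map $f_{\ast n_j}$ induced by $f$ on $H_{n_j}(X;\mathbb{Q})\cong\mathbb{Q}^{k_j}$. Let $RO$ be the union (with multiplicity) of the non-zero complex roots of the polynomials $p_j$ with $n_j$ odd, and let $RE$ be the union (with multiplicity) of the non-zero complex roots of the polynomials $p_j$ with $n_j$ even. Then $L(f^m,X)=0$ for all integers $m\ge 1$ if and only if the following two conditions are satisfied: (1) the product of $(-1)^{\sum_{j:\,n_j\text{ odd}}k_j}$ and the last terms of all the polynomials $p_j$ with $n_j$ odd equals the product of $(-1)^{1+\sum_{j:\,n_j\text{ even}}k_j}$ and the last terms of all the polynomials $p_j$ with $n_j$ even; (2) $RO$ is a permutation of $\{1\}\cup RE$ (equality as multisets).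
   Context: Bubble spaces. A bubble space is obtained recursively as follows. Start with a sphere $S^n$, $n\ge 2$. Glue a disk $D^{d_1}$, $1\le d_1\le n$, along an embedding $\partial D^{d_1}=S^{d_1-1}\to S^n$ (i.e. take the pushout of $D^{d_1}\hookleftarrow S^{d_1-1}\to S^n$). At each following step glue a further disk $D^{d}$ along an embedding of its boundary $\partial D^d$ either into the original sphere $S^n$ minus the images of the boundaries of the previously attached disks (with $1\le d\le n$), or into the interior of a previously attached disk $D^{d'}$ (with $1\le d\le d'$), away from the images of the boundaries of previously attached disks. The result of repeating this a finite number of times is a bubble space; it is said to consist of the sphere $S^n$ and the attached disks. Spaces are assumed to be connected simplicial complexes. The rational homology of such an $X$ is that of the wedge of $S^n$ with one sphere $S^{d}$ for each attached disk $D^{d}$; in the situation of the claim, $H_{n_j}(X;\mathbb{Q})\cong\mathbb{Q}^{k_j}$ for each $j$, $H_0(X;\mathbb{Q})\cong\mathbb{Q}$, and all other rational homology groups vanish. Last term. For a non-zero polynomial $a_nx^n+\cdots+a_ix^i$, written with exponents $n>\cdots>i\ge 0$ and with $a_i\ne 0$, its last term is the coefficient $a_i$ (the non-zero coefficient of lowest degree). Lefschetz number. For a continuous map $g:X\to X$, $L(g,X)=\sum_{k\ge 0}(-1)^k\operatorname{tr}\big(g_{\ast k}:H_k(X;\mathbb{Q})\to H_k(X;\mathbb{Q})\big)$; $f^m$ is the $m$-th iterate of $f$. Empty products are $1$ and empty sums are $0$. *)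

theory Defs
  imports "HOL-Homology.Homology" "HOL-Analysis.Polytope" "Jordan_Normal_Form.Determinant"
begin

section \<open>Bubble spaces\<close>

text \<open>
  The closed unit disk \<open>D\<^sup>d\<close>, in the same ambient type as the library's \<open>nsphere\<close>. For \<open>d \<ge> 1\<close>
  its boundary sphere is \<open>nsphere (d - 1)\<close>.
\<close>
definition ndisk :: "nat \<Rightarrow> (nat \<Rightarrow> real) topology" where
  "ndisk d = subtopology (Euclidean_space d) {x. (\<Sum>i<d. (x i)\<^sup>2) \<le> 1}"

definition disk_boundary :: "nat \<Rightarrow> (nat \<Rightarrow> real) set" where
  "disk_boundary d = topspace (nsphere (d - 1))"

text \<open>
  The pushout of \<open>D \<supseteq> A \<rightarrow> X\<close>, realised on the set \<open>topspace X \<union> j ` topspace D\<close>, where \<open>j\<close> is the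
  attaching map on \<open>A\<close> and is injective with values outside \<open>topspace X\<close> on the rest of \<open>D\<close>. The
  topology is the quotient topology from the disjoint union, that is, the finest one making the
  inclusion of \<open>X\<close> and the map \<open>j\<close> continuous.
\<close>
definition glue :: "'a topology \<Rightarrow> 'b topology \<Rightarrow> ('b \<Rightarrow> 'a) \<Rightarrow> 'a topology" where
  "glue X D j = topology (\<lambda>U. U \<subseteq> topspace X \<union> j ` topspace D \<and>
      openin X (U \<inter> topspace X) \<and> openin D {x \<in> topspace D. j x \<in> U})"

lemma openin_glue:
  "openin (glue X D j) U \<longleftrightarrow> U \<subseteq> topspace X \<union> j ` topspace D \<and>
      openin X (U \<inter> topspace X) \<and> openin D {x \<in> topspace D. j x \<in> U}"
proof -
  have "istopology (\<lambda>U. U \<subseteq> topspace X \<union> j ` topspace D \<and>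
      openin X (U \<inter> topspace X) \<and> openin D {x \<in> topspace D. j x \<in> U})"
    unfolding istopology_def
  proof (rule conjI; intro allI impI conjI)
    fix S T
    assume S: "S \<subseteq> topspace X \<union> j ` topspace D \<and> openin X (S \<inter> topspace X) \<and>
        openin D {x \<in> topspace D. j x \<in> S}"
      and T: "T \<subseteq> topspace X \<union> j ` topspace D \<and> openin X (T \<inter> topspace X) \<and>
        openin D {x \<in> topspace D. j x \<in> T}"
    show "S \<inter> T \<subseteq> topspace X \<union> j ` topspace D"
      using S by blast
    have "S \<inter> T \<inter> topspace X = (S \<inter> topspace X) \<inter> (T \<inter> topspace X)"
      by blast
    then show "openin X (S \<inter> T \<inter> topspace X)"
      using S T by (simp only: openin_Int)
    have "{x \<in> topspace D. j x \<in> S \<inter> T} = {x \<in> topspace D. j x \<in> S} \<inter> {x \<in> topspace D. j x \<in> T}"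
      by blast
    then show "openin D {x \<in> topspace D. j x \<in> S \<inter> T}"
      using S T by (simp only: openin_Int)
  next
    fix K
    assume K: "\<forall>S\<in>K. S \<subseteq> topspace X \<union> j ` topspace D \<and> openin X (S \<inter> topspace X) \<and>
        openin D {x \<in> topspace D. j x \<in> S}"
    show "\<Union>K \<subseteq> topspace X \<union> j ` topspace D"
      using K by blast
    have "openin X (\<Union>S\<in>K. S \<inter> topspace X)"
      using K by (intro openin_Union) blast
    moreover have "\<Union>K \<inter> topspace X = (\<Union>S\<in>K. S \<inter> topspace X)"
      by blast
    ultimately show "openin X (\<Union>K \<inter> topspace X)"
      by (simp only:)
    have "openin D (\<Union>S\<in>K. {x \<in> topspace D. j x \<in> S})"
      using K by (intro openin_Union) blast
    moreover have "{x \<in> topspace D. j x \<in> \<Union>K} = (\<Union>S\<in>K. {x \<in> topspace D. j x \<in> S})"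
      by blast
    ultimately show "openin D {x \<in> topspace D. j x \<in> \<Union>K}"
      by (simp only:)
  qed
  then show ?thesis
    unfolding glue_def by (simp add: topology_inverse')
qed

lemma topspace_glue: "topspace (glue X D j) = topspace X \<union> j ` topspace D"
proof
  show "topspace (glue X D j) \<subseteq> topspace X \<union> j ` topspace D"
    using openin_topspace [of "glue X D j"] unfolding openin_glue by blast
  have "(topspace X \<union> j ` topspace D) \<inter> topspace X = topspace X"
    "{x \<in> topspace D. j x \<in> topspace X \<union> j ` topspace D} = topspace D"
    by blast+
  then have "openin (glue X D j) (topspace X \<union> j ` topspace D)"
    by (simp add: openin_glue)
  then show "topspace X \<union> j ` topspace D \<subseteq> topspace (glue X D j)"
    by (rule openin_subset)
qed

lemma continuous_map_from_glue:
  "continuous_map (glue X D j) Z h \<longleftrightarrow> continuous_map X Z h \<and> continuous_map D Z (h \<circ> j)"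
proof (intro iffI conjI)
  have 1: "{x \<in> topspace (glue X D j). h x \<in> U} \<inter> topspace X = {x \<in> topspace X. h x \<in> U}" for U
    by (auto simp: topspace_glue)
  have 2: "{x \<in> topspace D. j x \<in> {y \<in> topspace (glue X D j). h y \<in> U}} =
      {x \<in> topspace D. (h \<circ> j) x \<in> U}" for U
    by (auto simp: topspace_glue)
  {
    assume h: "continuous_map (glue X D j) Z h"
    have pre: "openin (glue X D j) {y \<in> topspace (glue X D j). h y \<in> U}" if "openin Z U" for U
      using h that by (rule openin_continuous_map_preimage)
    have into: "\<And>y. y \<in> topspace X \<union> j ` topspace D \<Longrightarrow> h y \<in> topspace Z"
      using continuous_map_funspace [OF h] by (auto simp: topspace_glue)
    have "openin X {x \<in> topspace X. h x \<in> U}" if "openin Z U" for U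
      using pre [OF that] unfolding openin_glue 1 by blast
    moreover have "h \<in> topspace X \<rightarrow> topspace Z"
      using into by simp
    ultimately show "continuous_map X Z h"
      unfolding continuous_map_def by blast
    have "openin D {x \<in> topspace D. (h \<circ> j) x \<in> U}" if "openin Z U" for U
      using pre [OF that] unfolding openin_glue 2 by blast
    moreover have "h \<circ> j \<in> topspace D \<rightarrow> topspace Z"
      using into by simp
    ultimately show "continuous_map D Z (h \<circ> j)"
      unfolding continuous_map_def by blast
  }
  assume h: "continuous_map X Z h \<and> continuous_map D Z (h \<circ> j)"
  have "openin (glue X D j) {y \<in> topspace (glue X D j). h y \<in> U}" if "openin Z U" for U
  proof -
    have "openin X {x \<in> topspace X. h x \<in> U}" "openin D {x \<in> topspace D. (h \<circ> j) x \<in> U}"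
      using h [THEN conjunct1] h [THEN conjunct2] that by (simp_all only: openin_continuous_map_preimage)
    moreover have "{y \<in> topspace (glue X D j). h y \<in> U} \<subseteq> topspace X \<union> j ` topspace D"
      unfolding topspace_glue by blast
    ultimately show ?thesis
      unfolding openin_glue 1 2 by blast
  qed
  moreover have "h y \<in> topspace Z" if "y \<in> topspace (glue X D j)" for y
    using that h [THEN conjunct1, THEN continuous_map_funspace, THEN funcset_mem, of y]
      h [THEN conjunct2, THEN continuous_map_funspace, THEN funcset_mem]
    unfolding topspace_glue by (elim UnE imageE) simp_all
  ultimately show "continuous_map (glue X D j) Z h"
    unfolding continuous_map_def by blast
qed

text \<open>
  \<open>bubble_model n ds X B\<close>: the space \<open>X\<close> is obtained from \<open>S\<^sup>n\<close> by successively gluing disks of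
  dimensions \<open>ds ! 0, ds ! 1, \<dots>\<close>, and \<open>B\<close> is the union of the images of the boundaries of these
  disks. The points of the original sphere are the pairs \<open>(0, x)\<close>; the interior points of the disk
  of dimension \<open>ds ! i\<close> are the pairs \<open>(Suc i, x)\<close>. Thus the dimension of the piece with label \<open>i\<close>
  is \<open>(n # ds) ! i\<close>.
\<close>
inductive bubble_model ::
    "nat \<Rightarrow> nat list \<Rightarrow> (nat \<times> (nat \<Rightarrow> real)) topology \<Rightarrow> (nat \<times> (nat \<Rightarrow> real)) set \<Rightarrow> bool"
  for n :: nat where
  sphere: "n \<ge> 2 \<Longrightarrow> bubble_model n [] (prod_topology (discrete_topology {0}) (nsphere n)) {}"
| attach: "\<lbrakk>bubble_model n ds X B;
     i \<le> length ds; 1 \<le> d; d \<le> (n # ds) ! i;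
     embedding_map (nsphere (d - 1)) X \<phi>;
     \<phi> ` disk_boundary d \<subseteq> {i} \<times> UNIV - B\<rbrakk>
   \<Longrightarrow> bubble_model n (ds @ [d])
         (glue X (ndisk d) (\<lambda>x. if x \<in> disk_boundary d then \<phi> x else (Suc (length ds), x)))
         (B \<union> \<phi> ` disk_boundary d)"

definition bubble_space :: "nat \<Rightarrow> nat multiset \<Rightarrow> 'a topology \<Rightarrow> bool" where
  "bubble_space n M X \<longleftrightarrow>
     (\<exists>ds Y B. bubble_model n ds Y B \<and> mset ds = M \<and> X homeomorphic_space Y)"

section \<open>Singular homology with rational coefficients\<close>

text \<open>
  The library's singular homology has integer coefficients; the following repeats its construction
  over the rationals, with the library's singular simplices, faces and simplex maps.
\<close>

type_synonym 'a rat_chain = "((nat \<Rightarrow> real) \<Rightarrow> 'a) \<Rightarrow>\<^sub>0 rat"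

definition rscale :: "rat \<Rightarrow> ('b \<Rightarrow>\<^sub>0 rat) \<Rightarrow> ('b \<Rightarrow>\<^sub>0 rat)" where
  "rscale q c = Poly_Mapping.map ((*) q) c"

definition rextend :: "('b \<Rightarrow> ('c \<Rightarrow>\<^sub>0 rat)) \<Rightarrow> ('b \<Rightarrow>\<^sub>0 rat) \<Rightarrow> ('c \<Rightarrow>\<^sub>0 rat)" where
  "rextend g c = (\<Sum>s\<in>Poly_Mapping.keys c. rscale (Poly_Mapping.lookup c s) (g s))"

definition rat_chain_set :: "nat \<Rightarrow> 'a topology \<Rightarrow> 'a rat_chain set" where
  "rat_chain_set p X = {c. Poly_Mapping.keys c \<subseteq> singular_simplex_set p X}"

definition rat_chain_boundary :: "nat \<Rightarrow> 'a rat_chain \<Rightarrow> 'a rat_chain" where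
  "rat_chain_boundary p c = (if p = 0 then 0 else
     rextend (\<lambda>s. \<Sum>k\<le>p. Poly_Mapping.single (singular_face p k s) ((-1) ^ k)) c)"

definition rat_chain_map :: "nat \<Rightarrow> ('a \<Rightarrow> 'b) \<Rightarrow> 'a rat_chain \<Rightarrow> 'b rat_chain" where
  "rat_chain_map p g = rextend (\<lambda>s. Poly_Mapping.single (simplex_map p g s) 1)"

definition rat_cycles :: "nat \<Rightarrow> 'a topology \<Rightarrow> 'a rat_chain set" where
  "rat_cycles p X = {c \<in> rat_chain_set p X. rat_chain_boundary p c = 0}"

definition rat_boundaries :: "nat \<Rightarrow> 'a topology \<Rightarrow> 'a rat_chain set" where
  "rat_boundaries p X = rat_chain_boundary (Suc p) ` rat_chain_set (Suc p) X"

definition rat_class :: "nat \<Rightarrow> 'a topology \<Rightarrow> 'a rat_chain \<Rightarrow> 'a rat_chain set" where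
  "rat_class p X z = {w \<in> rat_cycles p X. w - z \<in> rat_boundaries p X}"

definition rat_homology :: "nat \<Rightarrow> 'a topology \<Rightarrow> 'a rat_chain set set" where
  "rat_homology p X = rat_class p X ` rat_cycles p X"

definition rat_hom_induced ::
    "nat \<Rightarrow> 'a topology \<Rightarrow> 'b topology \<Rightarrow> ('a \<Rightarrow> 'b) \<Rightarrow> 'a rat_chain set \<Rightarrow> 'b rat_chain set" where
  "rat_hom_induced p X Y g c = (\<Union>z\<in>c. rat_class p Y (rat_chain_map p g z))"

section \<open>Trace and characteristic polynomial on rational homology\<close>

text \<open>
  The linear combination of the classes of the cycles \<open>zs\<close> with coefficients \<open>v\<close>. The vector space
  structure on homology is the quotient one, so this is the class of the linear combination of the
  cycles.
\<close>
definition rat_lincomb ::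
    "nat \<Rightarrow> 'a topology \<Rightarrow> 'a rat_chain list \<Rightarrow> (nat \<Rightarrow> rat) \<Rightarrow> 'a rat_chain set" where
  "rat_lincomb p X zs v = rat_class p X (\<Sum>i<length zs. rscale (v i) (zs ! i))"

definition rat_hom_basis :: "nat \<Rightarrow> 'a topology \<Rightarrow> 'a rat_chain list \<Rightarrow> bool" where
  "rat_hom_basis p X zs \<longleftrightarrow> set zs \<subseteq> rat_cycles p X \<and>
     (\<forall>c \<in> rat_homology p X. \<exists>!v. v \<in> {..<length zs} \<rightarrow>\<^sub>E UNIV \<and> c = rat_lincomb p X zs v)"

definition rat_hom_matrix ::
    "nat \<Rightarrow> 'a topology \<Rightarrow> ('a \<Rightarrow> 'a) \<Rightarrow> 'a rat_chain list \<Rightarrow> rat mat \<Rightarrow> bool" where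
  "rat_hom_matrix p X f zs A \<longleftrightarrow> A \<in> carrier_mat (length zs) (length zs) \<and>
     (\<forall>j<length zs. rat_hom_induced p X X f (rat_class p X (zs ! j)) =
        rat_lincomb p X zs (\<lambda>i. A $$ (i, j)))"

text \<open>
  The determinant of \<open>A - x I\<close>. This is not always monic: it differs from the library's \<open>char_poly\<close>,
  the determinant of \<open>x I - A\<close>, by the sign \<open>(-1)\<^sup>k\<close> where \<open>k\<close> is the size of \<open>A\<close>.
\<close>
definition det_minus_x :: "rat mat \<Rightarrow> rat poly" where
  "det_minus_x A = Determinant.det
     (map_mat (\<lambda>a. [:a:]) A - [:0, 1:] \<cdot>\<^sub>m 1\<^sub>m (dim_row A))"

text \<open>
  Trace and characteristic polynomial do not depend on the basis, so the definite descriptions below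
  are well defined whenever the homology space is finite-dimensional.
\<close>
definition rat_hom_trace :: "nat \<Rightarrow> 'a topology \<Rightarrow> ('a \<Rightarrow> 'a) \<Rightarrow> rat" where
  "rat_hom_trace p X f = (THE t. \<exists>zs A. rat_hom_basis p X zs \<and> rat_hom_matrix p X f zs A \<and>
     t = (\<Sum>i<length zs. A $$ (i, i)))"

definition rat_hom_charpoly :: "nat \<Rightarrow> 'a topology \<Rightarrow> ('a \<Rightarrow> 'a) \<Rightarrow> rat poly" where
  "rat_hom_charpoly p X f = (THE P. \<exists>zs A. rat_hom_basis p X zs \<and> rat_hom_matrix p X f zs A \<and>
     P = det_minus_x A)"

text \<open>
  \<open>Sum_any\<close> is the sum over the indices with non-zero summand; there are finitely many of these when
  the total rational homology is finite-dimensional.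
\<close>
definition lefschetz_number :: "('a \<Rightarrow> 'a) \<Rightarrow> 'a topology \<Rightarrow> rat" where
  "lefschetz_number g X = Sum_any (\<lambda>k. (-1) ^ k * rat_hom_trace k X g)"

section \<open>Last terms and roots\<close>

definition last_term :: "'a::zero poly \<Rightarrow> 'a" where
  "last_term p = coeff p (LEAST i. coeff p i \<noteq> 0)"

definition nonzero_complex_roots :: "rat poly \<Rightarrow> complex multiset" where
  "nonzero_complex_roots p = filter_mset (\<lambda>z. z \<noteq> 0) (proots (map_poly of_rat p))"

end

theory Submission
  imports Defs "Jordan_Normal_Form.Schur_Decomposition"
begin

text \<open>
  By path-connectedness the trace on \<open>H\<^sub>0\<close> is 1, so \<open>L(f\<^sup>m)\<close> is the difference of the \<open>m\<close>-th power sums of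
  \<open>{1} \<union> RE\<close> and of \<open>RO\<close>. The power sums of all orders \<open>m \<ge> 1\<close> determine a multiset of non-zero
  numbers, so all \<open>L(f\<^sup>m)\<close> vanish iff condition (2) holds. Up to the sign \<open>(-1)\<^sup>k\<close>, the last term
  of a characteristic polynomial of degree \<open>k\<close> is the product of the negatives of its non-zero
  roots; hence (2) implies (1).

  The homology of a bubble space is computed by induction on the attached disks. For \<open>Y = X \<union> D\<^sup>d\<close>,
  excision identifies \<open>H(Y, X)\<close> with \<open>H(D\<^sup>d, S\<^sup>d\<^sup>-\<^sup>1)\<close>. The connecting map to \<open>H(X)\<close> vanishes because
  the attaching map factors through a sphere or disk whose reduced homology is zero in degree
  \<open>d - 1\<close>, so a basis of the homology of \<open>X\<close> is completed by one class in degree \<open>d\<close>. The argument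
  needs each stage to be Hausdorff; as subspaces of the final polyhedron, all stages are.
  A basis of integral homology made of integral cycles is a basis of rational homology,
  by clearing denominators.
\<close>

section \<open>Eigenvalues and power sums\<close>

text \<open>The exact sequence of a pair, excision and the homology of spheres are used with integer
  coefficients. The passage to the rationals happens at the level of chains: integral homology is
  shown to be free on an explicit list of cycles, and freeness persists because an attachment adds
  either nothing or one infinite cyclic summand that splits off.

  The geometric obstacle is that excision wants open sets, while the old space and the boundary
  sphere are closed. Both are enlarged to the complement of the centre of the disk, which deforms
  back onto them. For this the disk must sit in the new space as a closed subspace; here
  compactness, injectivity of the attaching map and the Hausdorff property meet.

  The restriction d \<le> d' on disks attached to a piece of dimension d' gives d - 1 < d', so the
  boundary sphere cannot detect homology of the piece. Reduced homology lets d = 1, with its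
  two-point boundary, follow the same line.

  Trace and characteristic polynomial are definite descriptions; similarity of the matrices in any
  two bases must be established before a value can be read off.\<close>

lemma sum_diag_mult_commute:
  fixes A B :: "'a::comm_semiring_0 mat"
  assumes "A \<in> carrier_mat n m" "B \<in> carrier_mat m n"
  shows "(\<Sum>i<n. (A * B) $$ (i, i)) = (\<Sum>i<m. (B * A) $$ (i, i))"
proof -
  have "(\<Sum>i<n. (A * B) $$ (i, i)) = (\<Sum>i<n. \<Sum>j<m. A $$ (i, j) * B $$ (j, i))"
    using assms by (intro sum.cong) (auto simp: scalar_prod_def lessThan_atLeast0 intro!: sum.cong)
  also have "\<dots> = (\<Sum>j<m. \<Sum>i<n. B $$ (j, i) * A $$ (i, j))"
    by (subst sum.swap) (simp add: mult.commute)
  also have "\<dots> = (\<Sum>i<m. (B * A) $$ (i, i))"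
    using assms by (intro sum.cong) (auto simp: scalar_prod_def lessThan_atLeast0 intro!: sum.cong)
  finally show ?thesis .
qed

text \<open>The two identity matrices are products of the same rectangular factors in opposite
  order, so their traces agree; in characteristic 0 these traces determine the sizes. This shows
  that two bases of a homology space have the same length.\<close>

lemma invertible_mat_imp_square:
  fixes A B :: "'a::field_char_0 mat"
  assumes "A \<in> carrier_mat n m" "B \<in> carrier_mat m n" "A * B = 1\<^sub>m n" "B * A = 1\<^sub>m m"
  shows "n = m"
proof -
  have "of_nat n = (of_nat m :: 'a)"
    using sum_diag_mult_commute [OF assms(1,2)] unfolding assms(3,4) by simp
  then show ?thesis
    by simp
qed

lemma det_minus_x_eq_char_poly:
  assumes "A \<in> carrier_mat k k"
  shows "det_minus_x A = (-1) ^ k * char_poly A"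
proof -
  have "map_mat (\<lambda>a. [:a:]) A - [:0, 1:] \<cdot>\<^sub>m 1\<^sub>m (dim_row A) = (-1) \<cdot>\<^sub>m char_poly_matrix A"
    using assms by (intro eq_matI) (auto simp: char_poly_matrix_def)
  moreover have "dim_col (char_poly_matrix A) = k"
    using assms by (simp add: char_poly_matrix_def)
  ultimately show ?thesis
    unfolding det_minus_x_def char_poly_def by (simp only: det_smult)
qed

lemma sum_diag_similar:
  fixes A :: "'a::comm_semiring_1 mat"
  assumes "similar_mat_wit A B P Q" "A \<in> carrier_mat k k"
  shows "(\<Sum>i<k. A $$ (i, i)) = (\<Sum>i<k. B $$ (i, i))"
proof -
  have c: "B \<in> carrier_mat k k" "P \<in> carrier_mat k k" "Q \<in> carrier_mat k k"
    and QP: "Q * P = 1\<^sub>m k" and A: "A = P * B * Q"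
    using assms unfolding similar_mat_wit_def Let_def by auto
  have "(\<Sum>i<k. A $$ (i, i)) = (\<Sum>i<k. (Q * (P * B)) $$ (i, i))"
    unfolding A by (rule sum_diag_mult_commute) (use c in auto)
  also have "Q * (P * B) = B"
    using assoc_mult_mat [OF c(3) c(2) c(1)] QP c by simp
  finally show ?thesis .
qed

lemma upper_triangular_pow:
  fixes B :: "'a::comm_semiring_1 mat"
  assumes B: "B \<in> carrier_mat k k" "upper_triangular B"
  shows "upper_triangular (B ^\<^sub>m m) \<and> (\<forall>i<k. (B ^\<^sub>m m) $$ (i, i) = B $$ (i, i) ^ m)"
proof (induction m)
  case 0
  then show ?case using B by auto
next
  case (Suc m)
  let ?C = "B ^\<^sub>m m"
  have C: "?C \<in> carrier_mat k k" using B by simp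
  have CB: "(?C * B) $$ (i, j) = (\<Sum>r<k. ?C $$ (i, r) * B $$ (r, j))" if "i < k" "j < k" for i j
    using that B C by (auto simp: scalar_prod_def lessThan_atLeast0 intro!: sum.cong)
  \<comment> \<open>Only r with i \<le> r \<le> j can contribute to entry (i, j): no r at all below
    the diagonal, and just r = i on it.\<close>
  have low: "?C $$ (i, r) * B $$ (r, j) = 0" if "r < i \<or> j < r" "i < k" "r < k" for i j r
    using that B C Suc unfolding upper_triangular_def by auto
  have "(?C * B) $$ (i, j) = 0" if "j < i" "i < k" for i j
    unfolding CB [OF that(2) less_trans [OF that]] using that
    by (intro sum.neutral ballI low) auto
  then have "upper_triangular (?C * B)"
    using C B by (auto simp: upper_triangular_def)
  moreover have "(?C * B) $$ (i, i) = B $$ (i, i) ^ Suc m" if "i < k" for i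
  proof -
    have "(\<Sum>r<k. ?C $$ (i, r) * B $$ (r, i)) = (\<Sum>r\<in>{i}. ?C $$ (i, r) * B $$ (r, i))"
      using that by (intro sum.mono_neutral_right ballI low) auto
    then show ?thesis
      using that Suc CB [OF that that] by (simp add: mult.commute)
  qed
  ultimately show ?case by simp
qed

text \<open>Schur triangularisation over the complex numbers puts the m-th powers of the eigenvalues
  on the diagonal of the m-th power. The list \<open>es\<close> keeps zeros and multiplicities; the
  factors e - x carry the sign of det(A - x I).\<close>

lemma complex_eigenvalues:
  fixes A :: "rat mat"
  assumes A: "A \<in> carrier_mat k k"
  obtains es :: "complex list" where "length es = k"
    "map_poly of_rat (det_minus_x A) = (\<Prod>e\<leftarrow>es. [:e, -1:])"
    "\<And>m. of_rat (\<Sum>i<k. (A ^\<^sub>m m) $$ (i, i)) = (\<Sum>e\<leftarrow>es. e ^ m)"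
proof -
  let ?A = "map_mat of_rat A :: complex mat"
  have cA: "?A \<in> carrier_mat k k" using A by simp
  obtain es where es: "char_poly ?A = (\<Prod>a\<leftarrow>es. [:- a, 1:])" "length es = k"
    using char_poly_factorized [OF cA] by blast
  obtain B P Q where "schur_decomposition ?A es = (B, P, Q)"
    by (cases "schur_decomposition ?A es") auto
  from schur_decomposition [OF cA es(1) this]
  have sim: "similar_mat_wit ?A B P Q" and ut: "upper_triangular B" and diag: "diag_mat B = es"
    by auto
  have B: "B \<in> carrier_mat k k"
    by (rule similar_mat_witD2 [OF cA sim])
  have trace: "of_rat (\<Sum>i<k. (A ^\<^sub>m m) $$ (i, i)) = (\<Sum>e\<leftarrow>es. e ^ m)" for m
  proof -
    have "map_mat of_rat (A ^\<^sub>m m) = ?A ^\<^sub>m m"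
      by (rule of_rat_hom.mat_hom_pow [OF A])
    then have "of_rat (\<Sum>i<k. (A ^\<^sub>m m) $$ (i, i)) = (\<Sum>i<k. (?A ^\<^sub>m m) $$ (i, i))"
      using A by (simp add: of_rat_sum flip: \<open>map_mat of_rat (A ^\<^sub>m m) = _\<close>)
    also have "\<dots> = (\<Sum>i<k. (B ^\<^sub>m m) $$ (i, i))"
      by (rule sum_diag_similar [OF similar_mat_wit_pow [OF sim]]) (use cA in simp)
    also have "\<dots> = (\<Sum>i<k. (es ! i) ^ m)"
      using upper_triangular_pow [OF B ut, of m] B by (simp add: diag_mat_def flip: diag)
    also have "\<dots> = (\<Sum>e\<leftarrow>es. e ^ m)"
      using es(2) by (simp add: sum_list_sum_nth lessThan_atLeast0)
    finally show ?thesis .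
  qed
  have "map_poly of_rat (det_minus_x A) = (-1) ^ k * (\<Prod>a\<leftarrow>es. [:- a, 1:])"
    unfolding det_minus_x_eq_char_poly [OF A] es(1) [symmetric] of_rat_hom.char_poly_hom [OF A]
    by (cases "even k") (simp_all add: poly_eq_iff coeff_map_poly of_rat_minus)
  also have "\<dots> = (\<Prod>e\<leftarrow>es. [:e, -1:])"
    unfolding es(2) [symmetric]
  proof (induction es)
    case (Cons a es)
    have "(-1) ^ Suc (length es) * ([:- a, 1:] * q) = - [:- a, 1:] * ((-1) ^ length es * q)" for q :: "complex poly"
      by (simp only: power_Suc mult_minus_left mult_minus_right mult_1_left mult.left_commute)
    with Cons show ?case by simp
  qed simp
  finally show thesis
    using that es(2) trace by blast
qed

lemma proots_linear_factors: "proots (\<Prod>e\<leftarrow>es. [:e, -1:] :: 'a::idom poly) = mset es"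
proof (induction es)
  case (Cons e es)
  have "proots [:e, -1:] = proots (- [:e, -1:])"
    by (simp only: proots_uminus)
  also have "\<dots> = {#e#}"
    using proots_linear_factor [of "-e"] by simp
  finally have "proots [:e, -1:] = {#e#}" .
  moreover have "(\<Prod>e\<leftarrow>es. [:e, -1:]) \<noteq> 0"
    by (auto simp: prod_list_zero_iff)
  ultimately show ?case
    using Cons by (simp add: proots_mult del: mult_pCons_left)
qed simp

text \<open>For e = 0 the factor is -x, which raises the lowest exponent by one and changes the
  sign. Otherwise the lowest exponent stays, and the shifted term contributes nothing there.\<close>

lemma last_term_linear_mult:
  fixes p :: "'a::idom poly"
  assumes "p \<noteq> 0"
  shows "last_term ([:e, -1:] * p) = (if e = 0 then -1 else e) * last_term p"
proof -
  define i where "i = (LEAST i. coeff p i \<noteq> 0)"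
  have i: "coeff p i \<noteq> 0" and less: "\<And>j. j < i \<Longrightarrow> coeff p j = 0"
  proof -
    have "coeff p (degree p) \<noteq> 0"
      using assms by simp
    then show "coeff p i \<noteq> 0"
      unfolding i_def by (rule LeastI)
    show "coeff p j = 0" if "j < i" for j
      using not_less_Least [OF that [unfolded i_def]] by simp
  qed
  have lp: "last_term p = coeff p i"
    by (simp add: last_term_def i_def)
  show ?thesis
  proof (cases "e = 0")
    case True
    have "(LEAST i. coeff ([:e, -1:] * p) i \<noteq> 0) = Suc i"
      using True i less
      by (intro Least_equality) (auto simp: coeff_pCons Suc_le_eq not_less [symmetric] split: nat.splits)
    then show ?thesis
      using True by (simp add: last_term_def lp [unfolded last_term_def])
  next
    case False
    have c: "coeff ([:e, -1:] * p) j = e * coeff p j - (if j = 0 then 0 else coeff p (j - 1))" for j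
      by (cases j) auto
    have "(LEAST i. coeff ([:e, -1:] * p) i \<noteq> 0) = i"
    proof (rule Least_equality)
      show "coeff ([:e, -1:] * p) i \<noteq> 0"
        unfolding c using False i less [of "i - 1"] by (cases "i = 0") auto
      show "i \<le> y" if "coeff ([:e, -1:] * p) y \<noteq> 0" for y
      proof (rule ccontr)
        assume "\<not> i \<le> y"
        then show False using less [of y] less [of "y - 1"] that unfolding c by (auto split: if_splits)
      qed
    qed
    then show ?thesis
      unfolding lp using False less [of "i - 1"] by (cases "i = 0") (simp_all only: last_term_def c, auto)
  qed
qed

lemma last_term_map_poly_of_rat:
  "last_term (map_poly of_rat p :: complex poly) = of_rat (last_term p)"
  by (simp add: last_term_def)

text \<open>A zero eigenvalue contributes -1 to the last term and a non-zero e contributes e. One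
  sign per eigenvalue, k in all, cancels the former and turns the latter into -e.\<close>

lemma last_term_det_minus_x:
  assumes A: "A \<in> carrier_mat k k"
  shows "of_rat ((-1) ^ k * last_term (det_minus_x A)) =
    (\<Prod>z\<in>#nonzero_complex_roots (det_minus_x A). - z)"
proof -
  obtain es :: "complex list" where es: "length es = k"
    "map_poly of_rat (det_minus_x A) = (\<Prod>e\<leftarrow>es. [:e, -1:])"
    using complex_eigenvalues [OF A] by blast
  have "(-1) ^ length xs * last_term (\<Prod>e\<leftarrow>xs. [:e, -1:]) = (\<Prod>z\<in>#filter_mset (\<lambda>z. z \<noteq> 0) (mset xs). - z)"
    for xs :: "complex list"
  proof (induction xs)
    case Nil
    have "(LEAST i. coeff (1 :: complex poly) i \<noteq> 0) = 0"
      by (rule Least_equality) auto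
    then show ?case by (simp add: last_term_def)
  next
    case (Cons e xs)
    have "(\<Prod>e\<leftarrow>xs. [:e, -1:]) \<noteq> 0"
      by (auto simp: prod_list_zero_iff)
    with Cons show ?case
      by (simp add: last_term_linear_mult del: mult_pCons_left)
  qed
  from this [of es] show ?thesis
    unfolding nonzero_complex_roots_def es(2) proots_linear_factors
    unfolding es(1) [symmetric] es(2) [symmetric]
    by (simp add: of_rat_mult of_rat_power last_term_map_poly_of_rat)
qed

lemma sum_diag_pow_eq_power_sum:
  assumes A: "A \<in> carrier_mat k k" and m: "m \<ge> 1"
  shows "of_rat (\<Sum>i<k. (A ^\<^sub>m m) $$ (i, i)) =
    (\<Sum>z\<in>#nonzero_complex_roots (det_minus_x A). z ^ m)"
proof -
  obtain es :: "complex list" where es: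
    "map_poly of_rat (det_minus_x A) = (\<Prod>e\<leftarrow>es. [:e, -1:])"
    "of_rat (\<Sum>i<k. (A ^\<^sub>m m) $$ (i, i)) = (\<Sum>e\<leftarrow>es. e ^ m)"
    using complex_eigenvalues [OF A] by blast
  have "(\<Sum>e\<leftarrow>xs. e ^ m) = (\<Sum>z\<in>#filter_mset (\<lambda>z. z \<noteq> 0) (mset xs). z ^ m)" for xs :: "complex list"
    using m by (induction xs) auto
  then show ?thesis
    unfolding nonzero_complex_roots_def es proots_linear_factors .
qed

text \<open>Combinations of power sums of positive order are sums of values of polynomials x q(x).
  With q vanishing at every element other than w, such a sum is the multiplicity of w times w q(w),
  and w q(w) is non-zero because w is. Characteristic 0 then recovers the multiplicity.\<close>

lemma power_sums_determine_mset:
  fixes M N :: "'a::field_char_0 multiset"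
  assumes "0 \<notin># M" "0 \<notin># N"
    and eq: "\<And>m. m \<ge> 1 \<Longrightarrow> (\<Sum>z\<in>#M. z ^ m) = (\<Sum>z\<in>#N. z ^ m)"
  shows "M = N"
proof (rule multiset_eqI)
  fix w
  have poly_eq: "(\<Sum>z\<in>#M. poly (pCons 0 q) z) = (\<Sum>z\<in>#N. poly (pCons 0 q) z)" for q
  proof -
    have exp: "(\<Sum>z\<in>#L. poly (pCons 0 q) z) = (\<Sum>i\<le>degree q. coeff q i * (\<Sum>z\<in>#L. z ^ Suc i))" for L
    proof (induction L)
      case (add z L)
      have "poly (pCons 0 q) z = (\<Sum>i\<le>degree q. coeff q i * z ^ Suc i)"
        unfolding poly_pCons by (simp add: poly_altdef sum_distrib_left mult_ac)
      with add show ?case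
        by (simp add: sum.distrib distrib_left)
    qed simp
    show ?thesis
      unfolding exp using eq [of "Suc _"] by (simp only: le_add1 plus_1_eq_Suc)
  qed
  define F where "F = set_mset (M + N) - {w}"
  define q where "q = (\<Prod>u\<in>F. [:- u, 1:])"
  have F: "finite F" by (simp add: F_def)
  have q: "poly q z = (\<Prod>u\<in>F. z - u)" for z
    by (simp add: q_def poly_prod)
  have cnt: "(\<Sum>z\<in>#L. poly (pCons 0 q) z) = of_nat (count L w) * (w * poly q w)"
    if "set_mset L \<subseteq> insert w F" for L
    using that
  proof (induction L)
    case (add z L)
    have "poly q z = 0" if "z \<noteq> w"
      using that add.prems F by (auto simp: q)
    with add show ?case
      by (auto simp: algebra_simps)
  qed simp
  show "count M w = count N w"
  proof (cases "w \<in># M + N")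
    case True
    then have "w \<noteq> 0" "poly q w \<noteq> 0"
      using assms(1,2) F by (auto simp: q F_def)
    then show ?thesis
      using poly_eq [of q] cnt [of M] cnt [of N] by (simp add: F_def subset_insertI2)
  next
    case False
    then show ?thesis by (simp add: not_in_iff)
  qed
qed

section \<open>Rational homology from integral cycles\<close>

lemma lookup_rscale [simp]: "Poly_Mapping.lookup (rscale q c) x = q * Poly_Mapping.lookup c x"
  by (simp add: rscale_def Poly_Mapping.map.rep_eq when_def)

lemma rscale_add_right: "rscale q (c + d) = rscale q c + rscale q d"
  by (rule poly_mapping_eqI) (simp add: lookup_add distrib_left)

lemma rscale_diff_right: "rscale q (c - d) = rscale q c - rscale q d"
  by (rule poly_mapping_eqI) (simp add: lookup_minus right_diff_distrib)

lemma rscale_add_left: "rscale (q + r) c = rscale q c + rscale r c"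
  by (rule poly_mapping_eqI) (simp add: lookup_add distrib_right)

lemma rscale_diff_left: "rscale (q - r) c = rscale q c - rscale r c"
  by (rule poly_mapping_eqI) (simp add: lookup_minus left_diff_distrib)

lemma rscale_rscale [simp]: "rscale q (rscale r c) = rscale (q * r) c"
  by (rule poly_mapping_eqI) simp

lemma rscale_simps [simp]: "rscale 0 c = 0" "rscale 1 c = c" "rscale q 0 = 0"
  by (rule poly_mapping_eqI, simp)+

lemma rscale_sum_right: "rscale q (\<Sum>i\<in>I. f i) = (\<Sum>i\<in>I. rscale q (f i))"
  by (induction I rule: infinite_finite_induct) (auto simp: rscale_add_right)

lemma rscale_sum_left: "rscale (\<Sum>i\<in>I. f i) c = (\<Sum>i\<in>I. rscale (f i) c)"
  by (induction I rule: infinite_finite_induct) (auto simp: rscale_add_left)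

lemma keys_rscale: "Poly_Mapping.keys (rscale q c) \<subseteq> Poly_Mapping.keys c"
  by (auto simp: in_keys_iff)

text \<open>\<open>rextend\<close> sums over the support of its argument, which changes under
  addition and scaling. A common finite index set reduces linearity to a manipulation of
  sums.\<close>

lemma rextend_superset:
  assumes "finite S" "Poly_Mapping.keys c \<subseteq> S"
  shows "rextend g c = (\<Sum>s\<in>S. rscale (Poly_Mapping.lookup c s) (g s))"
  unfolding rextend_def
  using assms by (intro sum.mono_neutral_left) (auto simp: in_keys_iff)

lemma rextend_add: "rextend g (c + d) = rextend g c + rextend g d"
proof -
  let ?S = "Poly_Mapping.keys c \<union> Poly_Mapping.keys d"
  have "finite ?S" "Poly_Mapping.keys (c + d) \<subseteq> ?S"
    by (auto dest: Poly_Mapping.keys_add [THEN subsetD])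
  then show ?thesis
    by (simp add: rextend_superset [of ?S] lookup_add rscale_add_left sum.distrib)
qed

lemma rextend_rscale: "rextend g (rscale q c) = rscale q (rextend g c)"
  by (simp add: rextend_superset [of "Poly_Mapping.keys c"] keys_rscale rscale_sum_right)

lemma rextend_0 [simp]: "rextend g 0 = 0"
  by (simp add: rextend_def)

lemma rextend_single [simp]: "rextend g (Poly_Mapping.single s q) = rscale q (g s)"
  by (simp add: rextend_def)

lemma rextend_diff: "rextend g (c - d) = rextend g c - rextend g d"
  using rextend_add [of g "c - d" d] by (simp add: algebra_simps)

lemma rextend_sum: "rextend g (\<Sum>i\<in>I. f i) = (\<Sum>i\<in>I. rextend g (f i))"
  by (induction I rule: infinite_finite_induct) (auto simp: rextend_add)

section \<open>Integral chains inside rational chains\<close>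

definition rat_of_frag :: "('b \<Rightarrow>\<^sub>0 int) \<Rightarrow> ('b \<Rightarrow>\<^sub>0 rat)" where
  "rat_of_frag c = Poly_Mapping.map of_int c"

lemma lookup_rat_of_frag [simp]:
  "Poly_Mapping.lookup (rat_of_frag c) x = of_int (Poly_Mapping.lookup c x)"
  by (simp add: rat_of_frag_def Poly_Mapping.map.rep_eq when_def)

lemma keys_rat_of_frag [simp]: "Poly_Mapping.keys (rat_of_frag c) = Poly_Mapping.keys c"
  by (auto simp: in_keys_iff)

lemma rat_of_frag_eq_iff [simp]: "rat_of_frag c = rat_of_frag d \<longleftrightarrow> c = d"
  by (metis lookup_rat_of_frag of_int_eq_iff poly_mapping_eqI)

lemma rat_of_frag_0 [simp]: "rat_of_frag 0 = 0"
  by (rule poly_mapping_eqI) simp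

lemma rat_of_frag_add: "rat_of_frag (c + d) = rat_of_frag c + rat_of_frag d"
  by (rule poly_mapping_eqI) (simp add: lookup_add)

lemma rat_of_frag_diff: "rat_of_frag (c - d) = rat_of_frag c - rat_of_frag d"
  by (rule poly_mapping_eqI) (simp add: lookup_minus)

lemma rat_of_frag_sum: "rat_of_frag (\<Sum>i\<in>I. f i) = (\<Sum>i\<in>I. rat_of_frag (f i))"
  by (induction I rule: infinite_finite_induct) (auto simp: rat_of_frag_add)

lemma rat_of_frag_cmul: "rat_of_frag (frag_cmul a c) = rscale (of_int a) (rat_of_frag c)"
  by (rule poly_mapping_eqI) simp

lemma rat_of_frag_of: "rat_of_frag (frag_of s) = Poly_Mapping.single s 1"
  by (rule poly_mapping_eqI) (simp add: lookup_single when_def)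

lemma rat_of_frag_extend:
  "rat_of_frag (frag_extend g c) = rextend (\<lambda>s. rat_of_frag (g s)) (rat_of_frag c)"
  by (simp add: frag_extend_def rextend_def rat_of_frag_sum rat_of_frag_cmul)

lemma common_denominator:
  assumes "finite S"
  shows "\<exists>N::int. N > 0 \<and> (\<forall>x\<in>S. of_int N * (f x :: rat) \<in> \<int>)"
  using assms
proof (induction S)
  case empty
  then show ?case by (intro exI [of _ 1]) simp
next
  case (insert y S)
  then obtain N :: int where N: "N > 0" "\<And>x. x \<in> S \<Longrightarrow> of_int N * f x \<in> \<int>"
    by blast
  obtain a b where ab: "quotient_of (f y) = (a, b)" by fastforce
  then have b: "b > 0" "f y = of_int a / of_int b"
    by (auto simp: quotient_of_denom_pos quotient_of_div)
  have "of_int (N * b) * f x \<in> \<int>" if "x \<in> insert y S" for x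
  proof (cases "x = y")
    case True
    then have "of_int (N * b) * f x = of_int (N * a)" using b by simp
    then show ?thesis by (metis Ints_of_int)
  next
    case False
    then have "of_int b * (of_int N * f x) \<in> \<int>"
      using that False N(2) [of x] Ints_mult [OF Ints_of_int [of b]] by simp
    then show ?thesis by (simp only: of_int_mult mult_ac)
  qed
  then show ?case
    using N(1) b(1) by (intro exI [of _ "N * b"]) auto
qed

text \<open>Equality of the supports matters because membership in the chains of X is a condition on
  the support alone.\<close>

lemma clear_denominators:
  obtains N :: int and d where "N > 0" "rscale (of_int N) c = rat_of_frag d"
    "Poly_Mapping.keys d = Poly_Mapping.keys c"
proof -
  obtain N :: int where N: "N > 0"
    "\<And>x. x \<in> Poly_Mapping.keys c \<Longrightarrow> of_int N * Poly_Mapping.lookup c x \<in> \<int>"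
    using common_denominator [OF finite_keys [of c], of "Poly_Mapping.lookup c"] by blast
  \<comment> \<open>The floors are exact: N was chosen to make these products integral.\<close>
  define d where "d = Poly_Mapping.map (\<lambda>q. \<lfloor>of_int N * q\<rfloor>) c"
  have d: "of_int (Poly_Mapping.lookup d x) = of_int N * Poly_Mapping.lookup c x" for x
    using N(2) [of x]
    by (cases "Poly_Mapping.lookup c x = 0")
      (auto simp: d_def Poly_Mapping.map.rep_eq when_def in_keys_iff elim!: Ints_cases)
  have eq: "rscale (of_int N) c = rat_of_frag d"
    by (rule poly_mapping_eqI) (simp add: d)
  have "Poly_Mapping.lookup d x = 0 \<longleftrightarrow> Poly_Mapping.lookup c x = 0" for x
  proof -
    have "Poly_Mapping.lookup d x = 0 \<longleftrightarrow> of_int (Poly_Mapping.lookup d x) = (0 :: rat)"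
      by simp
    also have "\<dots> \<longleftrightarrow> Poly_Mapping.lookup c x = 0"
      unfolding d using N(1) by simp
    finally show ?thesis .
  qed
  then have "Poly_Mapping.keys d = Poly_Mapping.keys c"
    by (simp add: set_eq_iff in_keys_iff)
  with N(1) eq that show thesis by blast
qed

section \<open>Boundaries, chain maps and cycles over the rationals\<close>

lemma rat_chain_boundary_linear:
  "rat_chain_boundary p (c + d) = rat_chain_boundary p c + rat_chain_boundary p d"
  "rat_chain_boundary p (c - d) = rat_chain_boundary p c - rat_chain_boundary p d"
  "rat_chain_boundary p (rscale q c) = rscale q (rat_chain_boundary p c)"
  "rat_chain_boundary p (\<Sum>i\<in>I. f i) = (\<Sum>i\<in>I. rat_chain_boundary p (f i))"
  "rat_chain_boundary p 0 = 0"
  by (simp_all add: rat_chain_boundary_def rextend_add rextend_diff rextend_rscale rextend_sum)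

lemma rat_chain_map_linear:
  "rat_chain_map p g (c + d) = rat_chain_map p g c + rat_chain_map p g d"
  "rat_chain_map p g (c - d) = rat_chain_map p g c - rat_chain_map p g d"
  "rat_chain_map p g (rscale q c) = rscale q (rat_chain_map p g c)"
  "rat_chain_map p g (\<Sum>i\<in>I. f i) = (\<Sum>i\<in>I. rat_chain_map p g (f i))"
  "rat_chain_map p g 0 = 0"
  by (simp_all add: rat_chain_map_def rextend_add rextend_diff rextend_rscale rextend_sum)

lemma rat_of_frag_chain_boundary:
  "rat_chain_boundary p (rat_of_frag c) = rat_of_frag (chain_boundary p c)"
proof -
  have pm: "of_int ((-1) ^ k) = ((-1) ^ k :: rat)" for k :: nat by simp
  have "rscale ((-1) ^ k) (Poly_Mapping.single s 1) = Poly_Mapping.single s ((-1) ^ k)"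
    for k and s :: "(nat \<Rightarrow> real) \<Rightarrow> 'a"
    by (rule poly_mapping_eqI) (simp add: lookup_single when_def)
  then show ?thesis
    by (simp add: rat_chain_boundary_def chain_boundary_def rat_of_frag_extend rat_of_frag_sum
        rat_of_frag_cmul rat_of_frag_of pm del: of_int_power)
qed

lemma rat_of_frag_chain_map:
  "rat_chain_map p g (rat_of_frag c) = rat_of_frag (chain_map p g c)"
  by (simp add: rat_chain_map_def chain_map_def rat_of_frag_extend rat_of_frag_of)

lemma rat_of_frag_chain [simp]: "rat_of_frag c \<in> rat_chain_set p X \<longleftrightarrow> singular_chain p X c"
  by (simp add: rat_chain_set_def singular_chain_def)

lemma rat_of_frag_cycle [simp]: "rat_of_frag c \<in> rat_cycles p X \<longleftrightarrow> singular_relcycle p X {} c"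
  unfolding rat_cycles_def singular_cycle mem_Collect_eq rat_of_frag_chain rat_of_frag_chain_boundary
  by (metis rat_of_frag_0 rat_of_frag_eq_iff)

lemma rat_of_frag_boundaryI:
  "singular_relboundary p X {} c \<Longrightarrow> rat_of_frag c \<in> rat_boundaries p X"
  unfolding singular_boundary rat_boundaries_def
  by (metis imageI rat_of_frag_chain rat_of_frag_chain_boundary)

text \<open>Torsion dies over the rationals, so only a multiple of c is claimed to bound integrally.
  N clears the denominators of a rational chain with boundary c.\<close>

lemma rat_of_frag_boundaryD:
  assumes "rat_of_frag c \<in> rat_boundaries p X"
  obtains N :: int where "N > 0" "singular_relboundary p X {} (frag_cmul N c)"
proof -
  obtain b where b: "b \<in> rat_chain_set (Suc p) X" "rat_chain_boundary (Suc p) b = rat_of_frag c"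
    using assms by (auto simp: rat_boundaries_def)
  obtain N :: int and d where N: "N > 0" "rscale (of_int N) b = rat_of_frag d"
    "Poly_Mapping.keys d = Poly_Mapping.keys b"
    by (rule clear_denominators)
  have "singular_chain (Suc p) X d"
    using b(1) N(3) by (simp add: rat_chain_set_def singular_chain_def)
  moreover have "rat_of_frag (chain_boundary (Suc p) d) = rat_of_frag (frag_cmul N c)"
    unfolding rat_of_frag_chain_boundary [symmetric] N(2) [symmetric] rat_of_frag_cmul
    by (simp add: rat_chain_boundary_linear b(2))
  ultimately show thesis
    using that N(1) unfolding singular_boundary rat_of_frag_eq_iff by blast
qed

lemma rat_chain_set_linear:
  "0 \<in> rat_chain_set p X"
  "c \<in> rat_chain_set p X \<Longrightarrow> d \<in> rat_chain_set p X \<Longrightarrow> c + d \<in> rat_chain_set p X"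
  "c \<in> rat_chain_set p X \<Longrightarrow> rscale q c \<in> rat_chain_set p X"
  unfolding rat_chain_set_def using keys_rscale [of q c] Poly_Mapping.keys_add [of c d] by auto

lemma rat_cycles_linear:
  "0 \<in> rat_cycles p X"
  "c \<in> rat_cycles p X \<Longrightarrow> d \<in> rat_cycles p X \<Longrightarrow> c + d \<in> rat_cycles p X"
  "c \<in> rat_cycles p X \<Longrightarrow> rscale q c \<in> rat_cycles p X"
  by (simp_all add: rat_cycles_def rat_chain_set_linear rat_chain_boundary_linear)

lemma rat_boundaries_linear:
  "0 \<in> rat_boundaries p X"
  "c \<in> rat_boundaries p X \<Longrightarrow> d \<in> rat_boundaries p X \<Longrightarrow> c + d \<in> rat_boundaries p X"
  "c \<in> rat_boundaries p X \<Longrightarrow> rscale q c \<in> rat_boundaries p X"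
  unfolding rat_boundaries_def
  by (metis rat_chain_set_linear(1) rat_chain_boundary_linear(5) imageI)
    (force simp: rat_chain_set_linear simp flip: rat_chain_boundary_linear)+

lemma rat_boundaries_diff:
  "c \<in> rat_boundaries p X \<Longrightarrow> d \<in> rat_boundaries p X \<Longrightarrow> c - d \<in> rat_boundaries p X"
proof -
  have "c - d = c + rscale (-1) d"
    by (rule poly_mapping_eqI) (simp add: lookup_add lookup_minus)
  then show "c \<in> rat_boundaries p X \<Longrightarrow> d \<in> rat_boundaries p X \<Longrightarrow> c - d \<in> rat_boundaries p X"
    by (simp only: rat_boundaries_linear)
qed

lemma rat_boundaries_sum:
  "(\<And>i. i \<in> I \<Longrightarrow> f i \<in> rat_boundaries p X) \<Longrightarrow> (\<Sum>i\<in>I. f i) \<in> rat_boundaries p X"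
  by (induction I rule: infinite_finite_induct) (auto simp: rat_boundaries_linear)

lemma rat_cycles_sum:
  "(\<And>i. i \<in> I \<Longrightarrow> f i \<in> rat_cycles p X) \<Longrightarrow> (\<Sum>i\<in>I. f i) \<in> rat_cycles p X"
  by (induction I rule: infinite_finite_induct) (auto simp: rat_cycles_linear)

section \<open>Homologous cycles, coordinates and bases\<close>

definition rat_homologous :: "nat \<Rightarrow> 'a topology \<Rightarrow> 'a rat_chain \<Rightarrow> 'a rat_chain \<Rightarrow> bool" where
  "rat_homologous p X c d \<longleftrightarrow> c - d \<in> rat_boundaries p X"

lemma rat_homologous_refl [simp]: "rat_homologous p X c c"
  by (simp add: rat_homologous_def rat_boundaries_linear)

lemma rat_homologous_sym: "rat_homologous p X c d \<Longrightarrow> rat_homologous p X d c"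
  using rat_boundaries_diff [OF rat_boundaries_linear(1), of "c - d"] by (simp add: rat_homologous_def)

lemma rat_homologous_trans [trans]:
  "rat_homologous p X c d \<Longrightarrow> rat_homologous p X d e \<Longrightarrow> rat_homologous p X c e"
  unfolding rat_homologous_def by (drule (1) rat_boundaries_linear(2)) simp

lemma rat_homologous_rscale:
  "rat_homologous p X c d \<Longrightarrow> rat_homologous p X (rscale q c) (rscale q d)"
  unfolding rat_homologous_def by (metis rat_boundaries_linear(3) rscale_diff_right)

lemma rat_homologous_sum:
  "(\<And>i. i \<in> I \<Longrightarrow> rat_homologous p X (f i) (g i)) \<Longrightarrow> rat_homologous p X (\<Sum>i\<in>I. f i) (\<Sum>i\<in>I. g i)"
  unfolding rat_homologous_def sum_subtractf [symmetric] by (rule rat_boundaries_sum)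

lemma rat_class_eq_iff:
  assumes "c \<in> rat_cycles p X" "d \<in> rat_cycles p X"
  shows "rat_class p X c = rat_class p X d \<longleftrightarrow> rat_homologous p X c d"
proof
  assume "rat_class p X c = rat_class p X d"
  moreover have "c \<in> rat_class p X c"
    using assms by (simp add: rat_class_def rat_boundaries_linear)
  ultimately show "rat_homologous p X c d"
    by (simp add: rat_class_def rat_homologous_def)
next
  assume h: "rat_homologous p X c d"
  have "rat_homologous p X w c \<longleftrightarrow> rat_homologous p X w d" for w
    using h rat_homologous_sym rat_homologous_trans by blast
  then show "rat_class p X c = rat_class p X d"
    by (simp add: rat_class_def rat_homologous_def)
qed

definition rat_comb :: "'a rat_chain list \<Rightarrow> (nat \<Rightarrow> rat) \<Rightarrow> 'a rat_chain" where
  "rat_comb zs v = (\<Sum>i<length zs. rscale (v i) (zs ! i))"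

lemma rat_comb_cong: "(\<And>i. i < length zs \<Longrightarrow> v i = w i) \<Longrightarrow> rat_comb zs v = rat_comb zs w"
  by (simp add: rat_comb_def)

lemma rat_comb_cycle: "set zs \<subseteq> rat_cycles p X \<Longrightarrow> rat_comb zs v \<in> rat_cycles p X"
  unfolding rat_comb_def by (intro rat_cycles_sum rat_cycles_linear) auto

lemma rat_comb_diff: "rat_comb zs v - rat_comb zs w = rat_comb zs (\<lambda>i. v i - w i)"
  by (simp add: rat_comb_def rscale_diff_left sum_subtractf)

text \<open>Unique coordinates of classes become spanning and independence of cycles, the form in
  which chain computations can be fed in.\<close>

lemma rat_hom_basis_iff:
  "rat_hom_basis p X zs \<longleftrightarrow> set zs \<subseteq> rat_cycles p X \<and>
     (\<forall>c \<in> rat_cycles p X. \<exists>v. rat_homologous p X c (rat_comb zs v)) \<and>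
     (\<forall>v. rat_comb zs v \<in> rat_boundaries p X \<longrightarrow> (\<forall>i<length zs. v i = 0))" (is "_ \<longleftrightarrow> ?R")
proof
  assume b: "rat_hom_basis p X zs"
  then have zs: "set zs \<subseteq> rat_cycles p X"
    and ex: "\<And>c. c \<in> rat_cycles p X \<Longrightarrow>
      \<exists>!v. v \<in> {..<length zs} \<rightarrow>\<^sub>E UNIV \<and> rat_class p X c = rat_class p X (rat_comb zs v)"
    by (auto simp: rat_hom_basis_def rat_homology_def rat_lincomb_def rat_comb_def)
  have "\<exists>v. rat_homologous p X c (rat_comb zs v)" if "c \<in> rat_cycles p X" for c
    using ex [OF that] rat_class_eq_iff [OF that rat_comb_cycle [OF zs]] by blast
  moreover have "\<forall>i<length zs. v i = 0" if v: "rat_comb zs v \<in> rat_boundaries p X" for v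
  proof -
    \<comment> \<open>Uniqueness in \<open>rat_hom_basis\<close> concerns extensional functions
      only, so both v and the zero function are restricted to the index range before they are
      compared.\<close>
    let ?v = "restrict v {..<length zs}" and ?o = "restrict (\<lambda>i. 0) {..<length zs}"
    have "rat_comb zs ?v = rat_comb zs v" "rat_comb zs ?o = 0"
      by (simp_all add: rat_comb_def)
    then have "rat_class p X 0 = rat_class p X (rat_comb zs ?v)" "rat_class p X 0 = rat_class p X (rat_comb zs ?o)"
      using v rat_class_eq_iff [OF rat_cycles_linear(1) rat_comb_cycle [OF zs, of v]]
        rat_homologous_sym [of p X "rat_comb zs v" 0]
      by (simp_all add: rat_homologous_def)
    then have "?v = ?o"
      using ex [OF rat_cycles_linear(1)] by (metis restrict_PiE_iff UNIV_I)
    then show ?thesis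
      by (metis lessThan_iff restrict_apply')
  qed
  ultimately show ?R using zs by blast
next
  assume R: ?R
  then have zs: "set zs \<subseteq> rat_cycles p X" by blast
  have "\<exists>!v. v \<in> {..<length zs} \<rightarrow>\<^sub>E UNIV \<and> rat_class p X c = rat_class p X (rat_comb zs v)"
    if c: "c \<in> rat_cycles p X" for c
  proof -
    obtain v where v: "rat_homologous p X c (rat_comb zs v)"
      using R c by blast
    have "rat_comb zs (restrict v {..<length zs}) = rat_comb zs v"
      by (rule rat_comb_cong) simp
    with v have "rat_class p X c = rat_class p X (rat_comb zs (restrict v {..<length zs}))"
      using rat_class_eq_iff [OF c rat_comb_cycle [OF zs]] by simp
    moreover have "w = u"
      if w: "w \<in> {..<length zs} \<rightarrow>\<^sub>E UNIV" "rat_class p X c = rat_class p X (rat_comb zs w)"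
        and u: "u \<in> {..<length zs} \<rightarrow>\<^sub>E UNIV" "rat_class p X c = rat_class p X (rat_comb zs u)" for w u
    proof -
      have "rat_homologous p X (rat_comb zs w) (rat_comb zs u)"
        using w(2) u(2) rat_class_eq_iff [OF rat_comb_cycle [OF zs] rat_comb_cycle [OF zs]] by metis
      then have "\<forall>i<length zs. w i - u i = 0"
        using R unfolding rat_homologous_def rat_comb_diff by blast
      then show ?thesis
        using w(1) u(1) by (intro PiE_ext [OF w(1) u(1)]) auto
    qed
    ultimately show ?thesis
      by (intro ex1I [of _ "restrict v {..<length zs}"]) auto
  qed
  then show "rat_hom_basis p X zs"
    using zs by (auto simp: rat_hom_basis_def rat_homology_def rat_lincomb_def rat_comb_def)
qed

section \<open>Functoriality of rational chains\<close>

lemma rscale_cancel: "rscale q c = rscale q d \<Longrightarrow> q \<noteq> 0 \<Longrightarrow> c = d"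
  by (metis poly_mapping_eqI lookup_rscale mult_cancel_left)

lemma rat_chain_cases:
  assumes "c \<in> rat_chain_set p X"
  obtains N :: int and d where "N > 0" "rscale (of_int N) c = rat_of_frag d" "singular_chain p X d"
  using clear_denominators [of c] assms unfolding rat_chain_set_def singular_chain_def mem_Collect_eq
  by metis

text \<open>Multiplied by a common denominator, the claim is the integral identity, and the scalar
  cancels. The same transfer gives compatibility with composition and identity.\<close>

lemma rat_chain_map_boundary:
  assumes "c \<in> rat_chain_set p X"
  shows "rat_chain_boundary p (rat_chain_map p g c) = rat_chain_map (p - 1) g (rat_chain_boundary p c)"
proof -
  obtain N :: int and d where N: "N > 0" "rscale (of_int N) c = rat_of_frag d" "singular_chain p X d"
    using assms by (rule rat_chain_cases)
  show ?thesis
    by (rule rscale_cancel [of "of_int N"])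
      (use N in \<open>simp_all add: rat_chain_boundary_linear(3) [symmetric] rat_chain_map_linear(3) [symmetric]
        rat_of_frag_chain_map rat_of_frag_chain_boundary chain_boundary_chain_map\<close>)
qed

lemma rat_chain_map_compose:
  assumes "c \<in> rat_chain_set p X"
  shows "rat_chain_map p (h \<circ> g) c = rat_chain_map p h (rat_chain_map p g c)"
proof -
  obtain N :: int and d where N: "N > 0" "rscale (of_int N) c = rat_of_frag d"
    using assms by (rule rat_chain_cases)
  show ?thesis
    by (rule rscale_cancel [of "of_int N"])
      (use N in \<open>simp_all add: rat_chain_map_linear(3) [symmetric] rat_of_frag_chain_map chain_map_compose\<close>)
qed

lemma rat_chain_map_id:
  assumes "c \<in> rat_chain_set p X"
  shows "rat_chain_map p id c = c"
proof -
  obtain N :: int and d where N: "N > 0" "rscale (of_int N) c = rat_of_frag d" "singular_chain p X d"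
    using assms by (rule rat_chain_cases)
  show ?thesis
    by (rule rscale_cancel [of "of_int N"])
      (use N in \<open>simp_all add: rat_chain_map_linear(3) [symmetric] rat_of_frag_chain_map chain_map_ident\<close>)
qed

lemma rat_chain_map_chain:
  assumes "c \<in> rat_chain_set p X" "continuous_map X Y g"
  shows "rat_chain_map p g c \<in> rat_chain_set p Y"
proof -
  obtain N :: int and d where N: "N > 0" "rscale (of_int N) c = rat_of_frag d" "singular_chain p X d"
    using assms(1) by (rule rat_chain_cases)
  have "rscale (of_int N) (rat_chain_map p g c) = rat_of_frag (chain_map p g d)"
    by (simp add: N(2) rat_of_frag_chain_map flip: rat_chain_map_linear(3))
  then have "rat_chain_map p g c = rscale (1 / of_int N) (rat_of_frag (chain_map p g d))"
    using N(1) by (simp flip: \<open>_ = rat_of_frag (chain_map p g d)\<close>)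
  then show ?thesis
    using singular_chain_chain_map [OF N(3) assms(2)] by (simp add: rat_chain_set_linear)
qed

lemma rat_chain_map_cycle:
  assumes "c \<in> rat_cycles p X" "continuous_map X Y g"
  shows "rat_chain_map p g c \<in> rat_cycles p Y"
  using assms rat_chain_map_chain [of c p X Y g] rat_chain_map_boundary [of c p X g]
  by (simp add: rat_cycles_def rat_chain_map_linear(5))

lemma rat_chain_map_boundaries:
  assumes "c \<in> rat_boundaries p X" "continuous_map X Y g"
  shows "rat_chain_map p g c \<in> rat_boundaries p Y"
proof -
  obtain b where b: "b \<in> rat_chain_set (Suc p) X" "c = rat_chain_boundary (Suc p) b"
    using assms(1) by (auto simp: rat_boundaries_def)
  show ?thesis
    using rat_chain_map_chain [OF b(1) assms(2)] rat_chain_map_boundary [OF b(1), of g]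
    unfolding rat_boundaries_def b(2) by (metis diff_Suc_1 imageI)
qed

lemma rat_chain_map_homologous:
  "rat_homologous p X c d \<Longrightarrow> continuous_map X Y g \<Longrightarrow>
    rat_homologous p Y (rat_chain_map p g c) (rat_chain_map p g d)"
  unfolding rat_homologous_def by (metis rat_chain_map_boundaries rat_chain_map_linear(2))

text \<open>The union in \<open>rat_hom_induced\<close> runs over all representatives; homologous
  cycles have homologous images, so its members coincide.\<close>

lemma rat_hom_induced_class:
  assumes "z \<in> rat_cycles p X" "continuous_map X Y g"
  shows "rat_hom_induced p X Y g (rat_class p X z) = rat_class p Y (rat_chain_map p g z)"
proof -
  have "rat_class p Y (rat_chain_map p g w) = rat_class p Y (rat_chain_map p g z)"
    if "w \<in> rat_class p X z" for w
  proof -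
    have w: "w \<in> rat_cycles p X" "rat_homologous p X w z"
      using that by (auto simp: rat_class_def rat_homologous_def)
    then show ?thesis
      using rat_class_eq_iff [OF rat_chain_map_cycle [OF w(1) assms(2)] rat_chain_map_cycle [OF assms]]
        rat_chain_map_homologous [OF w(2) assms(2)] by simp
  qed
  moreover have "z \<in> rat_class p X z"
    using assms(1) by (simp add: rat_class_def rat_boundaries_linear)
  ultimately show ?thesis
    unfolding rat_hom_induced_def by blast
qed

section \<open>Matrices of induced maps and change of basis\<close>

lemma rat_hom_matrix_iff:
  assumes zs: "set zs \<subseteq> rat_cycles p X" and f: "continuous_map X X f"
  shows "rat_hom_matrix p X f zs A \<longleftrightarrow> A \<in> carrier_mat (length zs) (length zs) \<and>
    (\<forall>j<length zs. rat_homologous p X (rat_chain_map p f (zs ! j)) (rat_comb zs (\<lambda>i. A $$ (i, j))))"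
proof -
  have "rat_hom_induced p X X f (rat_class p X (zs ! j)) = rat_lincomb p X zs (\<lambda>i. A $$ (i, j)) \<longleftrightarrow>
      rat_homologous p X (rat_chain_map p f (zs ! j)) (rat_comb zs (\<lambda>i. A $$ (i, j)))"
    if "j < length zs" for j
  proof -
    have "zs ! j \<in> rat_cycles p X"
      using zs that by auto
    then show ?thesis
      using rat_class_eq_iff [OF rat_chain_map_cycle [OF _ f] rat_comb_cycle [OF zs]] f
      by (simp add: rat_hom_induced_class rat_lincomb_def flip: rat_comb_def)
  qed
  then show ?thesis
    unfolding rat_hom_matrix_def by blast
qed

text \<open>The matrix-vector product that underlies both change of basis and the matrix of a
  composite map.\<close>

lemma rat_comb_comb:
  assumes "\<And>j. j < length ws \<Longrightarrow> rat_homologous p X (ws ! j) (rat_comb zs (\<lambda>i. M i j))"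
  shows "rat_homologous p X (rat_comb ws v) (rat_comb zs (\<lambda>i. \<Sum>j<length ws. M i j * v j))"
proof -
  have "rat_homologous p X (rat_comb ws v) (\<Sum>j<length ws. rscale (v j) (rat_comb zs (\<lambda>i. M i j)))"
    unfolding rat_comb_def [of ws] using assms by (intro rat_homologous_sum rat_homologous_rscale) auto
  also have "(\<Sum>j<length ws. rscale (v j) (rat_comb zs (\<lambda>i. M i j))) =
      rat_comb zs (\<lambda>i. \<Sum>j<length ws. M i j * v j)"
    unfolding rat_comb_def rscale_sum_right rscale_sum_left
    by (subst sum.swap) (simp add: mult.commute)
  finally show ?thesis .
qed

lemma rat_chain_map_comb:
  "rat_chain_map p f (rat_comb zs v) = rat_comb (map (rat_chain_map p f) zs) v"
  by (simp add: rat_comb_def rat_chain_map_linear)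

lemma rat_comb_unique:
  assumes "rat_hom_basis p X zs" "rat_homologous p X (rat_comb zs v) (rat_comb zs w)" "i < length zs"
  shows "v i = w i"
proof -
  have "\<forall>i<length zs. v i - w i = 0"
    using assms(1,2) unfolding rat_hom_basis_iff rat_homologous_def rat_comb_diff by blast
  then show ?thesis using assms(3) by simp
qed

text \<open>\<open>ws\<close> may be any list of cycles: a second basis gives the change of basis,
  and the images of \<open>zs\<close> under f give the matrix of f.\<close>

lemma transition_matrix:
  assumes zs: "rat_hom_basis p X zs" and ws: "set ws \<subseteq> rat_cycles p X"
  obtains P where "P \<in> carrier_mat (length zs) (length ws)"
    "\<And>j. j < length ws \<Longrightarrow> rat_homologous p X (ws ! j) (rat_comb zs (\<lambda>i. P $$ (i, j)))"
proof -
  have "\<forall>j. \<exists>v. j < length ws \<longrightarrow> rat_homologous p X (ws ! j) (rat_comb zs v)"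
    using zs ws unfolding rat_hom_basis_iff by (meson nth_mem subsetD)
  then obtain v where v: "\<And>j. j < length ws \<Longrightarrow> rat_homologous p X (ws ! j) (rat_comb zs (v j))"
    by metis
  have "rat_comb zs (\<lambda>i. mat (length zs) (length ws) (\<lambda>(i, j). v j i) $$ (i, j)) = rat_comb zs (v j)"
    if "j < length ws" for j
    using that by (intro rat_comb_cong) simp
  with v show thesis
    by (intro that [of "mat (length zs) (length ws) (\<lambda>(i, j). v j i)"]) auto
qed

lemma sum_mult_mat:
  assumes "A \<in> carrier_mat n m" "B \<in> carrier_mat m k" "i < n" "j < k"
  shows "(\<Sum>r<m. A $$ (i, r) * B $$ (r, j)) = (A * B) $$ (i, j)"
  using assms by (auto simp: scalar_prod_def lessThan_atLeast0 intro!: sum.cong)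

lemma transition_matrix_inverse:
  assumes zs: "rat_hom_basis p X zs"
    and P: "P \<in> carrier_mat (length zs) (length ws)"
      "\<And>j. j < length ws \<Longrightarrow> rat_homologous p X (ws ! j) (rat_comb zs (\<lambda>i. P $$ (i, j)))"
    and Q: "Q \<in> carrier_mat (length ws) (length zs)"
      "\<And>j. j < length zs \<Longrightarrow> rat_homologous p X (zs ! j) (rat_comb ws (\<lambda>i. Q $$ (i, j)))"
  shows "P * Q = 1\<^sub>m (length zs)"
proof (rule eq_matI)
  fix i j
  assume "i < dim_row (1\<^sub>m (length zs) :: rat mat)" "j < dim_col (1\<^sub>m (length zs) :: rat mat)"
  then have ij: "i < length zs" "j < length zs"
    by auto
  have "rat_comb zs (\<lambda>i. if i = j then 1 else 0) = (\<Sum>i<length zs. if i = j then zs ! i else 0)"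
    unfolding rat_comb_def by (intro sum.cong) auto
  also have "\<dots> = zs ! j"
    using ij by simp
  finally have "rat_homologous p X (rat_comb zs (\<lambda>i. if i = j then 1 else 0))
      (rat_comb zs (\<lambda>i. \<Sum>r<length ws. P $$ (i, r) * Q $$ (r, j)))"
    using rat_homologous_trans [OF Q(2) [OF ij(2)] rat_comb_comb [OF P(2)]] by simp
  from rat_comb_unique [OF zs this ij(1)] show "(P * Q) $$ (i, j) = 1\<^sub>m (length zs) $$ (i, j)"
    using ij by (simp add: sum_mult_mat [OF P(1) Q(1)])
qed (use P Q in auto)

text \<open>With P expressing \<open>ws\<close> in terms of \<open>zs\<close>, the columns of A P
  and of P B are both the coordinates over \<open>zs\<close> of the images of \<open>ws\<close>
  under f, hence equal. P is invertible because the reverse expansion gives a two-sided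
  inverse.\<close>

lemma rat_hom_matrix_similar:
  assumes zs: "rat_hom_basis p X zs" and ws: "rat_hom_basis p X ws" and f: "continuous_map X X f"
    and A: "rat_hom_matrix p X f zs A" and B: "rat_hom_matrix p X f ws B"
  shows "length zs = length ws \<and> similar_mat A B"
proof -
  have zsc: "set zs \<subseteq> rat_cycles p X" and wsc: "set ws \<subseteq> rat_cycles p X"
    using zs ws by (auto simp: rat_hom_basis_def)
  have A': "A \<in> carrier_mat (length zs) (length zs)"
    "\<And>j. j < length zs \<Longrightarrow> rat_homologous p X (rat_chain_map p f (zs ! j)) (rat_comb zs (\<lambda>i. A $$ (i, j)))"
    using A rat_hom_matrix_iff [OF zsc f] by auto
  have B': "B \<in> carrier_mat (length ws) (length ws)"
    "\<And>j. j < length ws \<Longrightarrow> rat_homologous p X (rat_chain_map p f (ws ! j)) (rat_comb ws (\<lambda>i. B $$ (i, j)))"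
    using B rat_hom_matrix_iff [OF wsc f] by auto
  obtain P where P: "P \<in> carrier_mat (length zs) (length ws)"
    "\<And>j. j < length ws \<Longrightarrow> rat_homologous p X (ws ! j) (rat_comb zs (\<lambda>i. P $$ (i, j)))"
    using transition_matrix [OF zs wsc] by blast
  obtain Q where Q: "Q \<in> carrier_mat (length ws) (length zs)"
    "\<And>j. j < length zs \<Longrightarrow> rat_homologous p X (zs ! j) (rat_comb ws (\<lambda>i. Q $$ (i, j)))"
    using transition_matrix [OF ws zsc] by blast
  have PQ: "P * Q = 1\<^sub>m (length zs)" and QP: "Q * P = 1\<^sub>m (length ws)"
    using transition_matrix_inverse [OF zs P Q] transition_matrix_inverse [OF ws Q P] by auto
  have len: "length zs = length ws"
    by (rule invertible_mat_imp_square [OF P(1) Q(1) PQ QP])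
  have AP: "A * P = P * B"
  proof (rule eq_matI)
    fix i j
    assume "i < dim_row (P * B)" "j < dim_col (P * B)"
    then have ij: "i < length zs" "j < length ws"
      using P B' by auto
    have "rat_homologous p X (rat_chain_map p f (ws ! j))
        (rat_comb (map (rat_chain_map p f) zs) (\<lambda>i. P $$ (i, j)))"
      using rat_chain_map_homologous [OF P(2) [OF ij(2)] f] by (simp add: rat_chain_map_comb)
    also have "rat_homologous p X \<dots> (rat_comb zs (\<lambda>i. \<Sum>r<length zs. A $$ (i, r) * P $$ (r, j)))"
      using rat_comb_comb [of "map (rat_chain_map p f) zs" p X zs "\<lambda>i j. A $$ (i, j)"] A'(2) by simp
    finally have "rat_homologous p X (rat_comb zs (\<lambda>i. \<Sum>r<length zs. A $$ (i, r) * P $$ (r, j)))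
        (rat_chain_map p f (ws ! j))"
      by (rule rat_homologous_sym)
    also have "rat_homologous p X \<dots> (rat_comb zs (\<lambda>i. \<Sum>r<length ws. P $$ (i, r) * B $$ (r, j)))"
      using rat_homologous_trans [OF B'(2) [OF ij(2)] rat_comb_comb [OF P(2)]] .
    finally have "(\<Sum>r<length zs. A $$ (i, r) * P $$ (r, j)) = (\<Sum>r<length ws. P $$ (i, r) * B $$ (r, j))"
      using rat_comb_unique [OF zs _ ij(1)] by blast
    then show "(A * P) $$ (i, j) = (P * B) $$ (i, j)"
      using sum_mult_mat [OF A'(1) P(1)] sum_mult_mat [OF P(1) B'(1)] ij by simp
  qed (use P A' B' in auto)
  have "A = A * (P * Q)"
    using A' PQ by simp
  also have "\<dots> = P * B * Q"
    using assoc_mult_mat [OF A'(1) P(1) Q(1)] AP by simp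
  finally have "similar_mat_wit A B P Q"
    using PQ QP A' B' P Q len by (intro similar_mat_witI [of _ _ "length zs"]) auto
  then show ?thesis
    using len by (auto simp: similar_mat_def)
qed

lemma rat_hom_charpoly_eq:
  assumes zs: "rat_hom_basis p X zs" and f: "continuous_map X X f" and A: "rat_hom_matrix p X f zs A"
  shows "rat_hom_charpoly p X f = det_minus_x A"
  unfolding rat_hom_charpoly_def
proof (rule the_equality)
  show "\<exists>zs' A'. rat_hom_basis p X zs' \<and> rat_hom_matrix p X f zs' A' \<and> det_minus_x A = det_minus_x A'"
    using zs A by blast
  fix P
  assume "\<exists>zs' A'. rat_hom_basis p X zs' \<and> rat_hom_matrix p X f zs' A' \<and> P = det_minus_x A'"
  then obtain zs' A' where zs': "rat_hom_basis p X zs'" and A': "rat_hom_matrix p X f zs' A'"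
    and P: "P = det_minus_x A'"
    by blast
  have "length zs = length zs'" "char_poly A = char_poly A'"
    using rat_hom_matrix_similar [OF zs zs' f A A'] char_poly_similar by auto
  then show "P = det_minus_x A"
    using A A' det_minus_x_eq_char_poly [of A "length zs"] det_minus_x_eq_char_poly [of A' "length zs"]
    by (simp add: P rat_hom_matrix_def)
qed

lemma rat_hom_trace_eq:
  assumes zs: "rat_hom_basis p X zs" and f: "continuous_map X X f" and A: "rat_hom_matrix p X f zs A"
  shows "rat_hom_trace p X f = (\<Sum>i<length zs. A $$ (i, i))"
  unfolding rat_hom_trace_def
proof (rule the_equality)
  show "\<exists>zs' A'. rat_hom_basis p X zs' \<and> rat_hom_matrix p X f zs' A' \<and>
      (\<Sum>i<length zs. A $$ (i, i)) = (\<Sum>i<length zs'. A' $$ (i, i))"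
    using zs A by blast
  fix t
  assume "\<exists>zs' A'. rat_hom_basis p X zs' \<and> rat_hom_matrix p X f zs' A' \<and> t = (\<Sum>i<length zs'. A' $$ (i, i))"
  then obtain zs' A' where zs': "rat_hom_basis p X zs'" and A': "rat_hom_matrix p X f zs' A'"
    and t: "t = (\<Sum>i<length zs'. A' $$ (i, i))"
    by blast
  from rat_hom_matrix_similar [OF zs zs' f A A'] obtain P Q
    where "length zs = length zs'" "similar_mat_wit A A' P Q"
    by (auto simp: similar_mat_def)
  then show "t = (\<Sum>i<length zs. A $$ (i, i))"
    using A sum_diag_similar [of A A' P Q "length zs"] by (simp add: t rat_hom_matrix_def)
qed

lemma continuous_map_funpow: "continuous_map X X f \<Longrightarrow> continuous_map X X (f ^^ m)"
  by (induction m) (auto intro: continuous_map_compose)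

lemma rat_hom_matrix_exists:
  assumes "rat_hom_basis p X zs" "continuous_map X X f"
  obtains A where "rat_hom_matrix p X f zs A"
proof -
  have zs: "set zs \<subseteq> rat_cycles p X"
    using assms(1) by (simp add: rat_hom_basis_def)
  then have "set (map (rat_chain_map p f) zs) \<subseteq> rat_cycles p X"
    using rat_chain_map_cycle [OF _ assms(2)] by auto
  from transition_matrix [OF assms(1) this] obtain A
    where "A \<in> carrier_mat (length zs) (length zs)"
      "\<And>j. j < length zs \<Longrightarrow> rat_homologous p X (rat_chain_map p f (zs ! j)) (rat_comb zs (\<lambda>i. A $$ (i, j)))"
    by auto
  then show thesis
    using that rat_hom_matrix_iff [OF zs assms(2)] by blast
qed

lemma rat_hom_matrix_funpow:
  assumes zs: "rat_hom_basis p X zs" and f: "continuous_map X X f" and A: "rat_hom_matrix p X f zs A"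
  shows "rat_hom_matrix p X (f ^^ m) zs (A ^\<^sub>m m)"
proof -
  have zsc: "set zs \<subseteq> rat_cycles p X"
    using zs by (simp add: rat_hom_basis_def)
  have A': "A \<in> carrier_mat (length zs) (length zs)"
    "\<And>j. j < length zs \<Longrightarrow> rat_homologous p X (rat_chain_map p f (zs ! j)) (rat_comb zs (\<lambda>i. A $$ (i, j)))"
    using A rat_hom_matrix_iff [OF zsc f] by auto
  have chain: "zs ! j \<in> rat_chain_set p X" if "j < length zs" for j
    using subsetD [OF zsc nth_mem [OF that]] by (simp add: rat_cycles_def)
  have "rat_homologous p X (rat_chain_map p (f ^^ m) (zs ! j)) (rat_comb zs (\<lambda>i. (A ^\<^sub>m m) $$ (i, j)))"
    if j: "j < length zs" for j
    using j
  proof (induction m arbitrary: j)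
    case 0
    have "rat_comb zs (\<lambda>i. (A ^\<^sub>m 0) $$ (i, j)) = (\<Sum>i<length zs. if i = j then zs ! i else 0)"
      unfolding rat_comb_def using A'(1) 0 by (intro sum.cong) auto
    also have "\<dots> = zs ! j"
      using 0 by simp
    finally show ?case
      using rat_chain_map_id [OF chain [OF 0]] by (simp add: id_def [symmetric])
  next
    case (Suc m)
    let ?g = "rat_chain_map p (f ^^ m)"
    \<comment> \<open>f is applied first and expanded by the columns of A; the induction hypothesis
      is then applied to each basis cycle. This order matches A^(m+1) = A^m A.\<close>
    have "rat_chain_map p (f ^^ Suc m) (zs ! j) = ?g (rat_chain_map p f (zs ! j))"
      using rat_chain_map_compose [OF chain [OF Suc.prems], of "f ^^ m" f]
      by (simp only: funpow_Suc_right)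
    also have "rat_homologous p X \<dots> (rat_comb (map ?g zs) (\<lambda>i. A $$ (i, j)))"
      using rat_chain_map_homologous [OF A'(2) [OF Suc.prems] continuous_map_funpow [OF f, of m]]
      by (simp add: rat_chain_map_comb)
    also have "rat_homologous p X \<dots> (rat_comb zs (\<lambda>i. \<Sum>r<length zs. (A ^\<^sub>m m) $$ (i, r) * A $$ (r, j)))"
      using rat_comb_comb [of "map ?g zs" p X zs "\<lambda>i j. (A ^\<^sub>m m) $$ (i, j)"] Suc.IH by simp
    also have "rat_comb zs (\<lambda>i. \<Sum>r<length zs. (A ^\<^sub>m m) $$ (i, r) * A $$ (r, j)) =
        rat_comb zs (\<lambda>i. (A ^\<^sub>m Suc m) $$ (i, j))"
      using sum_mult_mat [OF pow_carrier_mat [OF A'(1)] A'(1) _ Suc.prems]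
      by (intro rat_comb_cong) simp
    finally show ?case .
  qed
  then show ?thesis
    using A' rat_hom_matrix_iff [OF zsc continuous_map_funpow [OF f]] by simp
qed

section \<open>From integral to rational bases\<close>

definition int_comb :: "'a chain list \<Rightarrow> (nat \<Rightarrow> int) \<Rightarrow> 'a chain" where
  "int_comb zs a = (\<Sum>i<length zs. frag_cmul (a i) (zs ! i))"

text \<open>Spanning is demanded over the integers, so the condition says that integral homology is
  free on the classes of \<open>zs\<close>, not merely that these are a basis modulo
  torsion.\<close>

definition int_hom_basis :: "nat \<Rightarrow> 'a topology \<Rightarrow> 'a chain list \<Rightarrow> bool" where
  "int_hom_basis p X zs \<longleftrightarrow> (\<forall>z\<in>set zs. singular_relcycle p X {} z) \<and>
     (\<forall>z. singular_relcycle p X {} z \<longrightarrow> (\<exists>a. homologous_rel p X {} z (int_comb zs a))) \<and>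
     (\<forall>a. singular_relboundary p X {} (int_comb zs a) \<longrightarrow> (\<forall>i<length zs. a i = 0))"

lemma rat_of_frag_int_comb: "rat_of_frag (int_comb zs a) = rat_comb (map rat_of_frag zs) (\<lambda>i. of_int (a i))"
  by (simp add: int_comb_def rat_comb_def rat_of_frag_sum rat_of_frag_cmul)

lemma rat_hom_basis_rat_of_frag:
  assumes "int_hom_basis p X zs"
  shows "rat_hom_basis p X (map rat_of_frag zs)"
  unfolding rat_hom_basis_iff
proof (intro conjI ballI allI impI)
  show "set (map rat_of_frag zs) \<subseteq> rat_cycles p X"
    using assms by (auto simp: int_hom_basis_def)
  fix c :: "'a rat_chain"
  assume c: "c \<in> rat_cycles p X"
  then have "c \<in> rat_chain_set p X"
    by (simp add: rat_cycles_def)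
  then obtain N :: int and d where N: "N > 0" "rscale (of_int N) c = rat_of_frag d"
    by (rule rat_chain_cases)
  have "singular_relcycle p X {} d"
    using rat_cycles_linear(3) [OF c, of "of_int N"] by (simp add: N(2))
  then obtain a where "homologous_rel p X {} d (int_comb zs a)"
    using assms by (auto simp: int_hom_basis_def)
  then have "rat_homologous p X (rat_of_frag d) (rat_of_frag (int_comb zs a))"
    unfolding homologous_rel_def rat_homologous_def by (metis rat_of_frag_boundaryI rat_of_frag_diff)
  then have "rat_homologous p X (rscale (1 / of_int N) (rscale (of_int N) c))
      (rscale (1 / of_int N) (rat_comb (map rat_of_frag zs) (\<lambda>i. of_int (a i))))"
    unfolding N(2) rat_of_frag_int_comb by (rule rat_homologous_rscale)
  then have "rat_homologous p X c (rat_comb (map rat_of_frag zs) (\<lambda>i. of_int (a i) / of_int N))"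
    using N(1) by (simp add: rat_comb_def rscale_sum_right)
  then show "\<exists>v. rat_homologous p X c (rat_comb (map rat_of_frag zs) v)"
    by blast
next
  fix v i
  assume v: "rat_comb (map rat_of_frag zs) v \<in> rat_boundaries p X" and i: "i < length (map rat_of_frag zs)"
  \<comment> \<open>Independence clears denominators twice: N makes the coefficients integral, and a
    further factor M makes the resulting cycle bound integrally. Both are positive, so they cancel
    at the end.\<close>
  obtain N :: int where N: "N > 0" "\<And>i. i < length zs \<Longrightarrow> of_int N * v i \<in> \<int>"
    using common_denominator [of "{..<length zs}" v] by auto
  define a where "a i = \<lfloor>of_int N * v i\<rfloor>" for i
  have a: "of_int (a i) = of_int N * v i" if "i < length zs" for i
    using N(2) [OF that] by (auto simp: a_def elim!: Ints_cases)
  have "rat_of_frag (int_comb zs a) = rscale (of_int N) (rat_comb (map rat_of_frag zs) v)"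
    unfolding rat_of_frag_int_comb by (simp add: rat_comb_def rscale_sum_right a)
  then have "rat_of_frag (int_comb zs a) \<in> rat_boundaries p X"
    using v by (simp add: rat_boundaries_linear)
  then obtain M :: int where M: "M > 0" "singular_relboundary p X {} (frag_cmul M (int_comb zs a))"
    by (rule rat_of_frag_boundaryD)
  have "frag_cmul M (int_comb zs a) = int_comb zs (\<lambda>i. M * a i)"
    by (simp add: int_comb_def frag_cmul_sum)
  with M(2) have "\<forall>i<length zs. M * a i = 0"
    using assms unfolding int_hom_basis_def by metis
  then show "v i = 0"
    using M(1) N(1) a [of i] i by auto
qed

lemma singular_relcycle_int_comb:
  "(\<forall>z\<in>set zs. singular_relcycle p X S z) \<Longrightarrow> singular_relcycle p X S (int_comb zs a)"
  unfolding int_comb_def by (intro singular_relcycle_sum singular_relcycle_cmul) auto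

lemma int_comb_append_single: "int_comb (zs @ [w]) a = int_comb zs a + frag_cmul (a (length zs)) w"
  by (simp add: int_comb_def nth_append)

section \<open>Integral bases of homology\<close>

text \<open>The group operation adds representatives of the two classes; conversely, any t
  homologous to a + b splits as (t - b) + b.\<close>

lemma mult_homologous_rel_set:
  "homologous_rel_set p X S a \<otimes>\<^bsub>relative_homology_group (int p) X S\<^esub> homologous_rel_set p X S b =
    homologous_rel_set p X S (a + b)"
proof -
  have "\<exists>r s. homologous_rel p X S a r \<and> homologous_rel p X S b s \<and> t = r + s"
    if "homologous_rel p X S (a + b) t" for t
  proof (intro exI conjI)
    show "homologous_rel p X S a (t - b)"
      using that by (simp add: homologous_rel_def algebra_simps)
  qed auto
  then show ?thesis
    unfolding mult_relative_homology_group by (auto intro: homologous_rel_add)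
qed

text \<open>A homomorphism from the integers is determined by its value at 1. Its values are thereby
  identified with classes of multiples of a chain; the downward step of the induction cancels h
  1.\<close>

lemma iso_integer_group_homologous_rel_set:
  assumes h: "h \<in> iso integer_group (relative_homology_group (int p) X S)"
    and c: "singular_relcycle p X S c" "h 1 = homologous_rel_set p X S c"
  shows "h k = homologous_rel_set p X S (frag_cmul k c)"
proof -
  let ?G = "relative_homology_group (int p) X S"
  interpret G: group ?G by simp
  have hom: "h (a + b) = h a \<otimes>\<^bsub>?G\<^esub> h b" and car: "h a \<in> carrier ?G" for a b
    using h by (auto simp: iso_def hom_def integer_group_def)
  have h0: "h 0 = \<one>\<^bsub>?G\<^esub>"
    using hom [of 0 0] car [of 0] G.r_cancel_one by simp
  show ?thesis
  proof (induction k rule: int_induct [of _ 0])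
    case base
    then show ?case
      using h0 homologous_rel_set_eq_relboundary [of p X S 0] by simp
  next
    case (step1 i)
    then show ?case
      using hom [of i 1] by (simp add: c(2) mult_homologous_rel_set frag_cmul_distrib)
  next
    case (step2 i)
    have "singular_relcycle p X S (frag_cmul (i - 1) c)"
      using c(1) by (rule singular_relcycle_cmul)
    then have "homologous_rel_set p X S (frag_cmul (i - 1) c) \<in> carrier ?G"
      by (auto simp: carrier_relative_homology_group)
    moreover have "homologous_rel_set p X S (frag_cmul (i - 1) c) \<otimes>\<^bsub>?G\<^esub> h 1 = h (i - 1) \<otimes>\<^bsub>?G\<^esub> h 1"
      using hom [of "i - 1" 1] frag_cmul_distrib [of "i - 1" 1 c]
      by (simp add: c(2) mult_homologous_rel_set step2)
    ultimately show ?case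
      using G.right_cancel [OF car [of 1] _ car [of "i - 1"]] by simp
  qed
qed

text \<open>c represents the image of 1. The second and third conclusions are surjectivity and
  injectivity of the isomorphism, phrased with relative boundaries.\<close>

lemma infinite_cyclic_generator:
  assumes "relative_homology_group (int p) X S \<cong> integer_group"
  obtains c where "singular_relcycle p X S c"
    "\<And>z. singular_relcycle p X S z \<Longrightarrow> \<exists>k. singular_relboundary p X S (z - frag_cmul k c)"
    "\<And>k. singular_relboundary p X S (frag_cmul k c) \<Longrightarrow> k = 0"
proof -
  let ?G = "relative_homology_group (int p) X S"
  obtain h where h: "h \<in> iso integer_group ?G"
    using group.iso_sym [OF _ assms] by (auto simp: is_iso_def)
  then have bij: "bij_betw h UNIV (carrier ?G)"
    by (simp add: iso_def integer_group_def)
  then have "h 1 \<in> carrier ?G"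
    by (auto simp: bij_betw_def)
  then obtain c where c: "singular_relcycle p X S c" "h 1 = homologous_rel_set p X S c"
    by (auto simp: carrier_relative_homology_group)
  note hk = iso_integer_group_homologous_rel_set [OF h c]
  show thesis
  proof (rule that [OF c(1)])
    fix z
    assume "singular_relcycle p X S z"
    then have "homologous_rel_set p X S z \<in> h ` UNIV"
      using bij by (auto simp: bij_betw_def carrier_relative_homology_group)
    then obtain k where "homologous_rel_set p X S z = h k"
      by blast
    then have "homologous_rel_set p X S z = homologous_rel_set p X S (frag_cmul k c)"
      using hk [of k] by (rule trans)
    then have "homologous_rel p X S z (frag_cmul k c)"
      by (rule homologous_rel_set_eq [THEN iffD1])
    then show "\<exists>k. singular_relboundary p X S (z - frag_cmul k c)"
      unfolding homologous_rel_def by (rule exI)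
  next
    fix k
    assume "singular_relboundary p X S (frag_cmul k c)"
    then have "homologous_rel p X S (frag_cmul k c) (frag_cmul 0 c)"
      by (simp add: homologous_rel_def)
    then have "homologous_rel_set p X S (frag_cmul k c) = homologous_rel_set p X S (frag_cmul 0 c)"
      by (rule homologous_rel_set_eq [THEN iffD2])
    then have "h k = h 0"
      using trans [OF hk [of k]] trans [OF _ hk [of 0, symmetric]] by blast
    then show "k = 0"
      using bij by (auto simp: bij_betw_def inj_on_def)
  qed
qed

section \<open>Pairs with vanishing connecting maps\<close>

lemma trivial_relative_homology_relboundary:
  assumes "trivial_group (relative_homology_group (int p) X S)" "singular_relcycle p X S z"
  shows "singular_relboundary p X S z"
proof -
  have "homologous_rel_set p X S z \<in> carrier (relative_homology_group (int p) X S)"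
    using assms(2) by (auto simp: carrier_relative_homology_group)
  then have "homologous_rel_set p X S z = singular_relboundary_set p X S"
    using assms(1) by (simp add: trivial_group_def)
  then show ?thesis
    by (simp add: homologous_rel_set_eq_relboundary)
qed

text \<open>In degrees p and p + 1 together, this condition cuts a short exact sequence 0 -> H_p(S)
  -> H_p(X) -> H_p(X, S) -> 0 out of the long one.\<close>

definition zero_hom_boundary :: "int \<Rightarrow> 'a topology \<Rightarrow> 'a set \<Rightarrow> bool" where
  "zero_hom_boundary p X S \<longleftrightarrow> (\<forall>u\<in>carrier (relative_homology_group p X S).
     hom_boundary p X S u = \<one>\<^bsub>homology_group (p - 1) (subtopology X S)\<^esub>)"

lemma zero_hom_boundaryD:
  assumes "zero_hom_boundary (int (Suc p)) X S" "singular_relcycle (Suc p) X S c"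
  shows "singular_relboundary p (subtopology X S) {} (chain_boundary (Suc p) c)"
proof -
  have "homologous_rel_set (Suc p) X S c \<in> carrier (relative_homology_group (int (Suc p)) X S)"
    unfolding carrier_relative_homology_group using assms(2) by blast
  then have "hom_boundary (int (Suc p)) X S (homologous_rel_set (Suc p) X S c) =
      \<one>\<^bsub>homology_group (int (Suc p) - 1) (subtopology X S)\<^esub>"
    using assms(1) unfolding zero_hom_boundary_def by blast
  then have "homologous_rel_set p (subtopology X S) {} (chain_boundary (Suc p) c) =
      singular_relboundary_set p (subtopology X S) {}"
    using hom_boundary_chain_boundary [OF assms(2)] by simp
  then show ?thesis
    by (rule homologous_rel_set_eq_relboundary [THEN iffD1])
qed

lemma singular_boundary_subtopologyD:
  "singular_relboundary p (subtopology X S) {} c \<Longrightarrow> singular_relboundary p X {} c"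
  using singular_boundary_mono [of S UNIV p X c] by simp

text \<open>Injectivity of H_p(S) -> H_p(X): a chain of X with boundary z is a relative cycle, and
  the connecting map sends its class to that of z.\<close>

lemma singular_boundary_subtopologyI:
  assumes "zero_hom_boundary (int (Suc p)) X S"
    "singular_relboundary p X {} z" "singular_chain p (subtopology X S) z"
  shows "singular_relboundary p (subtopology X S) {} z"
proof -
  obtain d where "singular_chain (Suc p) X d" "chain_boundary (Suc p) d = z"
    using assms(2) by (auto simp: singular_boundary)
  then show ?thesis
    using zero_hom_boundaryD [OF assms(1), of d] assms(3) by (simp add: singular_relcycle)
qed

text \<open>Exactness at H_p(X): if z is a boundary relative to S, it is an absolute boundary plus a
  chain e in S. Then e is itself a cycle and can be expanded in the basis of S.\<close>

lemma int_hom_basis_spans_relboundary: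
  assumes zs: "int_hom_basis p (subtopology X S) zs"
    and z: "singular_relcycle p X {} z" "singular_relboundary p X S z"
  shows "\<exists>a. homologous_rel p X {} z (int_comb zs a)"
proof -
  obtain d e where d: "singular_chain (Suc p) X d" and e: "singular_chain p (subtopology X S) e"
    and z_eq: "chain_boundary (Suc p) d + e = z"
    using z(2) by (auto simp: singular_relboundary)
  have "chain_boundary p (chain_boundary (Suc p) d) = 0"
    using chain_boundary_boundary_alt [OF d] .
  then have "chain_boundary p e = 0"
    using z(1) by (auto simp: singular_cycle chain_boundary_add simp flip: z_eq)
  then have "singular_relcycle p (subtopology X S) {} e"
    using e by (simp add: singular_cycle)
  then obtain a where "homologous_rel p (subtopology X S) {} e (int_comb zs a)"
    using zs by (auto simp: int_hom_basis_def)
  then have "singular_relboundary p X {} (e - int_comb zs a)"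
    unfolding homologous_rel_def by (rule singular_boundary_subtopologyD)
  moreover have "singular_relboundary p X {} (chain_boundary (Suc p) d)"
    using d by (auto simp: singular_boundary)
  ultimately have "singular_relboundary p X {} (chain_boundary (Suc p) d + (e - int_comb zs a))"
    by (intro singular_relboundary_add)
  then show ?thesis
    unfolding homologous_rel_def z_eq [symmetric] by (auto simp: algebra_simps)
qed

lemma singular_cycle_subtopologyD:
  "singular_relcycle p (subtopology X S) {} c \<Longrightarrow> singular_relcycle p X {} c"
  using singular_cycle_mono [of p X S c UNIV] by simp

lemma singular_cycle_imp_relcycle:
  assumes "singular_relcycle p X {} c"
  shows "singular_relcycle p X S c"
  using assms [unfolded singular_cycle] by (simp add: singular_relcycle)

lemma int_hom_basis_trivial_pair:
  assumes zs: "int_hom_basis p (subtopology X S) zs"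
    and triv: "trivial_group (relative_homology_group (int p) X S)"
    and bd: "zero_hom_boundary (int (Suc p)) X S"
  shows "int_hom_basis p X zs"
  unfolding int_hom_basis_def
proof (intro conjI ballI allI impI)
  have zs_cycle: "\<forall>z\<in>set zs. singular_relcycle p (subtopology X S) {} z"
    using zs by (simp add: int_hom_basis_def)
  then show "singular_relcycle p X {} z" if "z \<in> set zs" for z
    using that singular_cycle_subtopologyD by blast
  show "\<exists>a. homologous_rel p X {} z (int_comb zs a)" if z: "singular_relcycle p X {} z" for z
  proof -
    have "singular_relcycle p X S z"
      by (rule singular_cycle_imp_relcycle [OF z])
    then show ?thesis
      using int_hom_basis_spans_relboundary [OF zs z trivial_relative_homology_relboundary [OF triv]] by simp
  qed
  show "a i = 0" if "singular_relboundary p X {} (int_comb zs a)" "i < length zs" for a i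
    using singular_boundary_subtopologyI [OF bd that(1)] singular_relcycle_int_comb [OF zs_cycle, of a] zs that(2)
    by (auto simp: int_hom_basis_def singular_cycle)
qed

text \<open>The boundary of a relative generator c bounds some x inside S, because the connecting
  map in the degree of c is zero. Thus c - x is an absolute cycle lifting the generator. Vanishing
  one degree higher keeps the old basis independent in X.\<close>

lemma int_hom_basis_cyclic_pair:
  assumes zs: "int_hom_basis (Suc p) (subtopology X S) zs"
    and cyc: "relative_homology_group (int (Suc p)) X S \<cong> integer_group"
    and bd: "zero_hom_boundary (int (Suc p)) X S" "zero_hom_boundary (int (Suc (Suc p))) X S"
  obtains w where "int_hom_basis (Suc p) X (zs @ [w])"
proof -
  let ?p = "Suc p"
  obtain c where c: "singular_relcycle ?p X S c"
    and gen: "\<And>z. singular_relcycle ?p X S z \<Longrightarrow> \<exists>k. singular_relboundary ?p X S (z - frag_cmul k c)"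
    and free: "\<And>k. singular_relboundary ?p X S (frag_cmul k c) \<Longrightarrow> k = 0"
    using infinite_cyclic_generator [OF cyc] by blast
  obtain x where x: "singular_chain ?p (subtopology X S) x" "chain_boundary ?p x = chain_boundary ?p c"
    using zero_hom_boundaryD [OF bd(1) c] by (auto simp: singular_boundary)
  have xX: "singular_chain ?p X x"
    using singular_chain_mono [of ?p X S x UNIV] x(1) by simp
  define w where "w = c - x"
  have w: "singular_relcycle ?p X {} w"
    using c x xX by (simp add: w_def singular_cycle singular_relcycle singular_chain_diff chain_boundary_diff)
  have xk: "singular_relboundary ?p X S (frag_cmul k x)" for k
    by (intro singular_chain_imp_relboundary singular_chain_cmul x)
  have kw: "frag_cmul k w = frag_cmul k c - frag_cmul k x" for k
    unfolding w_def by (rule poly_mapping_eqI) (simp add: lookup_minus right_diff_distrib)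
  have zs_cycle: "\<forall>z\<in>set zs. singular_relcycle ?p (subtopology X S) {} z"
    using zs by (simp add: int_hom_basis_def)
  have comb: "singular_chain ?p (subtopology X S) (int_comb zs a)" for a
    using singular_relcycle_int_comb [OF zs_cycle, of a] by (simp add: singular_cycle)
  have "int_hom_basis ?p X (zs @ [w])"
    unfolding int_hom_basis_def
  proof (intro conjI ballI allI impI)
    show "singular_relcycle ?p X {} z" if "z \<in> set (zs @ [w])" for z
      using that zs_cycle w singular_cycle_subtopologyD [of ?p X S z] by auto
    show "\<exists>a. homologous_rel ?p X {} z (int_comb (zs @ [w]) a)" if z: "singular_relcycle ?p X {} z" for z
    proof -
      have "singular_relcycle ?p X S z"
        by (rule singular_cycle_imp_relcycle [OF z])
      then obtain k where "singular_relboundary ?p X S (z - frag_cmul k c)"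
        using gen by blast
      then have "singular_relboundary ?p X S (z - frag_cmul k w)"
        using singular_relboundary_add [OF _ xk [of k]] by (fastforce simp: kw algebra_simps)
      moreover have "singular_relcycle ?p X {} (z - frag_cmul k w)"
        by (intro singular_relcycle_diff singular_relcycle_cmul z w)
      ultimately obtain a where a: "homologous_rel ?p X {} (z - frag_cmul k w) (int_comb zs a)"
        using int_hom_basis_spans_relboundary [OF zs] by blast
      have "int_comb (zs @ [w]) (a(length zs := k)) = int_comb zs a + frag_cmul k w"
        unfolding int_comb_append_single by (simp add: int_comb_def)
      then have "homologous_rel ?p X {} z (int_comb (zs @ [w]) (a(length zs := k)))"
        using a by (simp add: homologous_rel_def algebra_simps)
      then show ?thesis by blast
    qed
    show "a i = 0" if a: "singular_relboundary ?p X {} (int_comb (zs @ [w]) a)" and i: "i < length (zs @ [w])" for a i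
    proof -
      let ?k = "a (length zs)"
      obtain d where d: "singular_chain (Suc ?p) X d"
        "chain_boundary (Suc ?p) d = int_comb zs a + frag_cmul ?k w"
        using a by (auto simp: singular_boundary int_comb_append_single)
      \<comment> \<open>Modulo S the combination of \<open>zs\<close> disappears and k w becomes k
        c. So k c is a relative boundary, and freeness of c forces k = 0.\<close>
      have "singular_relboundary ?p X S (int_comb zs a + frag_cmul ?k w)"
        unfolding singular_relboundary using d by (metis add.right_neutral singular_chain_0)
      then have "singular_relboundary ?p X S (int_comb zs a + frag_cmul ?k w - int_comb zs a + frag_cmul ?k x)"
        by (rule singular_relboundary_add [OF singular_relboundary_diff [OF _ singular_chain_imp_relboundary [OF comb]] xk])
      then have k0: "?k = 0"
        by (intro free) (simp add: kw)
      then have "singular_relboundary ?p X {} (int_comb zs a)"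
        using a by (simp add: int_comb_append_single)
      then have "\<forall>i<length zs. a i = 0"
        using singular_boundary_subtopologyI [OF bd(2) _ comb] zs by (auto simp: int_hom_basis_def)
      then show ?thesis
        using k0 i by (auto simp: less_Suc_eq)
    qed
  qed
  then show thesis by (rule that)
qed

text \<open>For S empty the statements on pairs turn into statements on absolute homology, starting
  from the empty basis.\<close>

lemma zero_hom_boundary_empty: "zero_hom_boundary p X {}"
proof -
  have "trivial_group (homology_group (p - 1) (subtopology X {}))"
    by (rule trivial_homology_group_empty) simp
  then show ?thesis
    using hom_boundary_carrier [of p X "{}"] by (auto simp: zero_hom_boundary_def trivial_group_def)
qed

lemma int_hom_basis_empty: "int_hom_basis p (subtopology X {}) []"
  by (auto simp: int_hom_basis_def int_comb_def singular_cycle singular_chain_empty)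

lemma int_hom_basis_trivial:
  "trivial_group (homology_group (int p) X) \<Longrightarrow> int_hom_basis p X []"
  by (intro int_hom_basis_trivial_pair [OF int_hom_basis_empty] zero_hom_boundary_empty)

lemma int_hom_basis_cyclic:
  assumes "homology_group (int p) X \<cong> integer_group" "p \<noteq> 0"
  obtains w where "int_hom_basis p X [w]"
proof -
  obtain q where "p = Suc q"
    using assms(2) not0_implies_Suc by blast
  then show thesis
    using int_hom_basis_cyclic_pair [OF int_hom_basis_empty, of q X] assms(1) zero_hom_boundary_empty that
    by (metis append_Nil)
qed

lemma chain_map_int_comb:
  "chain_map p g (int_comb zs a) = int_comb (map (chain_map p g) zs) a"
  by (simp add: int_comb_def chain_map_sum)

lemma int_hom_basis_homeomorphic:
  assumes zs: "int_hom_basis p Y zs" and gh: "homeomorphic_maps X Y h g"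
  shows "int_hom_basis p X (map (chain_map p g) zs)"
  unfolding int_hom_basis_def
proof (intro conjI ballI allI impI)
  have h: "continuous_map X Y h" and g: "continuous_map Y X g"
    and gh_id: "\<And>x. x \<in> topspace X \<Longrightarrow> g (h x) = x" and hg_id: "\<And>y. y \<in> topspace Y \<Longrightarrow> h (g y) = y"
    using gh by (auto simp: homeomorphic_maps_def)
  have cyc: "\<forall>z\<in>set zs. singular_relcycle p Y {} z"
    using zs by (simp add: int_hom_basis_def)
  have map_hg: "chain_map p g (chain_map p h c) = c" if "singular_chain p X c" for c
    using chain_map_id_gen [OF that, of "g \<circ> h"] gh_id by (simp add: chain_map_compose)
  have map_gh: "chain_map p h (chain_map p g c) = c" if "singular_chain p Y c" for c
    using chain_map_id_gen [OF that, of "h \<circ> g"] hg_id by (simp add: chain_map_compose)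
  show "singular_relcycle p X {} z" if "z \<in> set (map (chain_map p g) zs)" for z
    using that cyc singular_relcycle_chain_map [OF _ g] by auto
  show "\<exists>a. homologous_rel p X {} z (int_comb (map (chain_map p g) zs) a)" if z: "singular_relcycle p X {} z" for z
  proof -
    have "singular_relcycle p Y {} (chain_map p h z)"
      using singular_relcycle_chain_map [OF z h, of "{}"] by simp
    then obtain a where "homologous_rel p Y {} (chain_map p h z) (int_comb zs a)"
      using zs unfolding int_hom_basis_def by blast
    then have "singular_relboundary p X {} (chain_map p g (chain_map p h z - int_comb zs a))"
      unfolding homologous_rel_def using singular_relboundary_chain_map [OF _ g] by auto
    then have "homologous_rel p X {} z (int_comb (map (chain_map p g) zs) a)"
      using z by (simp add: homologous_rel_def chain_map_diff map_hg chain_map_int_comb singular_cycle)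
    then show ?thesis by blast
  qed
  show "a i = 0" if a: "singular_relboundary p X {} (int_comb (map (chain_map p g) zs) a)"
    and i: "i < length (map (chain_map p g) zs)" for a i
  proof -
    have "singular_relboundary p Y {} (chain_map p h (chain_map p g (int_comb zs a)))"
      using singular_relboundary_chain_map [OF a h] by (simp add: chain_map_int_comb)
    then have "singular_relboundary p Y {} (int_comb zs a)"
      using map_gh singular_relcycle_int_comb [OF cyc, of a] by (simp add: singular_cycle)
    then show ?thesis
      using zs i by (auto simp: int_hom_basis_def)
  qed
qed

text \<open>In degree 0 the generator is named explicitly, as the class of a chosen point, so that
  the action of f on it can be computed.\<close>

lemma int_hom_basis_0:
  assumes X: "path_connected_space X" and s: "singular_simplex 0 X s"
  shows "int_hom_basis 0 X [frag_of s]"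
proof -
  let ?G = "homology_group 0 X" and ?c = "homologous_rel_set 0 X {} (frag_of s)"
  have h: "pow ?G ?c \<in> iso integer_group (relative_homology_group (int 0) X {})"
    using iso_integer_zeroth_homology_group [OF X s] by simp
  have c: "singular_relcycle 0 X {} (frag_of s)"
    using s by (simp add: singular_cycle singular_chain_of chain_boundary_def)
  have "?c \<in> carrier ?G"
    using c by (auto simp: carrier_relative_homology_group_0)
  then have h1: "pow ?G ?c (1::int) = ?c"
    using group.int_pow_1 [OF group_relative_homology_group] by blast
  note hk = iso_integer_group_homologous_rel_set [OF h c h1]
  have bij: "bij_betw (pow ?G ?c) (UNIV :: int set) (carrier ?G)"
    using h by (simp add: iso_def integer_group_def)
  show ?thesis
    unfolding int_hom_basis_def
  proof (intro conjI ballI allI impI)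
    show "singular_relcycle 0 X {} z" if "z \<in> set [frag_of s]" for z
      using that c by simp
    show "\<exists>a. homologous_rel 0 X {} z (int_comb [frag_of s] a)" if z: "singular_relcycle 0 X {} z" for z
    proof -
      have "homologous_rel_set 0 X {} z \<in> carrier ?G"
        using z by (auto simp: carrier_relative_homology_group_0)
      then obtain k :: int where "homologous_rel_set 0 X {} z = pow ?G ?c k"
        using bij unfolding bij_betw_def by (metis imageE)
      then have "homologous_rel_set 0 X {} z = homologous_rel_set 0 X {} (frag_cmul k (frag_of s))"
        using hk [of k] by (rule trans)
      then have "homologous_rel 0 X {} z (frag_cmul k (frag_of s))"
        by (rule homologous_rel_set_eq [THEN iffD1])
      then have "homologous_rel 0 X {} z (int_comb [frag_of s] (\<lambda>_. k))"
        by (simp add: int_comb_def)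
      then show ?thesis by blast
    qed
    show "a i = 0" if "singular_relboundary 0 X {} (int_comb [frag_of s] a)" "i < length [frag_of s]" for a i
    proof -
      have "homologous_rel_set 0 X {} (frag_cmul (a 0) (frag_of s)) = homologous_rel_set 0 X {} (frag_cmul 0 (frag_of s))"
        unfolding homologous_rel_set_eq using that(1) by (simp add: int_comb_def homologous_rel_def)
      from trans [OF trans [OF hk [of "a 0"] this] hk [of 0, symmetric]]
      have "pow ?G ?c (a 0) = pow ?G ?c (0::int)" .
      then have "a 0 = 0"
        using bij unfolding bij_betw_def inj_on_def by blast
      then show ?thesis
        using that(2) by simp
    qed
  qed
qed

text \<open>In a path-connected space f moves a point to a homologous one; this is why every map has
  trace 1 on H_0.\<close>

lemma rat_hom_matrix_0:
  assumes X: "path_connected_space X" and s: "singular_simplex 0 X s" and f: "continuous_map X X f"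
  shows "rat_hom_matrix 0 X f [rat_of_frag (frag_of s)] (1\<^sub>m 1)"
proof -
  have cyc: "set [rat_of_frag (frag_of s)] \<subseteq> rat_cycles 0 X"
    using s by (simp add: singular_cycle singular_chain_of chain_boundary_def)
  have "homologous_rel 0 X {} (chain_map 0 f (frag_of s)) (frag_of s)"
    using iso_integer_zeroth_homology_group_aux [OF X singular_simplex_simplex_map [OF s f] s] by simp
  then have "rat_homologous 0 X (rat_chain_map 0 f (rat_of_frag (frag_of s))) (rat_of_frag (frag_of s))"
    unfolding homologous_rel_def rat_homologous_def rat_of_frag_chain_map rat_of_frag_diff [symmetric]
    by (rule rat_of_frag_boundaryI)
  then show ?thesis
    unfolding rat_hom_matrix_iff [OF cyc f] by (simp add: rat_comb_def)
qed

section \<open>Gluing along a closed subset\<close>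

text \<open>A strong deformation retraction. Keeping A pointwise fixed at all times allows a
  homotopy on D to be extended by the identity after gluing.\<close>

definition deforms_onto :: "'a topology \<Rightarrow> 'a set \<Rightarrow> (real \<times> 'a \<Rightarrow> 'a) \<Rightarrow> bool" where
  "deforms_onto V A h \<longleftrightarrow> A \<subseteq> topspace V \<and>
     continuous_map (prod_topology (top_of_set {0..1}) V) V h \<and>
     (\<forall>x\<in>topspace V. h (0, x) = x \<and> h (1, x) \<in> A) \<and> (\<forall>t\<in>{0..1}. \<forall>a\<in>A. h (t, a) = a)"

lemma deforms_onto_trivial_homology:
  assumes "deforms_onto V A h"
  shows "trivial_group (relative_homology_group p V A)"
proof (rule trivial_relative_homology_group_alt)
  have h: "continuous_map (prod_topology (top_of_set {0..1}) V) V h" and A: "A \<subseteq> topspace V"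
    and h01: "\<And>x. x \<in> topspace V \<Longrightarrow> h (0, x) = x" "\<And>x. x \<in> topspace V \<Longrightarrow> h (1, x) \<in> A"
    and fixed: "\<And>t a. t \<in> {0..1} \<Longrightarrow> a \<in> A \<Longrightarrow> h (t, a) = a"
    using assms by (auto simp: deforms_onto_def)
  have "continuous_map V V (h \<circ> Pair 1)"
    using continuous_map_o_Pair [OF h, of 1] by simp
  then show "continuous_map V (subtopology V A) (\<lambda>x. h (1, x))"
    using h01(2) by (simp add: continuous_map_in_subtopology o_def Pi_iff)
  have "homotopic_with (\<lambda>k. k ` A \<subseteq> A) V V id (\<lambda>x. h (1, x))"
  proof (subst homotopic_with)
    show "k ` A \<subseteq> A \<longleftrightarrow> k' ` A \<subseteq> A" if "\<And>x. x \<in> topspace V \<Longrightarrow> k x = k' x" for k k' :: "'a \<Rightarrow> 'a"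
    proof -
      have "k ` A = k' ` A"
        using that A by (intro image_cong) auto
      then show ?thesis by simp
    qed
    show "\<exists>g. continuous_map (prod_topology (top_of_set {0..1::real}) V) V g \<and> (\<forall>x\<in>topspace V. g (0, x) = id x) \<and>
        (\<forall>x\<in>topspace V. g (1, x) = h (1, x)) \<and> (\<forall>t\<in>{0..1}. (\<lambda>x. g (t, x)) ` A \<subseteq> A)"
      by (rule exI [of _ h]) (use h h01 fixed in auto)
  qed
  then show "homotopic_with (\<lambda>k. k ` A \<subseteq> A) V V (\<lambda>x. h (1, x)) id"
    by (simp add: homotopic_with_sym)
qed

text \<open>In the exact sequence of the triple (X, S, T) the groups of the pair (S, T)
  vanish.\<close>

lemma iso_relativization_deforms_onto:
  assumes h: "deforms_onto (subtopology X S) T h"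
  shows "hom_induced p X T X S id \<in> iso (relative_homology_group p X T) (relative_homology_group p X S)"
proof (rule very_short_exact_sequence)
  have "T \<subseteq> S"
    using h by (auto simp: deforms_onto_def)
  then show "exact_seq
         ([relative_homology_group (p - 1) (subtopology X S) T, relative_homology_group p X S,
           relative_homology_group p X T, relative_homology_group p (subtopology X S) T],
          [hom_relboundary p X S T, hom_induced p X T X S id, hom_induced p (subtopology X S) T X T id])"
    using homology_exactness_triple_1 [of T S] homology_exactness_triple_3 [of T S] by fastforce
qed (rule deforms_onto_trivial_homology [OF h])+

lemma iso_excise_closed:
  assumes "closedin X A" "openin X V" "A \<subseteq> V"
  shows "hom_induced p (subtopology X (topspace X - A)) (V - A) X V id
    \<in> iso (relative_homology_group p (subtopology X (topspace X - A)) (V - A)) (relative_homology_group p X V)"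
proof -
  have "X closure_of A \<subseteq> X interior_of V"
    using assms by (simp add: closure_of_closedin interior_of_openin)
  from homology_excision_axiom [OF this openin_subset [OF assms(2)], of p] show ?thesis
    by simp
qed

text \<open>The issue is to extend an open U of X to the glued space. Its preimage in A is the trace
  of an open V of D; by injectivity of j, adding the image of V - A to U gives a set with preimage
  exactly V.\<close>

lemma subtopology_glue:
  assumes A: "closedin D A" and jA: "continuous_map (subtopology D A) X j"
    and inj: "inj_on j (topspace D)" and new: "j ` (topspace D - A) \<inter> topspace X = {}"
  shows "subtopology (glue X D j) (topspace X) = X"
  unfolding topology_eq
proof (intro allI iffI)
  fix U
  assume "openin (subtopology (glue X D j) (topspace X)) U"
  then show "openin X U"
    by (auto simp: openin_subtopology openin_glue)
next
  fix U
  assume U: "openin X U"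
  have UX: "U \<subseteq> topspace X"
    using U by (rule openin_subset)
  have AD: "A \<subseteq> topspace D"
    using A by (rule closedin_subset)
  have jAX: "j x \<in> topspace X" if "x \<in> A" for x
    using continuous_map_funspace [OF jA] that AD by auto
  have "openin (subtopology D A) {x \<in> topspace (subtopology D A). j x \<in> U}"
    using jA U by (rule openin_continuous_map_preimage)
  then obtain V where V: "openin D V" and VA: "{x \<in> topspace (subtopology D A). j x \<in> U} = V \<inter> A"
    by (auto simp: openin_subtopology)
  have VD: "V \<subseteq> topspace D"
    using V by (rule openin_subset)
  have VA': "x \<in> V \<longleftrightarrow> j x \<in> U" if "x \<in> A" for x
    using VA that AD by auto
  let ?W = "U \<union> j ` (V - A)"
  have "?W \<inter> topspace X = U"
    using UX VD new by blast
  moreover have "{x \<in> topspace D. j x \<in> ?W} = V"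
  proof -
    have "j x \<in> ?W \<longleftrightarrow> x \<in> V" if x: "x \<in> topspace D" for x
    proof (cases "x \<in> A")
      case True
      have "j x \<notin> j ` (V - A)"
        using jAX [OF True] new VD by blast
      then show ?thesis
        using VA' [OF True] by blast
    next
      case False
      then have "j x \<notin> U"
        using new UX x by blast
      moreover have "j x \<in> j ` (V - A) \<longleftrightarrow> x \<in> V - A"
        by (rule inj_on_image_mem_iff [OF inj x]) (use VD in blast)
      ultimately show ?thesis
        using False by blast
    qed
    then show ?thesis
      using VD by blast
  qed
  moreover have "?W \<subseteq> topspace X \<union> j ` topspace D"
    using UX VD by blast
  ultimately have "openin (glue X D j) ?W"
    unfolding openin_glue using U V by simp
  then show "openin (subtopology (glue X D j) (topspace X)) U"
    unfolding openin_subtopology using \<open>?W \<inter> topspace X = U\<close> by blast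
qed

text \<open>A continuous map from a compact space to a Hausdorff one is closed, so the injective j
  embeds all of D, including its boundary, as a closed subspace of the glued space.\<close>

locale closed_glue =
  fixes X :: "'a topology" and D :: "'b topology" and A and j
  assumes A: "closedin D A" and jA: "continuous_map (subtopology D A) X j"
    and inj: "inj_on j (topspace D)" and new: "j ` (topspace D - A) \<inter> topspace X = {}"
    and D_compact: "compact_space D" and D_Hausdorff: "Hausdorff_space D"
    and Hausdorff: "Hausdorff_space (glue X D j)"
begin

abbreviation Y where "Y \<equiv> glue X D j"

lemma subtopology_Y: "subtopology Y (topspace X) = X"
  using A jA inj new by (rule subtopology_glue)

lemma A_subset: "A \<subseteq> topspace D"
  using A by (rule closedin_subset)

lemma topspace_subset: "topspace X \<subseteq> topspace Y" "j ` topspace D \<subseteq> topspace Y"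
  by (auto simp: topspace_glue)

lemma in_X_iff: "x \<in> topspace D \<Longrightarrow> j x \<in> topspace X \<longleftrightarrow> x \<in> A"
  using continuous_map_funspace [OF jA] A_subset new by auto

lemma continuous_j: "continuous_map D Y j"
proof -
  \<comment> \<open>Continuity of j is the universal property of the gluing, applied to the
    identity.\<close>
  have "continuous_map Y Y id"
    by simp
  then show ?thesis
    unfolding continuous_map_from_glue [of X D j Y] by simp
qed

lemma closed_map_j: "closed_map D Y j"
  using continuous_j D_compact Hausdorff by (rule continuous_imp_closed_map)

lemma closedin_X: "closedin Y (topspace X)"
proof -
  have "{x \<in> topspace D. j x \<in> topspace Y - topspace X} = topspace D - A"
    using in_X_iff topspace_subset by auto
  moreover have "(topspace Y - topspace X) \<inter> topspace X = {}"
    by blast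
  moreover have "openin D (topspace D - A)"
    using A by (simp add: closedin_def)
  ultimately have "openin Y (topspace Y - topspace X)"
    unfolding openin_glue by (simp add: topspace_glue)
  then show ?thesis
    using topspace_subset by (simp add: closedin_def)
qed

lemma homeomorphic_j: "homeomorphic_map D (subtopology Y (j ` topspace D)) j"
  using injective_closed_imp_embedding_map [OF continuous_j closed_map_j inj]
  by (simp add: embedding_map_def)

lemma complement_image: "topspace Y - topspace X = j ` (topspace D - A)"
proof -
  have "y \<in> j ` (topspace D - A)" if y: "y \<in> topspace Y" "y \<notin> topspace X" for y
  proof -
    obtain x where "x \<in> topspace D" "y = j x"
      using y by (auto simp: topspace_glue)
    then show ?thesis
      using y(2) in_X_iff by auto
  qed
  moreover have "j ` (topspace D - A) \<subseteq> topspace Y - topspace X"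
    using in_X_iff topspace_subset(2) by auto
  ultimately show ?thesis
    by blast
qed

text \<open>The deformation of the punctured D is carried over by j and pasted with the constant
  homotopy on X. The two closed parts meet in the image of A, where the deformation stands
  still.\<close>

lemma deforms_onto_glue:
  assumes c: "c \<in> topspace D" "c \<notin> A"
    and h: "deforms_onto (subtopology D (topspace D - {c})) A h"
  obtains H where "deforms_onto (subtopology Y (topspace Y - {j c})) (topspace X) H"
proof -
  let ?I = "top_of_set {0..1::real}"
  let ?D' = "topspace D - {c}" and ?V' = "topspace Y - {j c}"
  let ?V = "subtopology Y ?V'"
  obtain g where g: "homeomorphic_maps D (subtopology Y (j ` topspace D)) j g"
    using homeomorphic_j homeomorphic_map_maps by blast
  have gj: "g (j x) = x" if "x \<in> topspace D" for x
    using g that by (simp add: homeomorphic_maps_def)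
  have jc: "j c \<notin> topspace X"
    using c in_X_iff by blast
  have topV: "topspace ?V = ?V'"
    by auto
  have jD': "j ` ?D' = j ` topspace D - {j c}"
    using inj c(1) by (auto simp: inj_on_def)
  have jD'_sub: "j ` ?D' \<subseteq> ?V'"
    using jD' topspace_subset by blast
  have cover: "?V' = topspace X \<union> j ` ?D'"
    using jc unfolding jD' topspace_glue by blast
  have h_cont: "continuous_map (prod_topology ?I (subtopology D ?D')) (subtopology D ?D') h"
    and h01: "\<And>x. x \<in> ?D' \<Longrightarrow> h (0, x) = x" "\<And>x. x \<in> ?D' \<Longrightarrow> h (1, x) \<in> A"
    and fixed: "\<And>t a. t \<in> {0..1} \<Longrightarrow> a \<in> A \<Longrightarrow> h (t, a) = a"
    using h by (auto simp: deforms_onto_def)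
  define H where "H = (\<lambda>(t, y). if y \<in> topspace X then y else j (h (t, g y)))"
  have agree: "j (h (t, g y)) = y" if t: "t \<in> {0..1}" and yX: "y \<in> topspace X" and yD: "y \<in> j ` ?D'" for t y
  proof -
    obtain x where x: "x \<in> ?D'" "y = j x"
      using yD by blast
    then have "x \<in> A"
      using yX in_X_iff by auto
    then show ?thesis
      using fixed [OF t] x gj by simp
  qed
  have "continuous_map (prod_topology ?I ?V) ?V H"
  proof (rule pasting_lemma_closed)
    let ?T = "\<lambda>b. {0..1::real} \<times> (if b then topspace X else j ` ?D')"
    let ?f = "\<lambda>b. if b then snd else (\<lambda>(t, y). j (h (t, g y)))"
    show "finite (UNIV :: bool set)"
      by simp
    have "closedin ?V (topspace X)"
      using closedin_X jc topspace_subset(1) by (auto simp: closedin_subtopology)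
    moreover have "closedin ?V (j ` ?D')"
    proof -
      have "closedin Y (j ` topspace D)"
        using closed_map_j by (simp add: closed_map_def)
      then show ?thesis
        using jD' topspace_subset(2) by (auto simp: closedin_subtopology)
    qed
    ultimately show "closedin (prod_topology ?I ?V) (?T b)" for b
      by (simp add: closedin_prod_Times_iff)
    show "continuous_map (subtopology (prod_topology ?I ?V) (?T b)) ?V (?f b)" for b
    proof (cases b)
      case True
      then show ?thesis
        by (simp add: continuous_map_from_subtopology continuous_map_snd)
    next
      case False
      have sub: "subtopology (prod_topology ?I ?V) ({0..1} \<times> j ` ?D') = prod_topology ?I (subtopology Y (j ` ?D'))"
        using jD'_sub by (simp add: subtopology_Times subtopology_subtopology Int_absorb1)
      have "continuous_map (subtopology Y (j ` topspace D)) D g"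
        using g by (simp add: homeomorphic_maps_def)
      then have "continuous_map (subtopology (subtopology Y (j ` topspace D)) (j ` ?D')) (subtopology D ?D') g"
        using gj inj_onD [OF inj _ _ c(1)]
        by (auto simp: continuous_map_in_subtopology continuous_map_from_subtopology)
      then have g': "continuous_map (subtopology Y (j ` ?D')) (subtopology D ?D') g"
        by (simp add: subtopology_subtopology Int_absorb1 image_mono)
      have "continuous_map (prod_topology ?I (subtopology Y (j ` ?D'))) (prod_topology ?I (subtopology D ?D'))
          (\<lambda>z. (fst z, g (snd z)))"
        using continuous_map_compose [OF continuous_map_snd g', of ?I]
        by (simp add: continuous_map_pairwise continuous_map_fst o_def)
      from continuous_map_compose [OF this h_cont]
      have hg: "continuous_map (prod_topology ?I (subtopology Y (j ` ?D'))) (subtopology D ?D')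
          (\<lambda>z. h (fst z, g (snd z)))"
        by (simp add: o_def)
      have j': "continuous_map (subtopology D ?D') ?V j"
        using jD'_sub continuous_j
        by (auto simp: continuous_map_in_subtopology continuous_map_from_subtopology image_subset_iff)
      from continuous_map_compose [OF hg j'] False show ?thesis
        by (simp add: sub o_def case_prod_unfold)
    qed
    show "?f b x = ?f b' x" if "x \<in> topspace (prod_topology ?I ?V) \<inter> ?T b \<inter> ?T b'" for b b' x
      using that agree by (cases x; cases b; cases b') auto
    show "\<exists>b. b \<in> UNIV \<and> x \<in> ?T b \<and> H x = ?f b x" if x: "x \<in> topspace (prod_topology ?I ?V)" for x
    proof (cases "snd x \<in> topspace X")
      case True
      then show ?thesis
        using x by (intro exI [of _ True]) (auto simp: H_def case_prod_unfold)
    next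
      case False
      then have "snd x \<in> j ` ?D'"
        using x cover by (auto simp: topV)
      then show ?thesis
        using x False by (intro exI [of _ False]) (auto simp: H_def case_prod_unfold)
    qed
  qed
  moreover have "H (0, y) = y \<and> H (1, y) \<in> topspace X" if y: "y \<in> ?V'" for y
  proof (cases "y \<in> topspace X")
    case True
    then show ?thesis by (simp add: H_def)
  next
    case False
    then obtain x where x: "x \<in> ?D'" "y = j x"
      using y cover by blast
    have "h (1, x) \<in> A"
      using h01(2) x(1) by blast
    then have "j (h (1, x)) \<in> topspace X"
      using in_X_iff A_subset by blast
    then show ?thesis
      using False x h01(1) [OF x(1)] gj by (simp add: H_def)
  qed
  moreover have "topspace X \<subseteq> ?V'"
    using cover by blast
  moreover have "H (t, y) = y" if "y \<in> topspace X" for t y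
    using that by (simp add: H_def)
  ultimately have "deforms_onto ?V (topspace X) H"
    unfolding deforms_onto_def topV by blast
  then show thesis
    by (rule that)
qed

text \<open>A and X are enlarged to the complements of c and of j c, which are open and deform back
  onto them. Excising A and X from these then leaves two pairs that j maps homeomorphically onto
  each other.\<close>

proposition iso_relative_homology_glue:
  assumes c: "c \<in> topspace D" "c \<notin> A"
    and h: "deforms_onto (subtopology D (topspace D - {c})) A h"
  shows "hom_induced p D A Y (topspace X) j
    \<in> iso (relative_homology_group p D A) (relative_homology_group p Y (topspace X))"
proof -
  let ?X = "topspace X"
  let ?D' = "topspace D - {c}" and ?V' = "topspace Y - {j c}"
  let ?DA = "subtopology D (topspace D - A)" and ?YX = "subtopology Y (topspace Y - ?X)"
  obtain H where H: "deforms_onto (subtopology Y ?V') ?X H"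
    using deforms_onto_glue [OF c h] by blast
  have jc: "j c \<in> topspace Y"
    using c topspace_subset(2) by blast
  have "openin D ?D'" "openin Y ?V'"
    using closedin_Hausdorff_singleton [OF D_Hausdorff c(1)] closedin_Hausdorff_singleton [OF Hausdorff jc]
    by (simp_all add: closedin_def)
  moreover have AD': "A \<subseteq> ?D'"
    using c A_subset by blast
  moreover have XV': "?X \<subseteq> ?V'"
    using c in_X_iff topspace_subset(1) by blast
  ultimately have
    exD: "hom_induced p ?DA (?D' - A) D ?D' id \<in> iso (relative_homology_group p ?DA (?D' - A)) (relative_homology_group p D ?D')"
    and exY: "hom_induced p ?YX (?V' - ?X) Y ?V' id \<in> iso (relative_homology_group p ?YX (?V' - ?X)) (relative_homology_group p Y ?V')"
    using iso_excise_closed [OF A] iso_excise_closed [OF closedin_X] by blast+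
  have relD: "hom_induced p D A D ?D' id \<in> iso (relative_homology_group p D A) (relative_homology_group p D ?D')"
    and relY: "hom_induced p Y ?X Y ?V' id \<in> iso (relative_homology_group p Y ?X) (relative_homology_group p Y ?V')"
    using iso_relativization_deforms_onto [OF h] iso_relativization_deforms_onto [OF H] by blast+
  have sub: "subtopology (subtopology Y (j ` topspace D)) (topspace Y - ?X) = ?YX"
    using complement_image by (simp add: subtopology_subtopology Int_absorb1 image_mono)
  have "homeomorphic_map ?DA (subtopology (subtopology Y (j ` topspace D)) (topspace Y - ?X)) j"
    using complement_image topspace_subset(2) by (intro homeomorphic_map_subtopologies [OF homeomorphic_j]) auto
  then have homeo: "homeomorphic_map ?DA ?YX j"
    unfolding sub .
  have jDV: "j ` (?D' - A) = ?V' - ?X"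
  proof -
    have "j ` (?D' - A) = j ` (topspace D - A) - {j c}"
      using inj c(1) A_subset by (auto simp: inj_on_def)
    then show ?thesis
      using complement_image by blast
  qed
  have jj: "hom_induced p ?DA (?D' - A) ?YX (?V' - ?X) j
      \<in> iso (relative_homology_group p ?DA (?D' - A)) (relative_homology_group p ?YX (?V' - ?X))"
    by (rule homeomorphic_map_relative_homology_iso [OF homeo _ jDV]) auto
  \<comment> \<open>This map between the enlarged pairs links two commuting squares: excision and
    the homeomorphism make it bijective, and the enlargement isomorphisms pass this on to the
    original pairs.\<close>
  let ?m = "hom_induced p D ?D' Y ?V' j"
  have jD'V': "j \<in> ?D' \<rightarrow> ?V'"
    using inj c(1) topspace_subset(2) by (auto simp: inj_on_def)
  have jAX: "j \<in> A \<rightarrow> ?X"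
    using in_X_iff A_subset by auto
  have idD: "continuous_map ?DA D id" and idY: "continuous_map ?YX Y id"
    by (simp_all add: continuous_map_from_subtopology)
  have "?m \<circ> hom_induced p ?DA (?D' - A) D ?D' id = hom_induced p ?DA (?D' - A) Y ?V' (j \<circ> id)"
    by (rule hom_induced_compose [symmetric]) (use idD continuous_j jD'V' in auto)
  also have "\<dots> = hom_induced p ?DA (?D' - A) Y ?V' (id \<circ> j)"
    by simp
  also have "\<dots> = hom_induced p ?YX (?V' - ?X) Y ?V' id \<circ> hom_induced p ?DA (?D' - A) ?YX (?V' - ?X) j"
    by (rule hom_induced_compose) (use idY homeo jDV in \<open>auto simp: homeomorphic_imp_continuous_map\<close>)
  finally have mD: "bij_betw (?m \<circ> hom_induced p ?DA (?D' - A) D ?D' id)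
      (carrier (relative_homology_group p ?DA (?D' - A))) (carrier (relative_homology_group p Y ?V'))"
    using jj exY by (auto simp: iso_def intro: bij_betw_trans)
  have "bij_betw (hom_induced p ?DA (?D' - A) D ?D' id)
      (carrier (relative_homology_group p ?DA (?D' - A))) (carrier (relative_homology_group p D ?D'))"
    using exD by (simp add: iso_def)
  from bij_betw_comp_iff [OF this, THEN iffD2, OF mD]
  have m: "bij_betw ?m (carrier (relative_homology_group p D ?D')) (carrier (relative_homology_group p Y ?V'))" .
  let ?l = "hom_induced p D A Y ?X j"
  have "hom_induced p Y ?X Y ?V' id \<circ> ?l = hom_induced p D A Y ?V' (id \<circ> j)"
    by (rule hom_induced_compose [symmetric]) (use continuous_j jAX XV' in auto)
  also have "\<dots> = hom_induced p D A Y ?V' (j \<circ> id)"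
    by simp
  also have "\<dots> = ?m \<circ> hom_induced p D A D ?D' id"
    by (rule hom_induced_compose) (use continuous_j jD'V' AD' in auto)
  finally have "bij_betw (hom_induced p Y ?X Y ?V' id \<circ> ?l)
      (carrier (relative_homology_group p D A)) (carrier (relative_homology_group p Y ?V'))"
    using m relD by (auto simp: iso_def intro: bij_betw_trans)
  moreover have "?l ` carrier (relative_homology_group p D A) \<subseteq> carrier (relative_homology_group p Y ?X)"
    using hom_induced_carrier by blast
  moreover have "bij_betw (hom_induced p Y ?X Y ?V' id)
      (carrier (relative_homology_group p Y ?X)) (carrier (relative_homology_group p Y ?V'))"
    using relY by (simp add: iso_def)
  ultimately have "bij_betw ?l (carrier (relative_homology_group p D A)) (carrier (relative_homology_group p Y ?X))"
    using bij_betw_comp_iff2 by blast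
  then show ?thesis
    by (simp add: iso_def hom_induced_hom)
qed

text \<open>By naturality the connecting map of (Y, X) is that of (D, A) followed by j on A, which
  factors through P. The connecting map takes values in reduced homology; this is essential for p =
  1, where H_0 of a non-empty P is not zero.\<close>

lemma zero_hom_boundary_glue:
  assumes iso: "hom_induced p D A Y (topspace X) j
      \<in> iso (relative_homology_group p D A) (relative_homology_group p Y (topspace X))"
    and \<psi>: "continuous_map (subtopology D A) P \<psi>" and e: "continuous_map P X e"
    and factor: "\<And>x. x \<in> A \<Longrightarrow> j x = e (\<psi> x)"
    and triv: "trivial_group (reduced_homology_group (p - 1) P)"
  shows "zero_hom_boundary p Y (topspace X)"
  unfolding zero_hom_boundary_def
proof
  let ?X = "topspace X"
  fix u
  assume "u \<in> carrier (relative_homology_group p Y ?X)"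
  then obtain v where v: "v \<in> carrier (relative_homology_group p D A)" "u = hom_induced p D A Y ?X j v"
    using iso by (auto simp: iso_def bij_betw_def)
  let ?w = "hom_boundary p D A v"
  have w: "?w \<in> carrier (reduced_homology_group (p - 1) (subtopology D A))"
    using hom_boundary_reduced_hom v(1) by (metis hom_in_carrier)
  have "hom_induced (p - 1) (subtopology D A) {} P {} \<psi> ?w \<in> carrier (reduced_homology_group (p - 1) P)"
    using w by (rule hom_induced_reduced)
  then have w0: "hom_induced (p - 1) (subtopology D A) {} P {} \<psi> ?w = \<one>\<^bsub>homology_group (p - 1) P\<^esub>"
    using triv by (simp add: trivial_group_def one_reduced_homology_group)
  have jAX: "j \<in> A \<rightarrow> ?X"
    using in_X_iff A_subset by auto
  have "hom_boundary p Y ?X u = hom_induced (p - 1) (subtopology D A) {} (subtopology Y ?X) {} j ?w"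
    using naturality_hom_induced [OF continuous_j jAX, of p] by (simp add: v(2) fun_eq_iff)
  also have "\<dots> = hom_induced (p - 1) (subtopology D A) {} X {} (e \<circ> \<psi>) ?w"
    unfolding subtopology_Y by (rule fun_cong [OF hom_induced_eq]) (use factor in simp)
  also have "\<dots> = hom_induced (p - 1) P {} X {} e (\<one>\<^bsub>homology_group (p - 1) P\<^esub>)"
    using hom_induced_compose_empty [OF \<psi> e, of "p - 1"] by (simp add: w0)
  also have "\<dots> = \<one>\<^bsub>homology_group (p - 1) X\<^esub>"
    by (rule hom_one [OF hom_induced_hom]) auto
  finally show "hom_boundary p Y ?X u = \<one>\<^bsub>homology_group (p - 1) (subtopology Y ?X)\<^esub>"
    by (simp add: subtopology_Y)
qed

lemma zero_hom_boundary_glue_trivial: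
  assumes iso: "hom_induced p D A Y (topspace X) j
      \<in> iso (relative_homology_group p D A) (relative_homology_group p Y (topspace X))"
    and triv: "trivial_group (relative_homology_group p D A)"
  shows "zero_hom_boundary p Y (topspace X)"
proof -
  have "trivial_group (relative_homology_group p Y (topspace X))"
    using isomorphic_group_triviality [OF is_isoI [OF iso]] triv by simp
  then show ?thesis
    unfolding zero_hom_boundary_def trivial_group_def
    using hom_one [OF hom_boundary_hom group_relative_homology_group group_relative_homology_group, of p Y "topspace X"]
    by auto
qed

lemma path_connected_glue:
  assumes "path_connected_space X" "path_connected_space D" "A \<noteq> {}"
  shows "path_connected_space Y"
proof -
  have "path_connectedin Y (topspace X)"
    using assms(1) topspace_subset(1) by (simp add: path_connectedin_def subtopology_Y)
  moreover have "path_connectedin Y (j ` topspace D)"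
    using path_connectedin_continuous_map_image [OF continuous_j] assms(2)
    by (simp add: path_connectedin_topspace)
  moreover have "topspace X \<inter> j ` topspace D \<noteq> {}"
    using assms(3) in_X_iff A_subset by blast
  ultimately have "path_connectedin Y (topspace Y)"
    unfolding topspace_glue by (rule path_connectedin_Un)
  then show ?thesis
    by (simp add: path_connectedin_topspace)
qed

end

section \<open>Disks and spheres\<close>

lemma ndisk_eq: "ndisk d = top_of_set {x. (\<Sum>i<d. (x i)\<^sup>2) \<le> 1 \<and> (\<forall>i\<ge>d. x i = 0)}"
  by (simp add: ndisk_def Euclidean_space_def euclidean_product_topology subtopology_subtopology
      Collect_conj_eq Int_commute)

lemma nsphere_pred_eq:
  assumes "1 \<le> d"
  shows "nsphere (d - 1) = top_of_set {x. (\<Sum>i<d. (x i)\<^sup>2) = 1 \<and> (\<forall>i\<ge>d. x i = 0)}"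
proof -
  have "{..d - 1} = {..<d}" "\<And>i. d - 1 < i \<longleftrightarrow> d \<le> i"
    using assms by auto
  then show ?thesis
    by (simp add: nsphere euclidean_product_topology)
qed

lemma disk_boundary_eq:
  "1 \<le> d \<Longrightarrow> disk_boundary d = {x. (\<Sum>i<d. (x i)\<^sup>2) = 1 \<and> (\<forall>i\<ge>d. x i = 0)}"
  unfolding disk_boundary_def by (simp only: nsphere_pred_eq topspace_euclidean_subtopology)

lemma disk_boundary_subset: "1 \<le> d \<Longrightarrow> disk_boundary d \<subseteq> topspace (ndisk d)"
  by (auto simp: disk_boundary_eq ndisk_eq)

lemma subtopology_disk_boundary:
  assumes "1 \<le> d"
  shows "subtopology (ndisk d) (disk_boundary d) = nsphere (d - 1)"
proof -
  have "{x. (\<Sum>i<d. (x i)\<^sup>2) \<le> 1 \<and> (\<forall>i\<ge>d. x i = 0)} \<inter> disk_boundary d = disk_boundary d"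
    using assms by (auto simp: disk_boundary_eq)
  then show ?thesis
    unfolding nsphere_pred_eq [OF assms] ndisk_eq subtopology_subtopology
    using disk_boundary_eq [OF assms] by simp
qed

lemma continuous_on_coordinate: "continuous_on S (\<lambda>x::'a \<Rightarrow> real. x i)"
  by (rule continuous_on_subset [OF continuous_on_product_coordinates subset_UNIV])

lemma continuous_on_snd_coordinate:
  "continuous_on S (\<lambda>z::'b::topological_space \<times> ('a \<Rightarrow> real). snd z i)"
  by (rule continuous_on_compose2 [OF continuous_on_coordinate [of UNIV] continuous_on_snd [OF continuous_on_id]]) simp

lemma closed_coordinates_0: "closed {x::nat \<Rightarrow> real. \<forall>i\<ge>d. x i = 0}"
proof -
  have "{x::nat \<Rightarrow> real. \<forall>i\<ge>d. x i = 0} = (\<Inter>i\<in>{d..}. {x. x i = 0})"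
    by auto
  moreover have "closed {x::nat \<Rightarrow> real. x i = 0}" for i
    by (intro closed_Collect_eq continuous_on_coordinate continuous_on_const)
  ultimately show ?thesis
    by auto
qed

lemma closed_ndisk: "closed {x::nat \<Rightarrow> real. (\<Sum>i<d. (x i)\<^sup>2) \<le> 1 \<and> (\<forall>i\<ge>d. x i = 0)}"
  by (intro closed_Collect_conj closed_coordinates_0 closed_Collect_le continuous_intros continuous_on_coordinate)

lemma closedin_disk_boundary:
  assumes "1 \<le> d"
  shows "closedin (ndisk d) (disk_boundary d)"
proof -
  have "closed (disk_boundary d)"
    unfolding disk_boundary_eq [OF assms]
    by (intro closed_Collect_conj closed_coordinates_0 closed_Collect_eq continuous_intros continuous_on_coordinate)
  then show ?thesis
    using disk_boundary_subset [OF assms] unfolding ndisk_eq by (simp add: closed_subset)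
qed

text \<open>The ambient space is an infinite product of lines, so boundedness is replaced by
  Tychonoff: the disk is a closed subset of a product of intervals.\<close>

lemma compact_space_ndisk: "compact_space (ndisk d)"
proof -
  let ?S = "{x::nat \<Rightarrow> real. (\<Sum>i<d. (x i)\<^sup>2) \<le> 1 \<and> (\<forall>i\<ge>d. x i = 0)}"
  have "\<bar>x i\<bar> \<le> 1" if x: "x \<in> ?S" for x :: "nat \<Rightarrow> real" and i
  proof (cases "i < d")
    case True
    then have "(x i)\<^sup>2 \<le> (\<Sum>i<d. (x i)\<^sup>2)"
      by (intro member_le_sum) auto
    also have "\<dots> \<le> 1"
      using x by simp
    finally show ?thesis
      by (simp add: abs_square_le_1)
  qed (use x in simp)
  then have "?S \<subseteq> UNIV \<rightarrow>\<^sub>E {-1..1}"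
    by (auto simp: abs_le_iff)
  moreover have "compactin (powertop_real UNIV) (UNIV \<rightarrow>\<^sub>E {-1..1})"
    by (simp add: compactin_PiE)
  moreover have "closedin (powertop_real UNIV) ?S"
    using closed_ndisk by (simp add: euclidean_product_topology)
  ultimately have "compactin (powertop_real UNIV) ?S"
    using closed_compactin by blast
  then show ?thesis
    unfolding ndisk_eq euclidean_product_topology by (rule compact_space_subtopology)
qed

lemma Hausdorff_space_ndisk: "Hausdorff_space (ndisk d)"
  unfolding ndisk_eq by (intro Hausdorff_space_subtopology) simp

lemma sum_squares_scale: "(\<Sum>i<d. (r * x i)\<^sup>2) = r\<^sup>2 * (\<Sum>i<d. (x i)\<^sup>2)" for r :: real
  by (simp add: power_mult_distrib sum_distrib_left)

lemma contractible_space_ndisk: "contractible_space (ndisk d)"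
proof -
  let ?S = "{x::nat \<Rightarrow> real. (\<Sum>i<d. (x i)\<^sup>2) \<le> 1 \<and> (\<forall>i\<ge>d. x i = 0)}"
  let ?h = "\<lambda>(t, x). (\<lambda>i. (1 - t) * x i) :: nat \<Rightarrow> real"
  have "continuous_on ({0..1} \<times> ?S) ?h"
    unfolding case_prod_unfold
    by (intro continuous_on_coordinatewise_then_product continuous_on_mult continuous_on_diff
        continuous_on_const continuous_on_fst continuous_on_id continuous_on_snd_coordinate)
  moreover have "?h \<in> {0..1} \<times> ?S \<rightarrow> ?S"
  proof clarsimp
    fix t :: real and x :: "nat \<Rightarrow> real"
    assume "0 \<le> t" "t \<le> 1" "(\<Sum>i<d. (x i)\<^sup>2) \<le> 1"
    then have "(1 - t)\<^sup>2 * (\<Sum>i<d. (x i)\<^sup>2) \<le> 1 * 1"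
      by (intro mult_mono) (auto simp: abs_square_le_1 intro: sum_nonneg)
    then show "(\<Sum>i<d. ((1 - t) * x i)\<^sup>2) \<le> 1"
      by (simp add: sum_squares_scale)
  qed
  ultimately have "continuous_map (prod_topology (top_of_set {0..1::real}) (ndisk d)) (ndisk d) ?h"
    by (simp add: ndisk_eq)
  then have "homotopic_with (\<lambda>_. True) (ndisk d) (ndisk d) id (\<lambda>_ _. 0)"
    unfolding homotopic_with_def by (intro exI [of _ ?h]) simp
  then show ?thesis
    unfolding contractible_space_def by blast
qed

lemma ndisk_center:
  assumes "1 \<le> d"
  shows "(\<lambda>_. 0) \<in> topspace (ndisk d)" "(\<lambda>_. 0) \<notin> disk_boundary d"
  using assms by (auto simp: ndisk_eq disk_boundary_eq)

lemma deforms_onto_disk_boundary: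
  assumes d: "1 \<le> d"
  obtains h where
    "deforms_onto (subtopology (ndisk d) (topspace (ndisk d) - {\<lambda>_. 0})) (disk_boundary d) h"
proof -
  let ?q = "\<lambda>x::nat \<Rightarrow> real. \<Sum>i<d. (x i)\<^sup>2"
  let ?V = "{x. ?q x \<le> 1 \<and> (\<forall>i\<ge>d. x i = 0)} - {\<lambda>_. 0}"
  \<comment> \<open>The radial factor of the straight path from x to x / |x|. The norm at time t is
    (1 - t) |x| + t, which lies between |x| and 1; so the path avoids the centre and stays in the
    disk, and boundary points have factor 1.\<close>
  define k where "k t x = (1 - t) + t / sqrt (?q x)" for t x
  define h where "h = (\<lambda>(t, x). \<lambda>i. k t x * x i)"
  have V: "subtopology (ndisk d) (topspace (ndisk d) - {\<lambda>_. 0}) = top_of_set ?V"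
    by (auto simp: ndisk_eq subtopology_subtopology intro: arg_cong [of _ _ top_of_set])
  have pos: "?q x > 0" if x: "x \<in> ?V" for x
  proof (rule ccontr)
    assume "\<not> ?q x > 0"
    then have "?q x = 0"
      using sum_nonneg [of "{..<d}" "\<lambda>i. (x i)\<^sup>2"] by simp
    then have "\<And>i. i < d \<Longrightarrow> x i = 0"
      by (simp add: sum_nonneg_eq_0_iff)
    then have "x = (\<lambda>_. 0)"
      using x by (intro ext) (metis (mono_tags, lifting) DiffD1 mem_Collect_eq not_less)
    then show False
      using x by blast
  qed
  have q_h: "?q (h (t, x)) = ((1 - t) * sqrt (?q x) + t)\<^sup>2" if "x \<in> ?V" for t x
  proof -
    have "k t x * sqrt (?q x) = (1 - t) * sqrt (?q x) + t"
      using pos [OF that] by (simp add: k_def distrib_right)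
    then have "((1 - t) * sqrt (?q x) + t)\<^sup>2 = (k t x)\<^sup>2 * (sqrt (?q x))\<^sup>2"
      by (simp add: power_mult_distrib flip: \<open>k t x * sqrt (?q x) = _\<close>)
    then show ?thesis
      using pos [OF that] by (simp add: h_def sum_squares_scale)
  qed
  have q_cont: "continuous_on S (\<lambda>z. ?q (snd z))" for S :: "(real \<times> (nat \<Rightarrow> real)) set"
    by (intro continuous_on_sum continuous_on_power continuous_on_snd_coordinate)
  have "\<forall>z\<in>{0..1::real} \<times> ?V. sqrt (?q (snd z)) \<noteq> 0"
  proof
    fix z :: "real \<times> (nat \<Rightarrow> real)"
    assume "z \<in> {0..1} \<times> ?V"
    then have "snd z \<in> ?V"
      by (rule mem_Times_iff [THEN iffD1, THEN conjunct2])
    then have "0 < sqrt (?q (snd z))"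
      using pos by (simp only: real_sqrt_gt_0_iff)
    then show "sqrt (?q (snd z)) \<noteq> 0"
      by (rule less_imp_neq [THEN not_sym])
  qed
  then have "continuous_on ({0..1} \<times> ?V) (\<lambda>z. k (fst z) (snd z))"
    unfolding k_def
    by (intro continuous_on_add continuous_on_diff continuous_on_const continuous_on_fst continuous_on_id
        continuous_on_divide continuous_on_real_sqrt q_cont)
  then have "continuous_on ({0..1} \<times> ?V) h"
    unfolding h_def case_prod_unfold
    by (intro continuous_on_coordinatewise_then_product continuous_on_mult continuous_on_snd_coordinate) auto
  moreover have "h (t, x) \<in> ?V" if t: "t \<in> {0..1}" and x: "x \<in> ?V" for t x
  proof -
    let ?r = "sqrt (?q x)"
    have r: "0 < ?r" "?r \<le> 1"
      using pos [OF x] x by auto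
    have "(1 - t) * ?r \<le> (1 - t) * 1"
      using t r by (intro mult_left_mono) auto
    moreover have "0 \<le> (1 - t) * ?r"
      using t r by simp
    ultimately have "0 \<le> (1 - t) * ?r + t" "(1 - t) * ?r + t \<le> 1"
      using t by auto
    then have "?q (h (t, x)) \<le> 1"
      unfolding q_h [OF x] by (simp add: power_le_one)
    moreover have "(1 - t) * ?r + t \<noteq> 0"
    proof (cases "t = 0")
      case False
      then show ?thesis using t \<open>0 \<le> (1 - t) * ?r\<close> by auto
    qed (use r in simp)
    then have "?q (h (t, x)) \<noteq> 0"
      unfolding q_h [OF x] by simp
    then have "h (t, x) \<noteq> (\<lambda>_. 0)"
      by (metis (mono_tags, lifting) sum.neutral zero_power2)
    moreover have "\<forall>i\<ge>d. h (t, x) i = 0"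
      using x by (simp add: h_def)
    ultimately show ?thesis
      by blast
  qed
  ultimately have "continuous_map (prod_topology (top_of_set {0..1}) (top_of_set ?V)) (top_of_set ?V) h"
    by auto
  moreover have "h (0, x) = x" for x
    by (simp add: h_def k_def)
  moreover have "h (1, x) \<in> disk_boundary d" if x: "x \<in> ?V" for x
    using q_h [OF x, of 1] x unfolding disk_boundary_eq [OF d] by (simp add: h_def)
  moreover have "h (t, a) = a" if "a \<in> disk_boundary d" for t a
    using that unfolding disk_boundary_eq [OF d] by (simp add: h_def k_def)
  moreover have "disk_boundary d \<subseteq> ?V"
    using ndisk_center [OF d] disk_boundary_subset [OF d] by (auto simp: ndisk_eq)
  ultimately have "deforms_onto (subtopology (ndisk d) (topspace (ndisk d) - {\<lambda>_. 0})) (disk_boundary d) h"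
    unfolding V deforms_onto_def by simp
  then show thesis
    by (rule that)
qed

text \<open>The disk is contractible, so the relative groups are the reduced groups of its boundary
  sphere one degree lower.\<close>

lemma relative_homology_ndisk:
  assumes d: "1 \<le> d"
  shows "relative_homology_group (int d) (ndisk d) (disk_boundary d) \<cong> integer_group"
    and "p \<noteq> int d \<Longrightarrow> trivial_group (relative_homology_group p (ndisk d) (disk_boundary d))"
proof -
  have "topspace (ndisk d) \<inter> disk_boundary d \<noteq> {}"
    using disk_boundary_subset [OF d] in_topspace_nsphere [of "d - 1"] by (auto simp: disk_boundary_def)
  then have iso: "relative_homology_group p (ndisk d) (disk_boundary d) \<cong>
      reduced_homology_group (p - 1) (nsphere (d - 1))" for p
    using isomorphic_group_relative_homology_of_contractible [OF contractible_space_ndisk]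
    by (metis subtopology_disk_boundary [OF d])
  show "relative_homology_group (int d) (ndisk d) (disk_boundary d) \<cong> integer_group"
    using iso_trans [OF iso [of "int d"]] reduced_homology_group_nsphere(1) [of "d - 1"] d
    by (simp add: of_nat_diff)
  show "trivial_group (relative_homology_group p (ndisk d) (disk_boundary d))" if "p \<noteq> int d"
    using isomorphic_group_triviality [OF iso [of p]] reduced_homology_group_nsphere(2) [of "p - 1" "d - 1"] d that
    by (simp add: of_nat_diff)
qed

lemma path_connected_space_nsphere:
  assumes "1 \<le> n"
  shows "path_connected_space (nsphere n)"
proof -
  let ?N = "{x::nat \<Rightarrow> real. x 0 \<ge> 0}" and ?S = "{x::nat \<Rightarrow> real. x 0 \<le> 0}"
  have "path_connected_space (subtopology (nsphere n) ?N)" "path_connected_space (subtopology (nsphere n) ?S)"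
    by (simp_all add: contractible_imp_path_connected_space contractible_space_upper_hemisphere
        contractible_space_lower_hemisphere)
  then have "path_connectedin (nsphere n) (topspace (nsphere n) \<inter> ?N)"
    "path_connectedin (nsphere n) (topspace (nsphere n) \<inter> ?S)"
    by (simp_all add: path_connectedin_def subtopology_restrict)
  \<comment> \<open>The unit vector of coordinate 1 lies in both hemispheres, which are separated by
    coordinate 0; it is a point of the sphere because n \<ge> 1.\<close>
  moreover have "(\<lambda>i. if i = 1 then 1 else 0) \<in> topspace (nsphere n) \<inter> ?N \<inter> (topspace (nsphere n) \<inter> ?S)"
    using assms by (simp add: nsphere power2_eq_square if_distrib [where f = "\<lambda>x. x * _"] cong: if_cong)
  ultimately have "path_connectedin (nsphere n) (topspace (nsphere n) \<inter> ?N \<union> topspace (nsphere n) \<inter> ?S)"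
    by (intro path_connectedin_Un) auto
  moreover have "topspace (nsphere n) \<inter> ?N \<union> topspace (nsphere n) \<inter> ?S = topspace (nsphere n)"
    by auto
  ultimately show ?thesis
    by (simp add: path_connectedin_topspace)
qed

section \<open>Homology of bubble spaces\<close>

lemma embedding_map_imp_continuous_map: "embedding_map X Y f \<Longrightarrow> continuous_map X Y f"
  unfolding embedding_map_def by (auto dest: homeomorphic_imp_continuous_map simp: continuous_map_in_subtopology)

lemma embedding_map_imp_inj_on: "embedding_map X Y f \<Longrightarrow> inj_on f (topspace X)"
  unfolding embedding_map_def by (rule homeomorphic_imp_injective_map)

text \<open>Labels stay within the number of attached disks, so the label of the next disk is fresh
  and its interior is disjoint from the space built so far.\<close>

lemma bubble_model_labels:
  "bubble_model n ds X B \<Longrightarrow> topspace X \<subseteq> {..length ds} \<times> UNIV"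
proof (induction rule: bubble_model.induct)
  case (attach ds X B i d \<phi>)
  have "\<phi> x \<in> topspace X" if "x \<in> disk_boundary d" for x
    using continuous_map_funspace [OF embedding_map_imp_continuous_map [OF attach(5)]] that
    by (auto simp: disk_boundary_def)
  then show ?case
    using attach.IH by (fastforce simp: topspace_glue)
qed auto

definition attaching_map :: "nat \<Rightarrow> nat \<Rightarrow> ((nat \<Rightarrow> real) \<Rightarrow> nat \<times> (nat \<Rightarrow> real)) \<Rightarrow> (nat \<Rightarrow> real) \<Rightarrow> nat \<times> (nat \<Rightarrow> real)" where
  "attaching_map k d \<phi> = (\<lambda>x. if x \<in> disk_boundary d then \<phi> x else (Suc k, x))"

lemma closed_glue_attach:
  assumes X: "topspace X \<subseteq> {..k} \<times> UNIV" and d: "1 \<le> d"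
    and \<phi>: "embedding_map (nsphere (d - 1)) X \<phi>"
    and Hausdorff: "Hausdorff_space (glue X (ndisk d) (attaching_map k d \<phi>))"
  shows "closed_glue X (ndisk d) (disk_boundary d) (attaching_map k d \<phi>)"
proof
  let ?j = "attaching_map k d \<phi>"
  have j_bd: "?j x = \<phi> x" if "x \<in> disk_boundary d" for x
    using that by (simp add: attaching_map_def)
  have j_int: "?j x = (Suc k, x)" if "x \<notin> disk_boundary d" for x
    using that by (simp add: attaching_map_def)
  have "continuous_map (nsphere (d - 1)) X ?j"
    by (rule continuous_map_eq [OF embedding_map_imp_continuous_map [OF \<phi>]]) (simp add: j_bd disk_boundary_def)
  then show "continuous_map (subtopology (ndisk d) (disk_boundary d)) X ?j"
    unfolding subtopology_disk_boundary [OF d] .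
  have \<phi>X: "\<phi> x \<in> topspace X" if "x \<in> disk_boundary d" for x
    using continuous_map_funspace [OF embedding_map_imp_continuous_map [OF \<phi>]] that
    by (auto simp: disk_boundary_def)
  have ne: "\<phi> x \<noteq> (Suc k, y)" if "x \<in> disk_boundary d" for x y
    using \<phi>X [OF that] X by auto
  show "inj_on ?j (topspace (ndisk d))"
  proof (rule inj_onI)
    fix x y
    assume eq: "?j x = ?j y"
    have "inj_on \<phi> (disk_boundary d)"
      using embedding_map_imp_inj_on [OF \<phi>] by (simp add: disk_boundary_def)
    then show "x = y"
      using eq ne [of x y] ne [of y x]
      by (cases "x \<in> disk_boundary d"; cases "y \<in> disk_boundary d") (auto simp: j_bd j_int dest: inj_onD)
  qed
  show "?j ` (topspace (ndisk d) - disk_boundary d) \<inter> topspace X = {}"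
    using X by (auto simp: j_int)
qed (use closedin_disk_boundary [OF d] compact_space_ndisk Hausdorff_space_ndisk Hausdorff in auto)

text \<open>
  A map into a single piece of a bubble space lifts to the sphere or disk that parametrises the
  piece, whose reduced homology vanishes below the dimension of the piece.
\<close>

definition piece_lift :: "nat \<Rightarrow> 'l \<Rightarrow> ('l \<times> 'a) topology \<Rightarrow> bool" where
  "piece_lift d i X \<longleftrightarrow> (\<exists>(P :: (nat \<Rightarrow> real) topology) e. continuous_map P X e \<and>
     (\<forall>q<int d. trivial_group (reduced_homology_group q P)) \<and>
     (\<forall>(Z :: (nat \<Rightarrow> real) topology) \<phi>. continuous_map Z X \<phi> \<and> \<phi> ` topspace Z \<subseteq> {i} \<times> UNIV \<longrightarrow>
        (\<exists>\<psi>. continuous_map Z P \<psi> \<and> (\<forall>z\<in>topspace Z. \<phi> z = e (\<psi> z)))))"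

lemma piece_liftI:
  fixes P :: "(nat \<Rightarrow> real) topology"
  assumes "continuous_map P X e" "\<And>q. q < int d \<Longrightarrow> trivial_group (reduced_homology_group q P)"
    and "\<And>(Z :: (nat \<Rightarrow> real) topology) \<phi>. continuous_map Z X \<phi> \<Longrightarrow> \<phi> ` topspace Z \<subseteq> {i} \<times> UNIV \<Longrightarrow>
      \<exists>\<psi>. continuous_map Z P \<psi> \<and> (\<forall>z\<in>topspace Z. \<phi> z = e (\<psi> z))"
  shows "piece_lift d i X"
  unfolding piece_lift_def
  by (rule exI [of _ P], rule exI [of _ e]) (simp add: assms)

lemma piece_liftE:
  assumes "piece_lift d i X"
  obtains P :: "(nat \<Rightarrow> real) topology" and e where "continuous_map P X e"
    "\<And>q. q < int d \<Longrightarrow> trivial_group (reduced_homology_group q P)"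
    "\<And>(Z :: (nat \<Rightarrow> real) topology) \<phi>. continuous_map Z X \<phi> \<Longrightarrow> \<phi> ` topspace Z \<subseteq> {i} \<times> UNIV \<Longrightarrow>
      \<exists>\<psi>. continuous_map Z P \<psi> \<and> (\<forall>z\<in>topspace Z. \<phi> z = e (\<psi> z))"
  using assms unfolding piece_lift_def
proof (elim exE conjE)
  fix P :: "(nat \<Rightarrow> real) topology" and e
  assume "continuous_map P X e" "\<forall>q<int d. trivial_group (reduced_homology_group q P)"
    "\<forall>(Z :: (nat \<Rightarrow> real) topology) \<phi>. continuous_map Z X \<phi> \<and> \<phi> ` topspace Z \<subseteq> {i} \<times> UNIV \<longrightarrow>
        (\<exists>\<psi>. continuous_map Z P \<psi> \<and> (\<forall>z\<in>topspace Z. \<phi> z = e (\<psi> z)))"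
  then show thesis
    by (intro that [of P e]) simp_all
qed

lemma piece_lift_sphere:
  "piece_lift n 0 (prod_topology (discrete_topology {0 :: 'l :: zero}) (nsphere n))"
proof (rule piece_liftI)
  let ?X = "prod_topology (discrete_topology {0::'l}) (nsphere n)"
  show "continuous_map (nsphere n) ?X (Pair 0)"
    by (simp add: continuous_map_pairwise o_def)
  show "trivial_group (reduced_homology_group q (nsphere n))" if "q < int n" for q
    using that by (simp add: reduced_homology_group_nsphere)
  fix Z :: "(nat \<Rightarrow> real) topology" and \<phi> :: "_ \<Rightarrow> 'l \<times> (nat \<Rightarrow> real)"
  assume \<phi>: "continuous_map Z ?X \<phi>" "\<phi> ` topspace Z \<subseteq> {0} \<times> UNIV"
  have "continuous_map Z (nsphere n) (snd \<circ> \<phi>)"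
    using \<phi>(1) by (simp add: continuous_map_pairwise)
  moreover have "\<forall>z\<in>topspace Z. \<phi> z = (0, (snd \<circ> \<phi>) z)"
    using \<phi>(2) by (auto simp: image_subset_iff mem_Times_iff prod_eq_iff)
  ultimately show "\<exists>\<psi>. continuous_map Z (nsphere n) \<psi> \<and> (\<forall>z\<in>topspace Z. \<phi> z = (0, \<psi> z))"
    by (intro exI conjI)
qed

text \<open>Points with an old label all lie in X, and X keeps its topology as a subspace, so a map
  into an old piece is already a map into X.\<close>

lemma piece_lift_glue_old:
  assumes "closed_glue X D A j" "piece_lift d i X"
    and old: "({i} \<times> UNIV) \<inter> topspace (glue X D j) \<subseteq> topspace X"
  shows "piece_lift d i (glue X D j)"
proof -
  interpret closed_glue X D A j by fact
  from assms(2) show ?thesis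
  proof (rule piece_liftE)
    fix P :: "(nat \<Rightarrow> real) topology" and e
    assume e: "continuous_map P X e"
      and triv: "\<And>q. q < int d \<Longrightarrow> trivial_group (reduced_homology_group q P)"
      and lift: "\<And>(Z :: (nat \<Rightarrow> real) topology) \<phi>. continuous_map Z X \<phi> \<Longrightarrow> \<phi> ` topspace Z \<subseteq> {i} \<times> UNIV \<Longrightarrow>
        \<exists>\<psi>. continuous_map Z P \<psi> \<and> (\<forall>z\<in>topspace Z. \<phi> z = e (\<psi> z))"
    have eY: "continuous_map P Y e"
      using e continuous_map_in_subtopology [of P Y "topspace X" e] by (simp add: subtopology_Y)
    show ?thesis
    proof (rule piece_liftI [OF eY triv])
      fix Z :: "(nat \<Rightarrow> real) topology" and \<phi>
      assume \<phi>: "continuous_map Z Y \<phi>" "\<phi> ` topspace Z \<subseteq> {i} \<times> UNIV"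
      have "\<phi> ` topspace Z \<subseteq> topspace Y"
        using continuous_map_funspace [OF \<phi>(1)] by blast
      then have "\<phi> ` topspace Z \<subseteq> topspace X"
        using old \<phi>(2) by blast
      then have "continuous_map Z (subtopology Y (topspace X)) \<phi>"
        using \<phi>(1) by (simp add: continuous_map_in_subtopology image_subset_iff_funcset)
      then show "\<exists>\<psi>. continuous_map Z P \<psi> \<and> (\<forall>z\<in>topspace Z. \<phi> z = e (\<psi> z))"
        unfolding subtopology_Y using \<phi>(2) by (rule lift)
    qed
  qed
qed

text \<open>The closed disk serves as parameter space. Its embedding j has a continuous inverse on
  the image, which lifts maps into the new piece.\<close>

lemma piece_lift_glue_new:
  assumes "closed_glue X (ndisk d) A j"
    and disjoint: "({i} \<times> UNIV) \<inter> topspace X = {}"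
  shows "piece_lift d i (glue X (ndisk d) j)"
proof -
  interpret closed_glue X "ndisk d" A j by fact
  let ?D = "ndisk d"
  obtain g where g: "homeomorphic_maps ?D (subtopology Y (j ` topspace ?D)) j g"
    using homeomorphic_j homeomorphic_map_maps by blast
  show ?thesis
  proof (rule piece_liftI [OF continuous_j])
    show "trivial_group (reduced_homology_group q ?D)" for q
      using trivial_reduced_homology_group_contractible_space [OF contractible_space_ndisk] .
    fix Z :: "(nat \<Rightarrow> real) topology" and \<phi>
    assume \<phi>: "continuous_map Z Y \<phi>" "\<phi> ` topspace Z \<subseteq> {i} \<times> UNIV"
    have im: "\<phi> ` topspace Z \<subseteq> j ` topspace ?D"
    proof
      fix y
      assume y: "y \<in> \<phi> ` topspace Z"
      then have "y \<in> topspace X \<union> j ` topspace ?D"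
        using continuous_map_funspace [OF \<phi>(1)] unfolding topspace_glue by blast
      moreover have "y \<notin> topspace X"
        using subsetD [OF \<phi>(2) y] disjoint by blast
      ultimately show "y \<in> j ` topspace ?D"
        by simp
    qed
    then have "continuous_map Z (subtopology Y (j ` topspace ?D)) \<phi>"
      using \<phi>(1) by (simp add: continuous_map_in_subtopology image_subset_iff_funcset)
    then have "continuous_map Z ?D (g \<circ> \<phi>)"
      using g by (auto simp: homeomorphic_maps_def intro: continuous_map_compose)
    moreover have "\<forall>z\<in>topspace Z. \<phi> z = j ((g \<circ> \<phi>) z)"
    proof
      fix z
      assume "z \<in> topspace Z"
      then obtain x where "x \<in> topspace ?D" "\<phi> z = j x"
        using im by blast
      then show "\<phi> z = j ((g \<circ> \<phi>) z)"
        using g by (simp add: homeomorphic_maps_def)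
    qed
    ultimately show "\<exists>\<psi>. continuous_map Z ?D \<psi> \<and> (\<forall>z\<in>topspace Z. \<phi> z = j (\<psi> z))"
      by (intro exI conjI)
  qed
qed

lemma path_connected_space_ndisk: "path_connected_space (ndisk d)"
  by (simp add: contractible_imp_path_connected_space contractible_space_ndisk)

text \<open>Connecting maps vanish for two different reasons: in degree d because the lift to the
  piece has zero reduced homology in degree d - 1 < d', and in every other degree because the
  relative group itself is zero.\<close>

lemma int_hom_basis_attach:
  assumes cg: "closed_glue X (ndisk d) (disk_boundary d) j" and d: "1 \<le> d"
    and lift: "piece_lift d' i X" "d \<le> d'" and im: "j ` disk_boundary d \<subseteq> {i} \<times> UNIV"
    and zs: "int_hom_basis p X zs" and p: "1 \<le> p"
  shows "\<exists>ws. int_hom_basis p (glue X (ndisk d) j) ws \<and> length ws = length zs + (if p = d then 1 else 0)"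
proof -
  interpret closed_glue X "ndisk d" "disk_boundary d" j by fact
  let ?D = "ndisk d" and ?A = "disk_boundary d"
  obtain h where "deforms_onto (subtopology ?D (topspace ?D - {\<lambda>_. 0})) ?A h"
    using deforms_onto_disk_boundary [OF d] by blast
  note iso = iso_relative_homology_glue [OF ndisk_center [OF d] this]
  have zero: "zero_hom_boundary q Y (topspace X)" for q
  proof (cases "q = int d")
    case True
    have top: "topspace (subtopology ?D ?A) = ?A"
      using A_subset by auto
    from lift(1) show ?thesis
    proof (rule piece_liftE)
      fix P :: "(nat \<Rightarrow> real) topology" and e
      assume e: "continuous_map P X e"
        and triv: "\<And>q. q < int d' \<Longrightarrow> trivial_group (reduced_homology_group q P)"
        and ex: "\<And>(Z :: (nat \<Rightarrow> real) topology) \<phi>. continuous_map Z X \<phi> \<Longrightarrow> \<phi> ` topspace Z \<subseteq> {i} \<times> UNIV \<Longrightarrow>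
          \<exists>\<psi>. continuous_map Z P \<psi> \<and> (\<forall>z\<in>topspace Z. \<phi> z = e (\<psi> z))"
      obtain \<psi> where \<psi>: "continuous_map (subtopology ?D ?A) P \<psi>" "\<And>z. z \<in> ?A \<Longrightarrow> j z = e (\<psi> z)"
        using ex [OF jA] im unfolding top by blast
      show ?thesis
        by (rule zero_hom_boundary_glue [OF iso \<psi>(1) e]) (use \<psi>(2) triv lift(2) True in auto)
    qed
  next
    case False
    then show ?thesis
      using zero_hom_boundary_glue_trivial [OF iso relative_homology_ndisk(2) [OF d]] by blast
  qed
  have zs': "int_hom_basis p (subtopology Y (topspace X)) zs"
    using zs by (simp add: subtopology_Y)
  have sym: "relative_homology_group q Y (topspace X) \<cong> relative_homology_group q ?D ?A" for q
    using group.iso_sym [OF group_relative_homology_group is_isoI [OF iso]] .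
  show ?thesis
  proof (cases "p = d")
    case True
    obtain q where q: "p = Suc q"
      using p by (cases p) auto
    have "relative_homology_group (int (Suc q)) Y (topspace X) \<cong> integer_group"
      using iso_trans [OF sym relative_homology_ndisk(1) [OF d]] True q by simp
    then obtain w where "int_hom_basis p Y (zs @ [w])"
      using int_hom_basis_cyclic_pair [OF zs' [unfolded q] _ zero zero] q by blast
    then show ?thesis
      using True by (intro exI [of _ "zs @ [w]"]) simp
  next
    case False
    then have "trivial_group (relative_homology_group (int p) Y (topspace X))"
      using isomorphic_group_triviality [OF sym] relative_homology_ndisk(2) [OF d, of "int p"] by simp
    then have "int_hom_basis p Y zs"
      by (rule int_hom_basis_trivial_pair [OF zs' _ zero])
    then show ?thesis
      using False by (intro exI [of _ zs]) simp
  qed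
qed

lemma int_hom_basis_sphere:
  assumes X: "X homeomorphic_space nsphere n" and p: "1 \<le> p"
  shows "\<exists>zs. int_hom_basis p X zs \<and> length zs = (if p = n then 1 else 0)"
proof -
  have red: "reduced_homology_group (int p) (nsphere n) = homology_group (int p) (nsphere n)"
    using p by (intro un_reduced_homology_group) simp
  have iso: "homology_group (int p) X \<cong> homology_group (int p) (nsphere n)"
    using X by (rule homeomorphic_space_imp_isomorphic_homology_groups)
  show ?thesis
  proof (cases "p = n")
    case True
    have "homology_group (int p) X \<cong> integer_group"
      using iso_trans [OF iso] reduced_homology_group_nsphere(1) [of n] red True by simp
    then obtain w where "int_hom_basis p X [w]"
      using int_hom_basis_cyclic p by (metis not_one_le_zero)
    then show ?thesis
      using True by (intro exI [of _ "[w]"]) simp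
  next
    case False
    have "trivial_group (homology_group (int p) X)"
      using isomorphic_group_triviality [OF iso] reduced_homology_group_nsphere(2) [of "int p" n] red False by simp
    then show ?thesis
      using False by (intro exI [of _ "[]"]) (simp add: int_hom_basis_trivial)
  qed
qed

text \<open>The invariant records lifts for all pieces, since the next disk may be attached to any
  of them. Bases are tracked from degree 1 on; path-connectedness settles degree 0.\<close>

proposition bubble_model_homology:
  assumes "bubble_model n ds X B" "Hausdorff_space X"
  shows "path_connected_space X \<and> topspace X \<noteq> {} \<and> (\<forall>i\<le>length ds. piece_lift ((n # ds) ! i) i X) \<and>
    (\<forall>p\<ge>1. \<exists>zs. int_hom_basis p X zs \<and> length zs = count_list (n # ds) p)"
  using assms
proof (induction rule: bubble_model.induct)
  case sphere
  let ?X = "prod_topology (discrete_topology {0::nat}) (nsphere n)"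
  have "?X homeomorphic_space nsphere n"
    by (rule prod_topology_homeomorphic_space_right) simp
  then have "\<exists>zs. int_hom_basis p ?X zs \<and> length zs = count_list (n # []) p" if "1 \<le> p" for p
    using int_hom_basis_sphere [of ?X n p] that by auto
  moreover have "path_connected_space ?X"
    using path_connected_space_nsphere [of n] sphere
    by (simp add: path_connected_space_prod_topology path_connected_space_discrete_topology)
  moreover have "topspace ?X \<noteq> {}"
    using in_topspace_nsphere by auto
  ultimately show ?case
    using piece_lift_sphere [of n] by simp
next
  case (attach ds X B i d \<phi>)
  let ?j = "attaching_map (length ds) d \<phi>"
  let ?Y = "glue X (ndisk d) ?j"
  have Y: "Hausdorff_space ?Y"
    using attach.prems by (simp add: attaching_map_def)
  have labels: "topspace X \<subseteq> {..length ds} \<times> UNIV"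
    using attach.hyps(1) by (rule bubble_model_labels)
  have cg: "closed_glue X (ndisk d) (disk_boundary d) ?j"
    using closed_glue_attach [OF labels attach.hyps(3,5) Y] .
  interpret closed_glue X "ndisk d" "disk_boundary d" ?j by fact
  \<comment> \<open>The Hausdorff property is assumed at the last stage and descends to earlier
    ones, against the direction of the construction.\<close>
  have "Hausdorff_space X"
    using Hausdorff_space_subtopology [OF Y, of "topspace X"] by (simp add: subtopology_Y)
  note IH = attach.IH [OF this]
  have "disk_boundary d \<noteq> {}"
    using in_topspace_nsphere by (auto simp: disk_boundary_def)
  then have "path_connected_space ?Y"
    using path_connected_glue IH path_connected_space_ndisk by blast
  moreover have "topspace ?Y \<noteq> {}"
    using IH by (auto simp: topspace_glue)
  moreover have "piece_lift ((n # ds @ [d]) ! k) k ?Y" if k: "k \<le> length (ds @ [d])" for k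
  proof (cases "k = Suc (length ds)")
    case True
    have "({k} \<times> UNIV) \<inter> topspace X = {}"
      using labels True by auto
    then show ?thesis
      using piece_lift_glue_new [OF cg] True by (simp add: nth_append)
  next
    case False
    then have k': "k \<le> length ds"
      using k by simp
    have "({k} \<times> UNIV) \<inter> topspace ?Y \<subseteq> topspace X"
    proof
      fix y
      assume y: "y \<in> ({k} \<times> UNIV) \<inter> topspace ?Y"
      show "y \<in> topspace X"
      proof (rule ccontr)
        assume "y \<notin> topspace X"
        then have "y \<in> ?j ` (topspace (ndisk d) - disk_boundary d)"
          using y complement_image by blast
        then show False
          using y k' by (auto simp: attaching_map_def)
      qed
    qed
    moreover have "(n # ds @ [d]) ! k = (n # ds) ! k"
      using k' nth_append [of "n # ds" "[d]" k] by simp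
    ultimately show ?thesis
      using piece_lift_glue_old [OF cg] IH k' by simp
  qed
  moreover have "\<exists>ws. int_hom_basis p ?Y ws \<and> length ws = count_list (n # ds @ [d]) p" if p: "1 \<le> p" for p
  proof -
    obtain zs where zs: "int_hom_basis p X zs" "length zs = count_list (n # ds) p"
      using IH p by blast
    have "?j ` disk_boundary d \<subseteq> {i} \<times> UNIV"
      using attach.hyps(6) by (auto simp: attaching_map_def)
    from int_hom_basis_attach [OF cg attach.hyps(3) _ attach.hyps(4) this zs(1) p]
    show ?thesis
      using IH attach.hyps(2) by (auto simp: zs(2) count_list_append)
  qed
  ultimately show ?case
    unfolding attaching_map_def by simp
qed

section \<open>Lefschetz numbers\<close>

lemma sum_mset_sum: "(\<Sum>z\<in>#(\<Sum>j\<in>S. R j). g z) = (\<Sum>j\<in>S. \<Sum>z\<in>#R j. g z)"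
  by (induction S rule: infinite_finite_induct) auto

lemma prod_mset_sum: "(\<Prod>z\<in>#(\<Sum>j\<in>S. R j). g z) = (\<Prod>j\<in>S. \<Prod>z\<in>#R j. g z)"
  by (induction S rule: infinite_finite_induct) auto

section \<open>Transfer from the model to a homeomorphic space\<close>

lemma bubble_space_int_hom_basis:
  assumes "bubble_space n M X" "Hausdorff_space X" and p: "1 \<le> p"
  shows "\<exists>zs. int_hom_basis p X zs \<and> length zs = count (add_mset n M) p"
proof -
  obtain ds Y B where Y: "bubble_model n ds Y B" "mset ds = M" "X homeomorphic_space Y"
    using assms(1) unfolding bubble_space_def by blast
  have "Hausdorff_space Y"
    using homeomorphic_Hausdorff_space [OF Y(3)] assms(2) by simp
  from bubble_model_homology [OF Y(1) this] p
  obtain zs where zs: "int_hom_basis p Y zs" "length zs = count_list (n # ds) p"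
    by blast
  obtain h g where "homeomorphic_maps X Y h g"
    using Y(3) unfolding homeomorphic_space_def by blast
  from int_hom_basis_homeomorphic [OF zs(1) this]
  show ?thesis
    using zs(2) by (intro exI [of _ "map (chain_map p g) zs"]) (simp add: Y(2) [symmetric] count_mset)
qed

lemma bubble_space_path_connected:
  assumes "bubble_space n M X" "Hausdorff_space X"
  shows "path_connected_space X" "topspace X \<noteq> {}"
proof -
  obtain ds Y B where Y: "bubble_model n ds Y B" "X homeomorphic_space Y"
    using assms(1) unfolding bubble_space_def by blast
  have "Hausdorff_space Y"
    using homeomorphic_Hausdorff_space [OF Y(2)] assms(2) by simp
  from bubble_model_homology [OF Y(1) this] have "path_connected_space Y" "topspace Y \<noteq> {}"
    by blast+
  then show "path_connected_space X" "topspace X \<noteq> {}"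
    using homeomorphic_path_connected_space [OF Y(2)] homeomorphic_empty_space [OF Y(2)] by simp_all
qed

lemma rat_hom_trace_0:
  assumes X: "path_connected_space X" "topspace X \<noteq> {}" and f: "continuous_map X X f"
  shows "rat_hom_trace 0 X f = 1"
proof -
  obtain a where "a \<in> topspace X"
    using X(2) by blast
  then have s: "singular_simplex 0 X (restrict (\<lambda>x. a) (standard_simplex 0))" (is "singular_simplex 0 X ?s")
    by (simp add: singular_simplex_def)
  have "rat_hom_basis 0 X [rat_of_frag (frag_of ?s)]"
    using rat_hom_basis_rat_of_frag [OF int_hom_basis_0 [OF X(1) s]] by simp
  from rat_hom_trace_eq [OF this f rat_hom_matrix_0 [OF X(1) s f]] show ?thesis
    by simp
qed

text \<open>One matrix A serves both the characteristic polynomial of f and the traces of all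
  iterates; this ties the roots to the Lefschetz numbers.\<close>

lemma int_hom_basis_imp_matrix:
  assumes zs: "int_hom_basis p X zs" and f: "continuous_map X X f"
  obtains A where "A \<in> carrier_mat (length zs) (length zs)" "rat_hom_charpoly p X f = det_minus_x A"
    "\<And>m. rat_hom_trace p X (f ^^ m) = (\<Sum>i<length zs. (A ^\<^sub>m m) $$ (i, i))"
proof -
  let ?zs = "map rat_of_frag zs"
  have b: "rat_hom_basis p X ?zs"
    using zs by (rule rat_hom_basis_rat_of_frag)
  obtain A where A: "rat_hom_matrix p X f ?zs A"
    using rat_hom_matrix_exists [OF b f] by blast
  show thesis
  proof (rule that)
    show "A \<in> carrier_mat (length zs) (length zs)"
      using A by (simp add: rat_hom_matrix_def)
    show "rat_hom_charpoly p X f = det_minus_x A"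
      using b f A by (rule rat_hom_charpoly_eq)
    show "rat_hom_trace p X (f ^^ m) = (\<Sum>i<length zs. (A ^\<^sub>m m) $$ (i, i))" for m
      using rat_hom_trace_eq [OF b continuous_map_funpow [OF f] rat_hom_matrix_funpow [OF b f A]] by simp
  qed
qed

theorem theorem2p2:
  fixes l :: nat and n k :: "nat \<Rightarrow> nat"
    and X :: "'a topology" and f :: "'a \<Rightarrow> 'a"
    and K :: "'b::euclidean_space set set"
    and p :: "nat \<Rightarrow> rat poly" and RO RE :: "complex multiset"
  assumes l: "l \<ge> 1"
    and n: "\<And>j. j \<in> {1..l} \<Longrightarrow> n j \<ge> 1" "strict_mono_on {1..l} n" "n l \<ge> 2"
    and k: "\<And>j. j \<in> {1..l} \<Longrightarrow> k j \<ge> 1"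
    and bubble: "bubble_space (n l)
      ((\<Sum>j\<in>{1..<l}. replicate_mset (k j) (n j)) + replicate_mset (k l - 1) (n l)) X"
    and connected: "connected_space X"
    and simplicial: "simplicial_complex K" "X homeomorphic_space top_of_set (\<Union>K)"
    and f: "continuous_map X X f"
  defines "p \<equiv> \<lambda>j. rat_hom_charpoly (n j) X f"
    and "RO \<equiv> (\<Sum>j | j \<in> {1..l} \<and> odd (n j). nonzero_complex_roots (p j))"
    and "RE \<equiv> (\<Sum>j | j \<in> {1..l} \<and> even (n j). nonzero_complex_roots (p j))"
  shows "(\<forall>m\<ge>1. lefschetz_number (f ^^ m) X = 0) \<longleftrightarrow>
      (-1) ^ (\<Sum>j | j \<in> {1..l} \<and> odd (n j). k j) *
          (\<Prod>j | j \<in> {1..l} \<and> odd (n j). last_term (p j)) =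
        (-1) ^ (1 + (\<Sum>j | j \<in> {1..l} \<and> even (n j). k j)) *
          (\<Prod>j | j \<in> {1..l} \<and> even (n j). last_term (p j)) \<and>
      RO = {#1#} + RE"
proof -
  let ?M = "(\<Sum>j\<in>{1..<l}. replicate_mset (k j) (n j)) + replicate_mset (k l - 1) (n l)"
  let ?O = "{j. j \<in> {1..l} \<and> odd (n j)}" and ?E = "{j. j \<in> {1..l} \<and> even (n j)}"
  have H: "Hausdorff_space X"
    unfolding homeomorphic_Hausdorff_space [OF simplicial(2)] by (simp add: Hausdorff_space_subtopology)
  note pc = bubble_space_path_connected [OF bubble H]
  have inj: "inj_on n {1..l}"
    using n(2) by (rule strict_mono_on_imp_inj_on)
  \<comment> \<open>The original sphere supplies the copy of n l that the k l - 1 disks leave out; k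
    l \<ge> 1 keeps the natural subtraction from truncating.\<close>
  have "replicate_mset (k l) (n l) = add_mset (n l) (replicate_mset (k l - 1) (n l))"
    using k [of l] l by (cases "k l") auto
  moreover have "{1..l} = insert l {1..<l}"
    using l by auto
  ultimately have M: "add_mset (n l) ?M = (\<Sum>j\<in>{1..l}. replicate_mset (k j) (n j))"
    by simp
  have cnt: "count (add_mset (n l) ?M) q = (\<Sum>j\<in>{1..l}. if n j = q then k j else 0)" for q
    unfolding M count_sum by (intro sum.cong) auto
  have cnt_n: "count (add_mset (n l) ?M) (n j) = k j" if j: "j \<in> {1..l}" for j
  proof -
    have "(\<Sum>i\<in>{1..l}. if n i = n j then k i else 0) = (\<Sum>i\<in>{1..l}. if i = j then k i else 0)"
      using inj_on_eq_iff [OF inj _ j] by (intro sum.cong) simp_all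
    then show ?thesis
      unfolding cnt using j by simp
  qed
  have "\<forall>j\<in>{1..l}. \<exists>A. A \<in> carrier_mat (k j) (k j) \<and> p j = det_minus_x A \<and>
      (\<forall>m. rat_hom_trace (n j) X (f ^^ m) = (\<Sum>i<k j. (A ^\<^sub>m m) $$ (i, i)))"
  proof
    fix j
    assume j: "j \<in> {1..l}"
    obtain zs where zs: "int_hom_basis (n j) X zs" "length zs = k j"
      using bubble_space_int_hom_basis [OF bubble H n(1) [OF j]] cnt_n [OF j] by auto
    obtain A where "A \<in> carrier_mat (k j) (k j)" "p j = det_minus_x A"
      "\<And>m. rat_hom_trace (n j) X (f ^^ m) = (\<Sum>i<k j. (A ^\<^sub>m m) $$ (i, i))"
      using int_hom_basis_imp_matrix [OF zs(1) f] unfolding p_def zs(2) by blast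
    then show "\<exists>A. A \<in> carrier_mat (k j) (k j) \<and> p j = det_minus_x A \<and>
        (\<forall>m. rat_hom_trace (n j) X (f ^^ m) = (\<Sum>i<k j. (A ^\<^sub>m m) $$ (i, i)))"
      by (intro exI [of _ A]) simp
  qed
  from bchoice [OF this] obtain A where A_all: "\<forall>j\<in>{1..l}. A j \<in> carrier_mat (k j) (k j) \<and>
      p j = det_minus_x (A j) \<and> (\<forall>m. rat_hom_trace (n j) X (f ^^ m) = (\<Sum>i<k j. (A j ^\<^sub>m m) $$ (i, i)))" ..
  then have A: "\<And>j. j \<in> {1..l} \<Longrightarrow> A j \<in> carrier_mat (k j) (k j)"
    and pA: "\<And>j. j \<in> {1..l} \<Longrightarrow> p j = det_minus_x (A j)"
    and trA: "\<And>j m. j \<in> {1..l} \<Longrightarrow> rat_hom_trace (n j) X (f ^^ m) = (\<Sum>i<k j. (A j ^\<^sub>m m) $$ (i, i))"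
    by blast+
  let ?R = "\<lambda>j. nonzero_complex_roots (p j)"
  have trace: "of_rat (rat_hom_trace (n j) X (f ^^ m)) = (\<Sum>z\<in>#?R j. z ^ m)"
    if "j \<in> {1..l}" "m \<ge> 1" for j m
    unfolding trA [OF that(1)] pA [OF that(1)] using A [OF that(1)] that(2) by (rule sum_diag_pow_eq_power_sum)
  \<comment> \<open>In these degrees the basis is the empty list, so the trace is an empty
    sum.\<close>
  have trace_0: "rat_hom_trace q X (f ^^ m) = 0" if q: "q \<noteq> 0" "q \<notin> n ` {1..l}" for q m
  proof -
    have "count (add_mset (n l) ?M) q = 0"
      unfolding cnt using q(2) by (intro sum.neutral) auto
    then obtain zs where zs: "int_hom_basis q X zs" "length zs = 0"
      using bubble_space_int_hom_basis [OF bubble H, of q] q(1) by auto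
    then show ?thesis
      using int_hom_basis_imp_matrix [OF zs(1) f] by (metis lessThan_0 sum.empty)
  qed
  have lefschetz: "of_rat (lefschetz_number (f ^^ m) X) =
      (\<Sum>z\<in>#{#1#} + RE. z ^ m) - (\<Sum>z\<in>#RO. z ^ m)" if m: "m \<ge> 1" for m
  proof -
    let ?t = "\<lambda>q. (-1) ^ q * rat_hom_trace q X (f ^^ m)"
    have "0 \<notin> n ` {1..l}"
      using n(1) by fastforce
    \<comment> \<open>Only degree 0 and the degrees n j can contribute. Degree 0 is distinct from
      the others because n j \<ge> 1, and it provides the additional 1 next to RE.\<close>
    moreover have "lefschetz_number (f ^^ m) X = sum ?t (insert 0 (n ` {1..l}))"
      unfolding lefschetz_number_def
      by (rule Sum_any.expand_superset) (use trace_0 in auto)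
    ultimately have "lefschetz_number (f ^^ m) X = 1 + (\<Sum>j\<in>{1..l}. ?t (n j))"
      using rat_hom_trace_0 [OF pc continuous_map_funpow [OF f, of m]] sum.reindex [OF inj, of ?t] by simp
    then have "of_rat (lefschetz_number (f ^^ m) X) = 1 + (\<Sum>j\<in>{1..l}. (-1) ^ n j * (\<Sum>z\<in>#?R j. z ^ m))"
      using trace m by (simp add: of_rat_add of_rat_sum of_rat_mult of_rat_power)
    also have "{1..l} = ?E \<union> ?O"
      by auto
    also have "(\<Sum>j\<in>?E \<union> ?O. (-1) ^ n j * (\<Sum>z\<in>#?R j. z ^ m)) =
        (\<Sum>j\<in>?E. (-1) ^ n j * (\<Sum>z\<in>#?R j. z ^ m)) + (\<Sum>j\<in>?O. (-1) ^ n j * (\<Sum>z\<in>#?R j. z ^ m))"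
      by (rule sum.union_disjoint) auto
    also have "(\<Sum>j\<in>?E. (-1) ^ n j * (\<Sum>z\<in>#?R j. z ^ m)) = (\<Sum>j\<in>?E. \<Sum>z\<in>#?R j. z ^ m)"
      by (intro sum.cong) auto
    also have "(\<Sum>j\<in>?O. (-1) ^ n j * (\<Sum>z\<in>#?R j. z ^ m)) = (\<Sum>j\<in>?O. - (\<Sum>z\<in>#?R j. z ^ m))"
    proof (rule sum.cong)
      fix j
      assume "j \<in> ?O"
      then have "(-1 :: complex) ^ n j = -1"
        by simp
      then show "(-1) ^ n j * (\<Sum>z\<in>#?R j. z ^ m) = - (\<Sum>z\<in>#?R j. z ^ m)"
        by (simp only: mult_minus_left mult_1_left)
    qed simp
    finally show ?thesis
      unfolding RO_def RE_def by (simp add: sum_mset_sum sum_negf)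
  qed
  have nz: "0 \<notin># RO" "0 \<notin># {#1#} + RE"
    by (auto simp: RO_def RE_def nonzero_complex_roots_def set_mset_sum)
  have "(\<forall>m\<ge>1. lefschetz_number (f ^^ m) X = 0) \<longleftrightarrow> RO = {#1#} + RE"
  proof
    assume L: "\<forall>m\<ge>1. lefschetz_number (f ^^ m) X = 0"
    show "RO = {#1#} + RE"
      by (rule power_sums_determine_mset [OF nz]) (use L lefschetz in force)
  next
    assume eq: "RO = {#1#} + RE"
    show "\<forall>m\<ge>1. lefschetz_number (f ^^ m) X = 0"
    proof (intro allI impI)
      fix m :: nat
      assume "m \<ge> 1"
      from lefschetz [OF this] have "of_rat (lefschetz_number (f ^^ m) X) = (0 :: complex)"
        unfolding eq by simp
      then show "lefschetz_number (f ^^ m) X = 0"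
        by simp
    qed
  qed
  \<comment> \<open>The root 1 adjoined to RE contributes the factor -1 to the product of negatives;
    it is the additional 1 in the exponent on the even side.\<close>
  moreover have "(-1) ^ (\<Sum>j\<in>?O. k j) * (\<Prod>j\<in>?O. last_term (p j)) =
      (-1) ^ (1 + (\<Sum>j\<in>?E. k j)) * (\<Prod>j\<in>?E. last_term (p j))" if eq: "RO = {#1#} + RE"
  proof -
    have prod: "of_rat ((-1) ^ (\<Sum>j\<in>J. k j) * (\<Prod>j\<in>J. last_term (p j))) = (\<Prod>z\<in>#(\<Sum>j\<in>J. ?R j). - z)"
      if "J \<subseteq> {1..l}" for J
    proof -
      have "of_rat ((-1) ^ (\<Sum>j\<in>J. k j) * (\<Prod>j\<in>J. last_term (p j))) =
          (\<Prod>j\<in>J. of_rat ((-1) ^ k j * last_term (p j)) :: complex)"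
        by (simp add: power_sum prod.distrib of_rat_mult of_rat_prod)
      also have "\<dots> = (\<Prod>j\<in>J. \<Prod>z\<in>#?R j. - z)"
        using that A pA last_term_det_minus_x by (intro prod.cong) auto
      finally show ?thesis
        by (simp add: prod_mset_sum)
    qed
    have "of_rat ((-1) ^ (\<Sum>j\<in>?O. k j) * (\<Prod>j\<in>?O. last_term (p j))) = (\<Prod>z\<in>#RO. - z)"
      unfolding RO_def by (rule prod) auto
    also have "\<dots> = - (\<Prod>z\<in>#RE. - z)"
      unfolding eq by simp
    also have "(\<Prod>z\<in>#RE. - z) = of_rat ((-1) ^ (\<Sum>j\<in>?E. k j) * (\<Prod>j\<in>?E. last_term (p j)))"
      unfolding RE_def by (rule prod [symmetric]) auto
    also have "- of_rat ((-1) ^ (\<Sum>j\<in>?E. k j) * (\<Prod>j\<in>?E. last_term (p j))) =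
        (of_rat ((-1) ^ (1 + (\<Sum>j\<in>?E. k j)) * (\<Prod>j\<in>?E. last_term (p j))) :: complex)"
      by (simp add: of_rat_minus)
    finally show ?thesis
      by (simp only: of_rat_eq_iff)
  qed
  ultimately show ?thesis
    by blast
qed

end
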